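(* Let $(\mathcal P_n,\Delta_1,\Delta_2,k)$ be any instance of ETC where $\mathcal P_n=(P_n,\mathcal T)$ is a temporal graph whose underlying graph is the path $P_n$ on $n$ vertices, and suppose there is a natural number $\sigma$ such that $|\mathcal T(e)|\le\sigma$ for every $e\in E(P_n)$. Then ETC on $(\mathcal P_n,\Delta_1,\Delta_2,k)$ is solvable in time $O(T^{4\sigma}\sigma^2 n^{2\sigma+1})$, where $T$ is the lifetime of $\mathcal P_n$.
   Context: A temporal graph $\mathcal G=(G,\mathcal T)$ consists of a finite static undirected graph $G=(V,E)$ and a function $\mathcal T:E\to 2^{\mathbb Z^+}\setminus\{\emptyset\}$ (finite sets) giving the times at which each edge appears; its time-edges are $\mathcal E(\mathcal G)=\{(e,t):e\in E,\ t\in\mathcal T(e)\}$ and its lifetime is $T(\mathcal G)=\max\{t:(e,t)\in\mathcal E(\mathcal G)\}$ (the earliest time is assumed to be $1$). Computation is in the word RAM model. An interval $[a,b]$ means the integer set $\{a,\dots,b\}$. An edge $e$ is $\Delta_1$-dense in $[a,b]$ if for every $\tau\in[a,\max\{a,b-\Delta_1+1\}]$ there is $t\in\mathcal T(e)$ with $\tau\le t\le \tau+\Delta_1-1$. A template is a pair $(X,[a,b])$ with $X$ a vertex set. Templates $(X,[a,b])$, $(Y,[c,d])$ are $\Delta_2$-independent if $X\cap Y=\emptyset$ or $|s-t|\ge\Delta_2$ for all $s\in[a,b]$, $t\in[c,d]$. $\mathcal G$ realises a collection $\{(X_i,[a_i,b_i])\}_i$ of pairwise $\Delta_2$-independent templates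 with $1\le a_i\le b_i\le T(\mathcal G)$ if every time-edge $(xy,t)$ has some $i$ with $x,y\in X_i$, $t\in[a_i,b_i]$, and for every $i$ and distinct $x,y\in X_i$, $xy$ is an edge that is $\Delta_1$-dense in $[a_i,b_i]$. $\mathcal G$ is a $(\Delta_1,\Delta_2)$-cluster temporal graph if it realises some such collection. ETC (Editing to Temporal Cliques): Input: a temporal graph $\mathcal G$ and positive integers $k,\Delta_1,\Delta_2$. Question: is there a set $\Pi$ of at most $k$ time-edge modifications (additions or deletions of time-edges) such that the modified temporal graph is a $(\Delta_1,\Delta_2)$-cluster temporal graph? *)

theory Defs
  imports Main
begin

section \<open>Temporal graphs\<close>

text \<open>Edges are two-element vertex sets; \<open>tg_times\<close> is only meaningful on \<open>tg_edges\<close>.\<close>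

record 'a temporal_graph =
  tg_verts :: "'a set"
  tg_edges :: "'a set set"
  tg_times :: "'a set \<Rightarrow> nat set"

definition is_temporal_graph :: "'a temporal_graph \<Rightarrow> bool" where
  "is_temporal_graph G \<longleftrightarrow>
     finite (tg_verts G) \<and>
     (\<forall>e\<in>tg_edges G. e \<subseteq> tg_verts G \<and> card e = 2) \<and>
     (\<forall>e\<in>tg_edges G. finite (tg_times G e) \<and> tg_times G e \<noteq> {} \<and> (\<forall>t\<in>tg_times G e. 1 \<le> t))"

definition time_edges :: "'a temporal_graph \<Rightarrow> ('a set \<times> nat) set" where
  "time_edges G = {(e, t). e \<in> tg_edges G \<and> t \<in> tg_times G e}"

text \<open>A graph without time-edges, which can arise by deleting all of them, gets lifetime 0.\<close>

definition lifetime :: "'a temporal_graph \<Rightarrow> nat" where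
  "lifetime G = (if time_edges G = {} then 0 else Max (snd ` time_edges G))"

text \<open>As times are positive, this says that the earliest time of \<open>G\<close> exists and is 1.\<close>

definition starts_at_one :: "'a temporal_graph \<Rightarrow> bool" where
  "starts_at_one G \<longleftrightarrow> 1 \<in> snd ` time_edges G"

definition is_path_graph :: "'a set \<Rightarrow> 'a set set \<Rightarrow> bool" where
  "is_path_graph V E \<longleftrightarrow>
     (\<exists>vs. distinct vs \<and> set vs = V \<and> E = {{vs ! i, vs ! Suc i} | i. Suc i < length vs})"


section \<open>Cluster temporal graphs\<close>

text \<open>
  For \<open>1 \<le> a\<close>, the truncated subtraction in \<open>max a (b + 1 - d)\<close> agrees with the integer
  value of \<open>max a (b - d + 1)\<close>.
\<close>

definition dense_in :: "'a temporal_graph \<Rightarrow> nat \<Rightarrow> 'a set \<Rightarrow> nat \<Rightarrow> nat \<Rightarrow> bool" where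
  "dense_in G d e a b \<longleftrightarrow>
     (\<forall>\<tau>\<in>{a..max a (b + 1 - d)}. \<exists>t\<in>tg_times G e. \<tau> \<le> t \<and> t \<le> \<tau> + d - 1)"

text \<open>The triple \<open>(X, a, b)\<close> stands for the template \<open>(X, [a, b])\<close>.\<close>

type_synonym 'a template = "'a set \<times> nat \<times> nat"

definition independent_templates :: "nat \<Rightarrow> 'a template \<Rightarrow> 'a template \<Rightarrow> bool" where
  "independent_templates d = (\<lambda>(X, a, b) (Y, a', b').
     X \<inter> Y = {} \<or> (\<forall>s\<in>{a..b}. \<forall>t\<in>{a'..b'}. int d \<le> \<bar>int s - int t\<bar>))"

definition realises :: "nat \<Rightarrow> nat \<Rightarrow> 'a temporal_graph \<Rightarrow> 'a template set \<Rightarrow> bool" where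
  "realises \<Delta>\<^sub>1 \<Delta>\<^sub>2 G \<C> \<longleftrightarrow>
     (\<forall>(X, a, b)\<in>\<C>. X \<subseteq> tg_verts G \<and> 1 \<le> a \<and> a \<le> b \<and> b \<le> lifetime G) \<and>
     pairwise (independent_templates \<Delta>\<^sub>2) \<C> \<and>
     (\<forall>(e, t)\<in>time_edges G. \<exists>(X, a, b)\<in>\<C>. e \<subseteq> X \<and> t \<in> {a..b}) \<and>
     (\<forall>(X, a, b)\<in>\<C>. \<forall>x\<in>X. \<forall>y\<in>X. x \<noteq> y \<longrightarrow>
        {x, y} \<in> tg_edges G \<and> dense_in G \<Delta>\<^sub>1 {x, y} a b)"

definition cluster_temporal_graph :: "nat \<Rightarrow> nat \<Rightarrow> 'a temporal_graph \<Rightarrow> bool" where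
  "cluster_temporal_graph \<Delta>\<^sub>1 \<Delta>\<^sub>2 G \<longleftrightarrow> (\<exists>\<C>. realises \<Delta>\<^sub>1 \<Delta>\<^sub>2 G \<C>)"


section \<open>Editing to Temporal Cliques\<close>

definition possible_time_edges :: "'a temporal_graph \<Rightarrow> ('a set \<times> nat) set" where
  "possible_time_edges G = {(e, t). e \<subseteq> tg_verts G \<and> card e = 2 \<and> 1 \<le> t}"

text \<open>
  The members of \<open>\<Pi>\<close> that are time-edges of \<open>G\<close> are deleted, the others are added. Edges
  enter or leave the underlying graph according to whether they still appear at some time.
\<close>

definition modify :: "'a temporal_graph \<Rightarrow> ('a set \<times> nat) set \<Rightarrow> 'a temporal_graph" where
  "modify G \<Pi> =
     (let M = (time_edges G - \<Pi>) \<union> (\<Pi> - time_edges G)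
      in \<lparr>tg_verts = tg_verts G, tg_edges = fst ` M, tg_times = (\<lambda>e. {t. (e, t) \<in> M})\<rparr>)"

definition ETC :: "'a temporal_graph \<Rightarrow> nat \<Rightarrow> nat \<Rightarrow> nat \<Rightarrow> bool" where
  "ETC G \<Delta>\<^sub>1 \<Delta>\<^sub>2 k \<longleftrightarrow>
     (\<exists>\<Pi>. \<Pi> \<subseteq> possible_time_edges G \<and> finite \<Pi> \<and> card \<Pi> \<le> k \<and>
        cluster_temporal_graph \<Delta>\<^sub>1 \<Delta>\<^sub>2 (modify G \<Pi>))"

text \<open>
  Input format for graphs on the vertex set \<open>{0..<n}\<close>: the header \<open>n, k, \<Delta>\<^sub>1, \<Delta>\<^sub>2\<close> and the
  number of edges, then for each edge, in any order and orientation, its two ends, its number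
  of appearances, and the increasing list of the times at which it appears.
\<close>

definition encodes_ETC :: "nat list \<Rightarrow> nat temporal_graph \<Rightarrow> nat \<Rightarrow> nat \<Rightarrow> nat \<Rightarrow> bool" where
  "encodes_ETC xs G \<Delta>\<^sub>1 \<Delta>\<^sub>2 k \<longleftrightarrow>
     (\<exists>n es. tg_verts G = {0..<n} \<and>
        distinct (map (\<lambda>(u, v, ts). {u, v}) es) \<and>
        tg_edges G = set (map (\<lambda>(u, v, ts). {u, v}) es) \<and>
        (\<forall>(u, v, ts)\<in>set es. ts = sorted_list_of_set (tg_times G {u, v})) \<and>
        xs = [n, k, \<Delta>\<^sub>1, \<Delta>\<^sub>2, length es] @ concat (map (\<lambda>(u, v, ts). u # v # length ts # ts) es))"


section \<open>The word RAM\<close>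

text \<open>
  Registers and memory cells hold \<open>w\<close>-bit words, represented by the naturals below \<open>2 ^ w\<close>;
  a program mentions only finitely many registers, while memory is accessed indirectly at the
  addresses below \<open>2 ^ w\<close>. Every instruction takes one unit of time.
\<close>

datatype word_op = Add | Sub | Mul | Div | Mod | And | Or | Xor | Shl | Shr | Less | Equal

datatype instr =
    LoadConst nat nat
  | Op word_op nat nat nat
  | LoadMem nat nat
  | StoreMem nat nat
  | Jump nat
  | JumpIfNonzero nat nat

type_synonym program = "instr list"

record ram_state =
  pc :: nat
  regs :: "nat \<Rightarrow> nat"
  mem :: "nat \<Rightarrow> nat"

fun op_val :: "nat \<Rightarrow> word_op \<Rightarrow> nat \<Rightarrow> nat \<Rightarrow> nat" where
  "op_val w Add x y = (x + y) mod 2 ^ w"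
| "op_val w Sub x y = (2 ^ w + x - y) mod 2 ^ w"
| "op_val w Mul x y = (x * y) mod 2 ^ w"
| "op_val w Div x y = x div y"
| "op_val w Mod x y = x mod y"
| "op_val w And x y = Bit_Operations.and x y"
| "op_val w Or x y = Bit_Operations.or x y"
| "op_val w Xor x y = Bit_Operations.xor x y"
| "op_val w Shl x y = push_bit y x mod 2 ^ w"
| "op_val w Shr x y = drop_bit y x"
| "op_val w Less x y = of_bool (x < y) mod 2 ^ w"
| "op_val w Equal x y = of_bool (x = y) mod 2 ^ w"

fun exec :: "nat \<Rightarrow> instr \<Rightarrow> ram_state \<Rightarrow> ram_state" where
  "exec w (LoadConst r c) s =
     s\<lparr>pc := Suc (pc s), regs := (regs s)(r := c mod 2 ^ w)\<rparr>"
| "exec w (Op f r p q) s =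
     s\<lparr>pc := Suc (pc s), regs := (regs s)(r := op_val w f (regs s p) (regs s q))\<rparr>"
| "exec w (LoadMem r p) s =
     s\<lparr>pc := Suc (pc s), regs := (regs s)(r := mem s (regs s p))\<rparr>"
| "exec w (StoreMem p q) s =
     s\<lparr>pc := Suc (pc s), mem := (mem s)(regs s p := regs s q)\<rparr>"
| "exec w (Jump l) s = s\<lparr>pc := l\<rparr>"
| "exec w (JumpIfNonzero r l) s = s\<lparr>pc := (if regs s r \<noteq> 0 then l else Suc (pc s))\<rparr>"

text \<open>A program halts by leaving its code.\<close>

definition halted :: "program \<Rightarrow> ram_state \<Rightarrow> bool" where
  "halted P s \<longleftrightarrow> length P \<le> pc s"

definition step :: "nat \<Rightarrow> program \<Rightarrow> ram_state \<Rightarrow> ram_state" where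
  "step w P s = (if halted P s then s else exec w (P ! pc s) s)"

definition init_state :: "nat \<Rightarrow> nat list \<Rightarrow> ram_state" where
  "init_state w xs =
     \<lparr>pc = 0, regs = (\<lambda>_. 0), mem = (\<lambda>i. if i < length xs then xs ! i mod 2 ^ w else 0)\<rparr>"

text \<open>The answer is left in register 0: 1 for yes, 0 for no.\<close>

definition decides_within :: "nat \<Rightarrow> program \<Rightarrow> nat list \<Rightarrow> bool \<Rightarrow> nat \<Rightarrow> bool" where
  "decides_within w P xs answer t \<longleftrightarrow>
     (\<exists>t'\<le>t. let s = (step w P ^^ t') (init_state w xs)
             in halted P s \<and> regs s 0 = of_bool answer)"

text \<open>
  The usual convention that words have \<open>\<Omega>(log N)\<close> bits, in the form \<open>w \<ge> c log\<^sub>2 N\<close>, where \<open>N\<close>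
  is the largest of the input words and the order \<open>b\<close> of the running time. A word can then hold
  each input number and the address of each cell that may be in use after \<open>b\<close> steps.
\<close>

definition sufficient_word_size :: "nat \<Rightarrow> nat list \<Rightarrow> nat \<Rightarrow> nat \<Rightarrow> bool" where
  "sufficient_word_size c xs b w \<longleftrightarrow> Max (insert b (set xs)) ^ c \<le> 2 ^ w"

end

theory Submission
  imports Defs
begin

text \<open>
  On a path, a template may be cut at every path edge that has no appearance during its interval,
  and its parts may be taken to be runs of consecutive vertices: an added time that is no longer
  covered is moved back to the latest covered time before it, which hits the same windows and costs
  no more. Afterwards each path edge lies in at most \<open>\<sigma>\<close> templates, because these have
  disjoint intervals and each contains an appearance of the edge. Sweeping over the path edges, it
  therefore suffices to remember at most \<open>\<sigma>\<close> triples of an interval and the first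
  vertex of the run, for which there are at most \<open>(n T\<^sup>2)\<^sup>\<sigma>\<close> choices. The
  modifications of the pairs that end at the right end of the current edge depend only on this
  state, and a greedy piercing of the windows finds the cheapest ones. A dynamic program that tries all
  pairs of consecutive states takes \<open>n (n T\<^sup>2)\<^sup>2\<^sup>\<sigma> \<sigma>\<^sup>2\<close>
  steps up to a constant; it is written in a structured language that is compiled to the word RAM.
\<close>

section \<open>A structured language and its compilation\<close>

text \<open>A state can forget the right ends of its runs: a run ends where its triple disappears,
  and the pair formed by the \<open>u\<close>-th vertex and the right end of the current edge lies
  in a template exactly when the run has started by \<open>u\<close>. So a template contributes only
  n T^2 choices. Comparing consecutive states settles independence, because two runs that share a
  vertex have a common edge or contain two adjacent edges, one each. The lifetime is an obstacle:
  the edited graph may live longer or shorter than the original one, while states range over times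
  up to the original \<open>T\<close>. Intervals are therefore truncated to \<open>T\<close> on the
  way to slots and to the new lifetime on the way back. Neither the order of the path nor \<sigma>
  is part of the input. The program starts at a vertex of degree one and takes for \<sigma> the
  largest number of appearances of an edge, in which the claimed bound is monotone. Pricing a state
  takes about n T \<sigma>^2 steps. It is done once per state and not per pair of states, and then
  it is absorbed, because n T is at most the number (n T^2)^\<sigma> of states.\<close>

datatype bop = Plus | Times | Monus | Quot | Rem | Lt | Eq

datatype expr = Con nat | Var nat | Rd expr | Bin bop expr expr

datatype com =
    Asg nat expr
  | Sto expr expr
  | Seq com com  (infixr ";;" 60)
  | Cond expr com com
  | Skip
  | For nat nat com

type_synonym store = "(nat \<Rightarrow> nat) \<times> (nat \<Rightarrow> nat)"

fun bop_val :: "bop \<Rightarrow> nat \<Rightarrow> nat \<Rightarrow> nat" where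
  "bop_val Plus x y = x + y"
| "bop_val Times x y = x * y"
| "bop_val Monus x y = x - y"
| "bop_val Quot x y = x div y"
| "bop_val Rem x y = x mod y"
| "bop_val Lt x y = of_bool (x < y)"
| "bop_val Eq x y = of_bool (x = y)"

fun ev :: "expr \<Rightarrow> store \<Rightarrow> nat" where
  "ev (Con c) s = c"
| "ev (Var x) s = fst s x"
| "ev (Rd e) s = snd s (ev e s)"
| "ev (Bin f d e) s = bop_val f (ev d s) (ev e s)"

definition incr :: "nat \<Rightarrow> store \<Rightarrow> store" where
  "incr r s = ((fst s)(r := Suc (fst s r)), snd s)"

primrec sem :: "com \<Rightarrow> store \<Rightarrow> store" where
  "sem (Asg x e) s = ((fst s)(x := ev e s), snd s)"
| "sem (Sto a e) s = (fst s, (snd s)(ev a s := ev e s))"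
| "sem (c ;; d) s = sem d (sem c s)"
| "sem (Cond e c d) s = (if ev e s \<noteq> 0 then sem c s else sem d s)"
| "sem Skip s = s"
| "sem (For r x c) s = ((\<lambda>s. incr r (sem c s)) ^^ fst s x) ((fst s)(r := 0), snd s)"

text \<open>
  Once all stored values and loop bounds are controlled by \<open>safe\<close>, overflow and running time are
  controlled syntactically by \<open>deg\<close> and \<open>cost_bound\<close>.
\<close>

primrec safe :: "nat \<Rightarrow> (nat \<Rightarrow> nat) \<Rightarrow> com \<Rightarrow> store \<Rightarrow> bool" where
  "safe Z \<rho> (Asg x e) s \<longleftrightarrow> ev e s \<le> Z"
| "safe Z \<rho> (Sto a e) s \<longleftrightarrow> ev e s \<le> Z"
| "safe Z \<rho> (c ;; d) s \<longleftrightarrow> safe Z \<rho> c s \<and> safe Z \<rho> d (sem c s)"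
| "safe Z \<rho> (Cond e c d) s \<longleftrightarrow> (if ev e s \<noteq> 0 then safe Z \<rho> c s else safe Z \<rho> d s)"
| "safe Z \<rho> Skip s \<longleftrightarrow> True"
| "safe Z \<rho> (For r x c) s \<longleftrightarrow> fst s x \<le> \<rho> x \<and>
     (\<forall>i<fst s x. safe Z \<rho> c (((\<lambda>s. incr r (sem c s)) ^^ i) ((fst s)(r := 0), snd s)))"

primrec writes :: "com \<Rightarrow> nat set" where
  "writes (Asg x e) = {x}"
| "writes (Sto a e) = {}"
| "writes (c ;; d) = writes c \<union> writes d"
| "writes (Cond e c d) = writes c \<union> writes d"
| "writes Skip = {}"
| "writes (For r x c) = insert r (writes c)"

primrec pure :: "com \<Rightarrow> bool" where
  "pure (Asg x e) \<longleftrightarrow> True"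
| "pure (Sto a e) \<longleftrightarrow> False"
| "pure (c ;; d) \<longleftrightarrow> pure c \<and> pure d"
| "pure (Cond e c d) \<longleftrightarrow> pure c \<and> pure d"
| "pure Skip \<longleftrightarrow> True"
| "pure (For r x c) \<longleftrightarrow> pure c"

lemma sem_frame: "x \<notin> writes c \<Longrightarrow> fst (sem c s) x = fst s x"
proof (induction c arbitrary: s)
  case (For r y c)
  have "fst (((\<lambda>s. incr r (sem c s)) ^^ i) s') x = fst s' x" for i s'
    using For by (induction i) (auto simp: incr_def)
  then show ?case using For.prems by simp
qed auto

lemma sem_pure: "pure c \<Longrightarrow> snd (sem c s) = snd s"
proof (induction c arbitrary: s)
  case (For r y c)
  have "snd (((\<lambda>s. incr r (sem c s)) ^^ i) s') = snd s'" for i s'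
    using For by (induction i) (auto simp: incr_def)
  then show ?case by simp
qed auto

text \<open>An exponent of growth: with all registers and cells at most \<open>Z\<close>, the value
  of \<open>e\<close> is at most \<open>Z ^ deg e\<close>. A read counts 1 since cells are small,
  and \<open>Plus\<close> adds 1 because one factor \<open>Z\<close> pays for the doubling.\<close>

fun deg :: "expr \<Rightarrow> nat" where
  "deg (Con c) = 1"
| "deg (Var x) = 1"
| "deg (Rd e) = 1"
| "deg (Bin f d e) = (case f of Plus \<Rightarrow> Suc (max (deg d) (deg e)) | Times \<Rightarrow> deg d + deg e
     | Lt \<Rightarrow> 1 | Eq \<Rightarrow> 1 | _ \<Rightarrow> deg d)"

text \<open>Registers below 64 hold program variables, the others hold intermediate values.\<close>

fun wf_expr :: "nat \<Rightarrow> expr \<Rightarrow> bool" where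
  "wf_expr D (Con c) \<longleftrightarrow> c \<le> 5"
| "wf_expr D (Var x) \<longleftrightarrow> x < 64"
| "wf_expr D (Rd e) \<longleftrightarrow> wf_expr D e"
| "wf_expr D (Bin f d e) \<longleftrightarrow> wf_expr D d \<and> wf_expr D e \<and> deg (Bin f d e) \<le> D"

primrec wf_com :: "nat \<Rightarrow> com \<Rightarrow> bool" where
  "wf_com D (Asg x e) \<longleftrightarrow> x < 64 \<and> wf_expr D e"
| "wf_com D (Sto a e) \<longleftrightarrow> wf_expr D a \<and> wf_expr D e"
| "wf_com D (c ;; d) \<longleftrightarrow> wf_com D c \<and> wf_com D d"
| "wf_com D (Cond e c d) \<longleftrightarrow> wf_expr D e \<and> wf_com D c \<and> wf_com D d"
| "wf_com D Skip \<longleftrightarrow> True"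
| "wf_com D (For r x c) \<longleftrightarrow> r < 64 \<and> x < 64 \<and> r \<noteq> x \<and> r \<notin> writes c \<and> x \<notin> writes c \<and> wf_com D c"

definition small :: "nat \<Rightarrow> store \<Rightarrow> bool" where
  "small Z s \<longleftrightarrow> (\<forall>x. fst s x \<le> Z) \<and> (\<forall>i. snd s i \<le> Z)"

lemma ev_le_power:
  assumes "small Z s" "5 \<le> Z" "wf_expr D e"
  shows "ev e s \<le> Z ^ deg e"
  using assms(3)
proof (induction e)
  case (Bin f d e)
  have le: "ev d s \<le> Z ^ deg d" "ev e s \<le> Z ^ deg e" using Bin by auto
  have Z: "1 \<le> Z" using assms by simp
  show ?case
  proof (cases f)
    case Plus
    have "ev d s + ev e s \<le> Z ^ max (deg d) (deg e) + Z ^ max (deg d) (deg e)"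
      using le power_increasing[OF max.cobounded1 Z] power_increasing[OF max.cobounded2 Z]
      by (meson add_mono le_trans)
    also have "\<dots> \<le> Z * Z ^ max (deg d) (deg e)"
      using assms(2) by (metis mult_2 mult_le_mono1 numeral_le_iff order_trans semiring_norm(69,72,68,78))
    finally show ?thesis using Plus by simp
  next
    case Times
    then show ?thesis using le by (simp add: power_add mult_mono)
  next
    case Monus
    then show ?thesis using le by simp
  next
    case Quot
    then show ?thesis using le by simp (meson div_le_dividend le_trans)
  next
    case Rem
    then show ?thesis using le by simp (meson mod_less_eq_dividend le_trans)
  next
    case Lt
    then show ?thesis using assms(2) by simp
  next
    case Eq
    then show ?thesis using assms(2) by simp
  qed
qed (use assms in \<open>auto simp: small_def\<close>)

section \<open>Code generation and its simulation on the word RAM\<close>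

fun comp_bop :: "bop \<Rightarrow> nat \<Rightarrow> instr list" where
  "comp_bop Plus d = [Op Add d d (Suc d)]"
| "comp_bop Times d = [Op Mul d d (Suc d)]"
| "comp_bop Monus d = [Op Less (Suc (Suc d)) (Suc d) d, Op Sub d d (Suc d), Op Mul d d (Suc (Suc d))]"
| "comp_bop Quot d = [Op Div d d (Suc d)]"
| "comp_bop Rem d = [Op Mod d d (Suc d)]"
| "comp_bop Lt d = [Op Less d d (Suc d)]"
| "comp_bop Eq d = [Op Equal d d (Suc d)]"

text \<open>The registers from \<open>d\<close> upwards serve as an evaluation stack: the result is
  left in \<open>d\<close>, and everything below survives, in particular the program variables. A
  bitwise \<open>Or\<close> of a register with itself is a move.\<close>

fun comp_expr :: "nat \<Rightarrow> expr \<Rightarrow> instr list" where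
  "comp_expr d (Con c) = [LoadConst d c]"
| "comp_expr d (Var x) = [Op Or d x x]"
| "comp_expr d (Rd e) = comp_expr d e @ [LoadMem d d]"
| "comp_expr d (Bin f e e') = comp_expr d e @ comp_expr (Suc d) e' @ comp_bop f d"

text \<open>Jump targets are absolute, hence the load address \<open>l\<close>. The test of a loop
  stands behind its body and is entered by a jump, so that a loop may have no round at all.\<close>

primrec compile :: "nat \<Rightarrow> com \<Rightarrow> instr list" where
  "compile l (Asg x e) = comp_expr 64 e @ [Op Or x 64 64]"
| "compile l (Sto a e) = comp_expr 64 a @ comp_expr 65 e @ [StoreMem 64 65]"
| "compile l (c ;; d) = compile l c @ compile (l + length (compile l c)) d"
| "compile l (Cond e c d) =
     (let l1 = Suc (l + length (comp_expr 64 e));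
          cd = compile l1 d;
          l2 = Suc (l1 + length cd);
          cc = compile l2 c
      in comp_expr 64 e @ [JumpIfNonzero 64 l2] @ cd @ [Jump (l2 + length cc)] @ cc)"
| "compile l Skip = []"
| "compile l (For r x c) =
     (let cc = compile (l + 2) c
      in [LoadConst r 0, Jump (l + 4 + length cc)] @ cc @ [LoadConst 64 1, Op Add r r 64]
         @ [Op Less 64 r x, JumpIfNonzero 64 (l + 2)])"

text \<open>In a loop the summand 4 stands for the two initial instructions and the final failing
  test; each round adds two instructions for the test and two for the increment.\<close>

primrec cost_bound :: "(nat \<Rightarrow> nat) \<Rightarrow> com \<Rightarrow> nat" where
  "cost_bound \<rho> (Asg x e) = Suc (length (comp_expr 64 e))"
| "cost_bound \<rho> (Sto a e) = Suc (length (comp_expr 64 a) + length (comp_expr 65 e))"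
| "cost_bound \<rho> (c ;; d) = cost_bound \<rho> c + cost_bound \<rho> d"
| "cost_bound \<rho> (Cond e c d) = length (comp_expr 64 e) + 2 + cost_bound \<rho> c + cost_bound \<rho> d"
| "cost_bound \<rho> Skip = 0"
| "cost_bound \<rho> (For r x c) = 4 + \<rho> x * (cost_bound \<rho> c + 4)"

definition code_at :: "program \<Rightarrow> nat \<Rightarrow> instr list \<Rightarrow> bool" where
  "code_at P l is \<longleftrightarrow> (\<forall>i<length is. l + i < length P \<and> P ! (l + i) = is ! i)"

lemma code_at_append [simp]:
  "code_at P l (xs @ ys) \<longleftrightarrow> code_at P l xs \<and> code_at P (l + length xs) ys"
proof
  assume L: "code_at P l (xs @ ys)"
  have "code_at P (l + length xs) ys" unfolding code_at_def
  proof (intro allI impI)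
    fix i assume "i < length ys"
    then show "l + length xs + i < length P \<and> P ! (l + length xs + i) = ys ! i"
      using L[unfolded code_at_def, rule_format, of "length xs + i"] by (simp add: ac_simps nth_append)
  qed
  moreover have "code_at P l xs" using L unfolding code_at_def by (auto simp: nth_append)
  ultimately show "code_at P l xs \<and> code_at P (l + length xs) ys" by blast
next
  assume R: "code_at P l xs \<and> code_at P (l + length xs) ys"
  show "code_at P l (xs @ ys)" unfolding code_at_def
  proof (intro allI impI)
    fix i assume i: "i < length (xs @ ys)"
    show "l + i < length P \<and> P ! (l + i) = (xs @ ys) ! i"
    proof (cases "i < length xs")
      case True
      then show ?thesis using R by (auto simp: code_at_def nth_append)
    next
      case False
      then show ?thesis using R i
        by (auto simp: code_at_def nth_append dest!: spec[of _ "i - length xs"])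
    qed
  qed
qed

lemma code_at_Cons [simp]:
  "code_at P l (x # xs) \<longleftrightarrow> l < length P \<and> P ! l = x \<and> code_at P (Suc l) xs"
  using code_at_append[of P l "[x]" xs] by (simp add: code_at_def)

lemma code_at_Nil [simp]: "code_at P l []"
  by (simp add: code_at_def)

definition reach :: "nat \<Rightarrow> program \<Rightarrow> nat \<Rightarrow> ram_state \<Rightarrow> ram_state \<Rightarrow> bool" where
  "reach w P n s s' \<longleftrightarrow> (\<exists>t\<le>n. (step w P ^^ t) s = s')"

lemma reach_refl [simp]: "reach w P n s s"
  unfolding reach_def by (intro exI[of _ 0]) simp

lemma reach_trans: "reach w P n s s' \<Longrightarrow> reach w P n' s' s'' \<Longrightarrow> reach w P (n + n') s s''"
  unfolding reach_def
proof (elim exE conjE)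
  fix t t'
  assume "t \<le> n" "(step w P ^^ t) s = s'" "t' \<le> n'" "(step w P ^^ t') s' = s''"
  then show "\<exists>t\<le>n + n'. (step w P ^^ t) s = s''"
    by (intro exI[of _ "t' + t"]) (auto simp: funpow_add)
qed

lemma reach_mono: "reach w P n s s' \<Longrightarrow> n \<le> n' \<Longrightarrow> reach w P n' s s'"
  unfolding reach_def using le_trans by blast

lemma reach_step: "reach w P 1 s (step w P s)"
  unfolding reach_def by (intro exI[of _ 1]) simp

lemma reach_exec: "pc s < length P \<Longrightarrow> P ! pc s = i \<Longrightarrow> reach w P 1 s (exec w i s)"
  using reach_step[of w P s] by (simp add: step_def halted_def)

text \<open>Only \<open>Monus\<close> takes more than one instruction: word subtraction wraps
  around, and multiplying by the comparison bit turns a negative difference into 0.\<close>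

lemma comp_bop_correct:
  assumes "code_at P (pc s) (comp_bop f d)"
    "regs s d < 2 ^ w" "regs s (Suc d) < 2 ^ w"
    "bop_val f (regs s d) (regs s (Suc d)) < 2 ^ w" "0 < w"
  shows "\<exists>s'. reach w P (length (comp_bop f d)) s s' \<and> pc s' = pc s + length (comp_bop f d) \<and>
     mem s' = mem s \<and> regs s' d = bop_val f (regs s d) (regs s (Suc d)) \<and>
     (\<forall>y<d. regs s' y = regs s y)"
proof (cases "f = Monus")
  case False
  then obtain g where g: "comp_bop f d = [Op g d d (Suc d)]"
    "op_val w g (regs s d) (regs s (Suc d)) = bop_val f (regs s d) (regs s (Suc d))"
    using assms by (cases f) auto
  have "reach w P 1 s (exec w (Op g d d (Suc d)) s)"
    using assms(1) g(1) by (intro reach_exec) auto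
  then show ?thesis using g
    by (intro exI[of _ "exec w (Op g d d (Suc d)) s"]) auto
next
  case True
  let ?s1 = "exec w (Op Less (Suc (Suc d)) (Suc d) d) s"
  let ?s2 = "exec w (Op Sub d d (Suc d)) ?s1"
  let ?s3 = "exec w (Op Mul d d (Suc (Suc d))) ?s2"
  have 1: "reach w P 1 s ?s1" using assms True by (intro reach_exec) auto
  have 2: "reach w P 1 ?s1 ?s2" using assms True by (intro reach_exec) auto
  have 3: "reach w P 1 ?s2 ?s3" using assms True by (intro reach_exec) auto
  have "reach w P (1 + 1 + 1) s ?s3" by (rule reach_trans[OF reach_trans[OF 1 2] 3])
  moreover have "regs ?s3 d = regs s d - regs s (Suc d)"
  proof (cases "regs s (Suc d) < regs s d")
    case lt: True
    have "(2 ^ w + regs s d - regs s (Suc d)) mod 2 ^ w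
        = (2 ^ w + (regs s d - regs s (Suc d))) mod 2 ^ w" using lt by simp
    also have "\<dots> = regs s d - regs s (Suc d)" using assms(2) by simp
    finally show ?thesis using lt assms by (simp add: mod_mult_left_eq)
  next
    case False
    then show ?thesis by simp
  qed
  moreover have "length (comp_bop f d) = 1 + 1 + 1" using True by simp
  ultimately show ?thesis using True
    by (intro exI[of _ ?s3] conjI) (simp_all only:, simp_all)
qed

definition evaluated :: "nat \<Rightarrow> program \<Rightarrow> nat \<Rightarrow> expr \<Rightarrow> store \<Rightarrow> ram_state \<Rightarrow> ram_state \<Rightarrow> bool" where
  "evaluated w P d e \<sigma> s s' \<longleftrightarrow> reach w P (length (comp_expr d e)) s s' \<and>
     pc s' = pc s + length (comp_expr d e) \<and> mem s' = mem s \<and> regs s' d = ev e \<sigma> \<and>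
     (\<forall>y<d. regs s' y = regs s y)"

lemma comp_expr_correct:
  assumes "code_at P (pc s) (comp_expr d e)" "wf_expr D e" "64 \<le> d"
    "\<forall>y<64. regs s y = fst \<sigma> y" "mem s = snd \<sigma>" "small Z \<sigma>" "5 \<le> Z" "Z ^ D < 2 ^ w" "0 < D"
  shows "\<exists>s'. evaluated w P d e \<sigma> s s'"
  unfolding evaluated_def using assms(1-5)
proof (induction e arbitrary: d s)
  case (Con c)
  have "Z ^ 1 \<le> Z ^ D" by (rule power_increasing) (use assms in auto)
  then have "c < 2 ^ w" using Con assms(7,8) by simp
  moreover have "reach w P 1 s (exec w (LoadConst d c) s)"
    using Con by (intro reach_exec) auto
  ultimately show ?case using Con
    by (intro exI[of _ "exec w (LoadConst d c) s"]) auto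
next
  case (Var x)
  moreover from this have "reach w P 1 s (exec w (Op Or d x x) s)"
    by (intro reach_exec) auto
  ultimately show ?case
    by (intro exI[of _ "exec w (Op Or d x x) s"]) auto
next
  case (Rd e)
  from Rd obtain s1 where s1: "reach w P (length (comp_expr d e)) s s1"
    "pc s1 = pc s + length (comp_expr d e)" "mem s1 = mem s" "regs s1 d = ev e \<sigma>"
    "\<forall>y<d. regs s1 y = regs s y" by force
  have "reach w P 1 s1 (exec w (LoadMem d d) s1)"
    using Rd.prems s1 by (intro reach_exec) auto
  from reach_trans[OF s1(1) this] show ?case using s1 Rd.prems
    by (intro exI[of _ "exec w (LoadMem d d) s1"]) auto
next
  case (Bin f e e')
  from Bin.IH(1)[of s d] Bin.prems obtain s1 where s1: "reach w P (length (comp_expr d e)) s s1"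
    "pc s1 = pc s + length (comp_expr d e)" "mem s1 = mem s" "regs s1 d = ev e \<sigma>"
    "\<forall>y<d. regs s1 y = regs s y" by force
  have "\<exists>s'. reach w P (length (comp_expr (Suc d) e')) s1 s' \<and>
    pc s' = pc s1 + length (comp_expr (Suc d) e') \<and>
    mem s' = mem s1 \<and> regs s' (Suc d) = ev e' \<sigma> \<and> (\<forall>y<Suc d. regs s' y = regs s1 y)"
    using Bin.prems s1 by (intro Bin.IH(2)) auto
  then obtain s2 where s2: "reach w P (length (comp_expr (Suc d) e')) s1 s2"
    "pc s2 = pc s1 + length (comp_expr (Suc d) e')" "mem s2 = mem s1" "regs s2 (Suc d) = ev e' \<sigma>"
    "\<forall>y<Suc d. regs s2 y = regs s1 y" by blast
  have lt: "ev g \<sigma> < 2 ^ w" if "wf_expr D g" for g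
  proof -
    have "deg g \<le> D" using that assms(9) by (cases g) auto
    then have "Z ^ deg g \<le> Z ^ D" using assms(7) by (intro power_increasing) auto
    then show ?thesis using ev_le_power[OF assms(6,7) that] assms(8) by linarith
  qed
  have regs2: "regs s2 d = ev e \<sigma>" using s1 s2 by simp
  have "0 < w" using assms(7,8,9) by (cases w) auto
  then have "\<exists>s'. reach w P (length (comp_bop f d)) s2 s' \<and> pc s' = pc s2 + length (comp_bop f d) \<and>
     mem s' = mem s2 \<and> regs s' d = bop_val f (regs s2 d) (regs s2 (Suc d)) \<and>
     (\<forall>y<d. regs s' y = regs s2 y)"
    using Bin.prems lt[of e] lt[of e'] lt[of "Bin f e e'"] regs2 s2 s1
    by (intro comp_bop_correct) (auto simp: add.assoc)
  then obtain s3 where s3: "reach w P (length (comp_bop f d)) s2 s3"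
     "pc s3 = pc s2 + length (comp_bop f d)"
     "mem s3 = mem s2" "regs s3 d = bop_val f (regs s2 d) (regs s2 (Suc d))"
     "\<forall>y<d. regs s3 y = regs s2 y" by blast
  show ?case
    using reach_trans[OF reach_trans[OF s1(1) s2(1)] s3(1)] s1 s2 s3 regs2
    by (intro exI[of _ s3]) (auto simp: add.assoc)
qed

definition agree :: "store \<Rightarrow> nat \<Rightarrow> ram_state \<Rightarrow> bool" where
  "agree \<sigma> l s \<longleftrightarrow> pc s = l \<and> mem s = snd \<sigma> \<and> (\<forall>y<64. regs s y = fst \<sigma> y)"

text \<open>Smallness of the store is carried through the same induction as the simulation: together
  with \<open>Z ^ D < 2 ^ w\<close> it ensures that no value of a well-formed expression wraps
  around, so that word arithmetic agrees with that of the naturals at every instruction.\<close>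

theorem comp_correct:
  assumes "code_at P l (compile l c)" "wf_com D c" "safe Z \<rho> c \<sigma>" "small Z \<sigma>" "agree \<sigma> l s"
    "5 \<le> Z" "Z ^ D < 2 ^ w" "0 < D"
  shows "small Z (sem c \<sigma>) \<and>
    (\<exists>s'. reach w P (cost_bound \<rho> c) s s' \<and> agree (sem c \<sigma>) (l + length (compile l c)) s')"
  using assms(1-5)
proof (induction c arbitrary: l \<sigma> s)
  case (Asg x e)
  have "\<exists>s'. evaluated w P 64 e \<sigma> s s'"
    by (rule comp_expr_correct[OF _ _ _ _ _ Asg.prems(4) assms(6-8)])
      (use Asg.prems in \<open>auto simp: agree_def\<close>)
  then obtain s1 where "evaluated w P 64 e \<sigma> s s1" by blast
  note s1 = this[unfolded evaluated_def, THEN conjunct1] this[unfolded evaluated_def, THEN conjunct2]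
  have "reach w P 1 s1 (exec w (Op Or x 64 64) s1)"
    using Asg.prems s1 by (intro reach_exec) (auto simp: agree_def)
  from reach_trans[OF s1(1) this] show ?case using Asg.prems s1
    by (intro conjI exI[of _ "exec w (Op Or x 64 64) s1"]) (auto simp: agree_def small_def)
next
  case (Sto a e)
  have "\<exists>s'. evaluated w P 64 a \<sigma> s s'"
    by (rule comp_expr_correct[OF _ _ _ _ _ Sto.prems(4) assms(6-8)])
      (use Sto.prems in \<open>auto simp: agree_def\<close>)
  then obtain s1 where "evaluated w P 64 a \<sigma> s s1" by blast
  note s1 = this[unfolded evaluated_def, THEN conjunct1] this[unfolded evaluated_def, THEN conjunct2]
  have "\<exists>s'. evaluated w P 65 e \<sigma> s1 s'"
    by (rule comp_expr_correct[OF _ _ _ _ _ Sto.prems(4) assms(6-8)])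
      (use Sto.prems s1 in \<open>auto simp: agree_def\<close>)
  then obtain s2 where "evaluated w P 65 e \<sigma> s1 s2" by blast
  note s2 = this[unfolded evaluated_def, THEN conjunct1] this[unfolded evaluated_def, THEN conjunct2]
  have "reach w P 1 s2 (exec w (StoreMem 64 65) s2)"
    using Sto.prems s1 s2 by (intro reach_exec) (auto simp: agree_def add.assoc)
  from reach_trans[OF reach_trans[OF s1(1) s2(1)] this] show ?case using Sto.prems s1 s2
    by (intro conjI exI[of _ "exec w (StoreMem 64 65) s2"]) (auto simp: agree_def small_def)
next
  case (Seq c d)
  from Seq.IH(1)[of l \<sigma> s] Seq.prems obtain s1 where s1: "small Z (sem c \<sigma>)"
    "reach w P (cost_bound \<rho> c) s s1" "agree (sem c \<sigma>) (l + length (compile l c)) s1" by auto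
  from Seq.IH(2)[of "l + length (compile l c)" "sem c \<sigma>" s1] Seq.prems s1
  obtain s2 where s2: "small Z (sem d (sem c \<sigma>))" "reach w P (cost_bound \<rho> d) s1 s2"
    "agree (sem d (sem c \<sigma>)) (l + length (compile l c) + length (compile (l + length (compile l c)) d)) s2"
    by auto
  show ?case using reach_trans[OF s1(2) s2(2)] s2
    by (auto simp: add.assoc intro!: exI[of _ s2])
next
  case (Cond e c d)
  define l1 where "l1 = Suc (l + length (comp_expr 64 e))"
  define l2 where "l2 = Suc (l1 + length (compile l1 d))"
  define le where "le = l2 + length (compile l2 c)"
  have code: "code_at P l (comp_expr 64 e)" "l + length (comp_expr 64 e) < length P"
    "P ! (l + length (comp_expr 64 e)) = JumpIfNonzero 64 l2"
    "code_at P l1 (compile l1 d)" "l1 + length (compile l1 d) < length P"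
    "P ! (l1 + length (compile l1 d)) = Jump le" "code_at P l2 (compile l2 c)"
    using Cond.prems(1) by (auto simp: Let_def l1_def l2_def le_def)
  have len: "l + length (compile l (Cond e c d)) = le"
    by (auto simp: Let_def l1_def l2_def le_def)
  have "\<exists>s'. evaluated w P 64 e \<sigma> s s'"
    by (rule comp_expr_correct[OF _ _ _ _ _ Cond.prems(4) assms(6-8)])
      (use Cond.prems code in \<open>auto simp: agree_def\<close>)
  then obtain s1 where "evaluated w P 64 e \<sigma> s s1" by blast
  note s1 = this[unfolded evaluated_def, THEN conjunct1] this[unfolded evaluated_def, THEN conjunct2]
  let ?s2 = "exec w (JumpIfNonzero 64 l2) s1"
  have 2: "reach w P (length (comp_expr 64 e) + 1) s ?s2"
    using Cond.prems code s1 by (intro reach_trans[OF s1(1)] reach_exec) (auto simp: agree_def)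
  show ?case
  proof (cases "ev e \<sigma> = 0")
    case True
    have "agree \<sigma> l1 ?s2" using True s1 Cond.prems(5) by (auto simp: agree_def l1_def)
    with Cond.IH(2)[of l1 \<sigma> ?s2] Cond.prems True code obtain s3 where
      s3: "small Z (sem d \<sigma>)" "reach w P (cost_bound \<rho> d) ?s2 s3"
      "agree (sem d \<sigma>) (l1 + length (compile l1 d)) s3" by auto
    have "reach w P 1 s3 (exec w (Jump le) s3)"
      using s3 code by (intro reach_exec) (auto simp: agree_def)
    from reach_trans[OF reach_trans[OF 2 s3(2)] this]
    have "reach w P (cost_bound \<rho> (Cond e c d)) s (exec w (Jump le) s3)"
      by (rule reach_mono) simp
    then show ?thesis unfolding len using s3 True
      by (intro conjI exI[of _ "exec w (Jump le) s3"]) (auto simp: agree_def)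
  next
    case False
    have "agree \<sigma> l2 ?s2" using False s1 Cond.prems(5) by (auto simp: agree_def)
    with Cond.IH(1)[of l2 \<sigma> ?s2] Cond.prems False code obtain s3 where
      s3: "small Z (sem c \<sigma>)" "reach w P (cost_bound \<rho> c) ?s2 s3"
      "agree (sem c \<sigma>) (l2 + length (compile l2 c)) s3" by auto
    from reach_trans[OF 2 s3(2)]
    have "reach w P (cost_bound \<rho> (Cond e c d)) s s3"
      by (rule reach_mono) simp
    then show ?thesis unfolding len using s3 False
      by (intro conjI exI[of _ s3]) (auto simp: agree_def le_def)
  qed
next
  case Skip
  then show ?case by (auto intro: exI[of _ s])
next
  case (For r x c)
  define lt where "lt = l + 4 + length (compile (l + 2) c)"
  have code: "l < length P" "P ! l = LoadConst r 0" "Suc l < length P" "P ! Suc l = Jump lt"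
    "code_at P (l + 2) (compile (l + 2) c)" "lt - 2 < length P" "lt - 1 < length P"
    "P ! (lt - 2) = LoadConst 64 1" "P ! (lt - 1) = Op Add r r 64"
    "lt < length P" "Suc lt < length P"
    "P ! lt = Op Less 64 r x" "P ! Suc lt = JumpIfNonzero 64 (l + 2)"
    using For.prems(1) by (auto simp: Let_def lt_def add.commute add.left_commute numeral_eq_Suc)
  have len: "l + length (compile l (For r x c)) = Suc (Suc lt)"
    by (simp add: Let_def lt_def)
  have w: "2 \<le> (2::nat) ^ w"
  proof -
    have "Z ^ 1 \<le> Z ^ D" by (rule power_increasing) (use assms in auto)
    then have "5 < (2::nat) ^ w" using assms by simp
    then show ?thesis by simp
  qed
  let ?n = "fst \<sigma> x"
  define it where "it i = ((\<lambda>s. incr r (sem c s)) ^^ i) ((fst \<sigma>)(r := 0), snd \<sigma>)" for i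
  have Zw: "Z < 2 ^ w"
  proof -
    have "Z ^ 1 \<le> Z ^ D" by (rule power_increasing) (use assms in auto)
    then show ?thesis using assms by simp
  qed
  have wf: "r < 64" "x < 64" "r \<noteq> x" "r \<notin> writes c" "x \<notin> writes c" "wf_com D c"
    using For.prems by auto
  have it0: "it 0 = ((fst \<sigma>)(r := 0), snd \<sigma>)" and itS: "it (Suc i) = incr r (sem c (it i))" for i
    by (auto simp: it_def)
  have it_r: "fst (it i) r = i" and it_x: "fst (it i) x = ?n" for i
    using wf by (induction i) (auto simp: it0 itS incr_def sem_frame)
  have sf: "safe Z \<rho> c (it i)" if "i < ?n" for i
    using For.prems(3) that by (simp add: it_def)
  have rho: "?n \<le> \<rho> x" using For.prems(3) by simp
  have nZ: "?n \<le> Z" using For.prems(4) by (simp add: small_def)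
  \<comment> \<open>The rounds are cut at the loop test \<open>lt\<close>, where control is before
    the first round as well as before the last test; one statement thus serves entry, rounds and
    exit.\<close>
  have main: "small Z (it i) \<and> (\<exists>s'. reach w P (2 + i * (cost_bound \<rho> c + 4)) s s' \<and> agree (it i) lt s')"
    if "i \<le> ?n" for i
    using that
  proof (induction i)
    case 0
    let ?s1 = "exec w (LoadConst r 0) s"
    let ?s2 = "exec w (Jump lt) ?s1"
    have "reach w P 1 s ?s1" "reach w P 1 ?s1 ?s2"
      using For.prems(5) code by - (rule reach_exec; auto simp: agree_def)+
    from reach_trans[OF this] show ?case using For.prems(4,5)
      by (intro conjI exI[of _ ?s2]) (auto simp: agree_def it0 small_def numeral_2_eq_2)
  next
    case (Suc i)
    then obtain s1 where s1: "small Z (it i)" "reach w P (2 + i * (cost_bound \<rho> c + 4)) s s1"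
      "agree (it i) lt s1" by auto
    let ?s2 = "exec w (Op Less 64 r x) s1"
    let ?s3 = "exec w (JumpIfNonzero 64 (l + 2)) ?s2"
    have 1: "reach w P 1 s1 ?s2" "reach w P 1 ?s2 ?s3"
      using s1 code by - (rule reach_exec; auto simp: agree_def)+
    have "agree (it i) (l + 2) ?s3"
      using s1 it_r it_x Suc.prems wf w by (auto simp: agree_def)
    with For.IH[of "l + 2" "it i" ?s3] code wf sf[of i] Suc.prems s1 obtain s4 where
      s4: "small Z (sem c (it i))" "reach w P (cost_bound \<rho> c) ?s3 s4"
      "agree (sem c (it i)) (lt - 2) s4" by (auto simp: lt_def)
    let ?s5 = "exec w (LoadConst 64 1) s4"
    let ?s6 = "exec w (Op Add r r 64) ?s5"
    have [simp]: "Suc (lt - 2) = lt - 1" "Suc (lt - Suc 0) = lt" by (auto simp: lt_def)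
    have 2: "reach w P 1 s4 ?s5" "reach w P 1 ?s5 ?s6"
      using s4 code by - (rule reach_exec; auto simp: agree_def)+
    have r: "fst (sem c (it i)) r = i" using sem_frame[OF wf(4)] it_r by simp
    have "0 < w" using w by (cases w) auto
    then have "agree (it (Suc i)) lt ?s6"
      using s4(3) wf w r Suc.prems nZ Zw by (auto simp: agree_def itS incr_def)
    moreover have "small Z (it (Suc i))" using s4(1) r Suc.prems nZ
      by (auto simp: itS incr_def small_def)
    moreover have "reach w P (2 + Suc i * (cost_bound \<rho> c + 4)) s ?s6"
      by (rule reach_mono[OF reach_trans[OF reach_trans[OF reach_trans[OF s1(2)
            reach_trans[OF 1]] s4(2)] reach_trans[OF 2]]]) simp
    ultimately show ?case by blast
  qed
  from main[of ?n] obtain s1 where s1: "small Z (it ?n)"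
    "reach w P (2 + ?n * (cost_bound \<rho> c + 4)) s s1" "agree (it ?n) lt s1" by auto
  let ?s2 = "exec w (Op Less 64 r x) s1"
  let ?s3 = "exec w (JumpIfNonzero 64 (l + 2)) ?s2"
  have 1: "reach w P 1 s1 ?s2" "reach w P 1 ?s2 ?s3"
    using s1 code by - (rule reach_exec; auto simp: agree_def)+
  have ag: "agree (it ?n) (Suc (Suc lt)) ?s3"
    using s1 it_r[of ?n] it_x[of ?n] wf by (auto simp: agree_def)
  have "?n * (cost_bound \<rho> c + 4) \<le> \<rho> x * (cost_bound \<rho> c + 4)" using rho by (rule mult_le_mono1)
  then have "reach w P (cost_bound \<rho> (For r x c)) s ?s3"
    by (intro reach_mono[OF reach_trans[OF s1(2) reach_trans[OF 1]]]) simp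
  moreover have "sem (For r x c) \<sigma> = it ?n" by (simp add: it_def)
  ultimately show ?case unfolding len using ag s1(1) by auto
qed

section \<open>Verification conditions\<close>

definition wp :: "nat \<Rightarrow> (nat \<Rightarrow> nat) \<Rightarrow> com \<Rightarrow> (store \<Rightarrow> bool) \<Rightarrow> store \<Rightarrow> bool" where
  "wp Z \<rho> c Q s \<longleftrightarrow> safe Z \<rho> c s \<and> Q (sem c s)"

lemma wp_simps [simp]:
  "wp Z \<rho> (Asg x e) Q (R, h) \<longleftrightarrow> ev e (R, h) \<le> Z \<and> Q (R(x := ev e (R, h)), h)"
  "wp Z \<rho> (Sto a e) Q (R, h) \<longleftrightarrow> ev e (R, h) \<le> Z \<and> Q (R, h(ev a (R, h) := ev e (R, h)))"
  "wp Z \<rho> (c ;; d) Q s \<longleftrightarrow> wp Z \<rho> c (wp Z \<rho> d Q) s"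
  "wp Z \<rho> Skip Q s \<longleftrightarrow> Q s"
  "wp Z \<rho> (Cond e c d) Q s \<longleftrightarrow> (if ev e s \<noteq> 0 then wp Z \<rho> c Q s else wp Z \<rho> d Q s)"
  by (auto simp: wp_def)

text \<open>The frame is built into weakening: registers that are not written and, for pure code,
  the whole memory may be taken as unchanged. Specifications of blocks can therefore speak about
  their outputs alone.\<close>

lemma wp_conseq:
  assumes "wp Z \<rho> c Q s"
    and "\<And>R h. Q (R, h) \<Longrightarrow> (\<And>x. x \<notin> writes c \<Longrightarrow> R x = fst s x) \<Longrightarrow> (pure c \<Longrightarrow> h = snd s) \<Longrightarrow> Q' (R, h)"
  shows "wp Z \<rho> c Q' s"
  using assms(1) assms(2)[of "fst (sem c s)" "snd (sem c s)"] sem_frame[of _ c s] sem_pure[of c s]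
  by (auto simp: wp_def)

text \<open>The invariant depends on the number of finished rounds and is stated for the store after
  the increment of the counter. As in \<open>wp_conseq\<close>, the frame is supplied, so an
  invariant only describes what the body changes.\<close>

lemma wp_For:
  assumes wf: "r \<noteq> x \<and> r \<notin> writes c \<and> x \<notin> writes c" and bound: "R x \<le> \<rho> x"
    and init: "I 0 (R(r := 0)) h"
    and body: "\<And>i R' h'. i < R x \<Longrightarrow> R' r = i \<Longrightarrow> (\<And>y. y \<notin> insert r (writes c) \<Longrightarrow> R' y = R y) \<Longrightarrow>
      (pure c \<Longrightarrow> h' = h) \<Longrightarrow> I i R' h' \<Longrightarrow>
      wp Z \<rho> c (\<lambda>(R'', h''). I (Suc i) (R''(r := Suc i)) h'') (R', h')"
    and fin: "\<And>R' h'. I (R x) R' h' \<Longrightarrow> (\<And>y. y \<notin> insert r (writes c) \<Longrightarrow> R' y = R y) \<Longrightarrow>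
      (pure c \<Longrightarrow> h' = h) \<Longrightarrow> Q (R', h')"
  shows "wp Z \<rho> (For r x c) Q (R, h)"
proof -
  define it where "it i = ((\<lambda>s. incr r (sem c s)) ^^ i) (R(r := 0), h)" for i
  have it0: "it 0 = (R(r := 0), h)" and itS: "it (Suc i) = incr r (sem c (it i))" for i
    by (auto simp: it_def)
  have r: "fst (it i) r = i" for i
    using wf by (induction i) (auto simp: it0 itS incr_def sem_frame)
  have fr: "fst (it i) y = R y" if "y \<notin> insert r (writes c)" for i y
    using that by (induction i) (auto simp: it0 itS incr_def sem_frame)
  have pu: "snd (it i) = h" if "pure c" for i
    using that by (induction i) (auto simp: it0 itS incr_def sem_pure)
  have st: "safe Z \<rho> c (it i) \<and> I (Suc i) (fst (it (Suc i))) (snd (it (Suc i)))"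
    if "i < R x" "I i (fst (it i)) (snd (it i))" for i
  proof -
    have "wp Z \<rho> c (\<lambda>(R'', h''). I (Suc i) (R''(r := Suc i)) h'') (fst (it i), snd (it i))"
      using that r fr pu by (intro body) auto
    moreover have "fst (sem c (it i)) r = i" using sem_frame[of r c] wf r by simp
    ultimately show ?thesis by (simp add: wp_def itS incr_def case_prod_beta)
  qed
  have I: "i \<le> R x \<Longrightarrow> I i (fst (it i)) (snd (it i))" for i
  proof (induction i)
    case 0
    show ?case unfolding it0 fst_conv snd_conv by (rule init)
  next
    case (Suc i)
    then show ?case using st[of i] by simp
  qed
  have "safe Z \<rho> (For r x c) (R, h)"
    using bound st I by (auto simp: it_def[symmetric])
  moreover have "sem (For r x c) (R, h) = (fst (it (R x)), snd (it (R x)))" by (simp add: it_def)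
  moreover have "Q (fst (it (R x)), snd (it (R x)))"
    using I[of "R x"] fr pu by (intro fin) auto
  ultimately show ?thesis by (simp add: wp_def)
qed

section \<open>Editing a single vertex pair\<close>

definition cover :: "(nat \<times> nat) set \<Rightarrow> nat set" where
  "cover A = (\<Union>(a, b)\<in>A. {a..b})"

text \<open>The starts of the windows in \<open>dense_in\<close>. An interval shorter than
  \<open>d\<close> has just the window starting at \<open>a\<close>, which reaches beyond
  \<open>b\<close>.\<close>

definition is_start :: "nat \<Rightarrow> (nat \<times> nat) set \<Rightarrow> nat \<Rightarrow> bool" where
  "is_start d A \<tau> \<longleftrightarrow> (\<exists>(a, b)\<in>A. a \<le> \<tau> \<and> \<tau> \<le> max a (b + 1 - d))"

text \<open>One condition for all of \<open>A\<close>: since the window of a short interval reaches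
  beyond it, the time that hits the window may belong to another interval.\<close>

definition feasible :: "nat \<Rightarrow> (nat \<times> nat) set \<Rightarrow> nat set \<Rightarrow> bool" where
  "feasible d A M \<longleftrightarrow> M \<subseteq> cover A \<and> (\<forall>\<tau>. is_start d A \<tau> \<longrightarrow> (\<exists>t\<in>M. \<tau> \<le> t \<and> t \<le> \<tau> + d - 1))"

text \<open>For a window start this is the last covered time of the window, each interval
  contributing its own last time in reach. The 0 is the default when no interval begins in
  time.\<close>

definition latest :: "nat \<Rightarrow> (nat \<times> nat) set \<Rightarrow> nat \<Rightarrow> nat" where
  "latest d A \<tau> = Max (insert 0 ((\<lambda>(a, b). min b (\<tau> + d - 1)) ` {(a, b) \<in> A. a \<le> \<tau> + d - 1}))"

text \<open>
  \<open>F\<close> is the set of free times; the result consists of the time chosen last and the number of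
  chosen times.
\<close>

fun greedy :: "nat \<Rightarrow> (nat \<times> nat) set \<Rightarrow> nat set \<Rightarrow> nat \<Rightarrow> nat \<times> nat" where
  "greedy d A F 0 = (0, 0)"
| "greedy d A F (Suc i) = (let (l, c) = greedy d A F i in
     if is_start d A (Suc i) \<and> l < Suc i \<and> \<not> (\<exists>t\<in>F. Suc i \<le> t \<and> t \<le> i + d)
     then (latest d A (Suc i), Suc c) else (l, c))"

text \<open>Original times outside the cover have to be deleted; those inside cost nothing to keep
  and are the free times of the greedy choice.\<close>

definition edit_cost :: "nat \<Rightarrow> nat \<Rightarrow> (nat \<times> nat) set \<Rightarrow> nat set \<Rightarrow> nat" where
  "edit_cost d T A O' = snd (greedy d A (O' \<inter> cover A) T) + card (O' - cover A)"

definition intervals_ok :: "nat \<Rightarrow> (nat \<times> nat) set \<Rightarrow> bool" where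
  "intervals_ok T A \<longleftrightarrow> (\<forall>(a, b)\<in>A. 1 \<le> a \<and> a \<le> b \<and> b \<le> T)"

lemma intervals_ok_finite: "intervals_ok T A \<Longrightarrow> finite A"
  by (rule finite_subset[of _ "{..T} \<times> {..T}"]) (auto simp: intervals_ok_def)

lemma cover_subset: "intervals_ok T A \<Longrightarrow> cover A \<subseteq> {1..T}"
  by (fastforce simp: intervals_ok_def cover_def)

lemma cover_finite: "intervals_ok T A \<Longrightarrow> finite (cover A)"
  using cover_subset finite_subset by blast

lemma latest_props:
  assumes "intervals_ok T A" "is_start d A \<tau>" "0 < d"
  shows "latest d A \<tau> \<in> cover A" "\<tau> \<le> latest d A \<tau>" "latest d A \<tau> \<le> \<tau> + d - 1"
    "\<And>t. t \<in> cover A \<Longrightarrow> t \<le> \<tau> + d - 1 \<Longrightarrow> t \<le> latest d A \<tau>"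
proof -
  let ?L = "(\<lambda>(a, b). min b (\<tau> + d - 1)) ` {(a, b) \<in> A. a \<le> \<tau> + d - 1}"
  have fin: "finite (insert 0 ?L)"
    using intervals_ok_finite[OF assms(1)] by (auto intro: finite_subset[of _ A])
  obtain a b where ab: "(a, b) \<in> A" "a \<le> \<tau>" "\<tau> \<le> max a (b + 1 - d)"
    using assms(2) by (auto simp: is_start_def)
  then have b: "a \<le> b" "1 \<le> a" "\<tau> \<le> b" using assms(1,3) by (auto simp: intervals_ok_def)
  have upper: "t \<le> latest d A \<tau>" if "t \<in> cover A" "t \<le> \<tau> + d - 1" for t
  proof -
    from that obtain a' b' where "(a', b') \<in> A" "a' \<le> t" "t \<le> b'" by (auto simp: cover_def)
    then have "min b' (\<tau> + d - 1) \<in> ?L" "t \<le> min b' (\<tau> + d - 1)" using that by (force, simp)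
    then show ?thesis unfolding latest_def using fin by (meson Max_ge insertI2 le_trans)
  qed
  then show "\<And>t. t \<in> cover A \<Longrightarrow> t \<le> \<tau> + d - 1 \<Longrightarrow> t \<le> latest d A \<tau>" .
  have "\<tau> \<in> cover A" using ab b by (force simp: cover_def)
  with upper[of \<tau>] assms(3) show le: "\<tau> \<le> latest d A \<tau>" by simp
  have "latest d A \<tau> \<in> insert 0 ?L" unfolding latest_def using fin by (intro Max_in) auto
  moreover have "latest d A \<tau> \<noteq> 0" using le b ab by linarith
  ultimately obtain a' b' where *: "(a', b') \<in> A" "a' \<le> \<tau> + d - 1" "latest d A \<tau> = min b' (\<tau> + d - 1)"
    by auto
  then show "latest d A \<tau> \<le> \<tau> + d - 1" by simp
  have "a' \<le> b'" using * assms(1) by (auto simp: intervals_ok_def)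
  then show "latest d A \<tau> \<in> cover A" using * by (auto simp: cover_def intro!: bexI[of _ "(a', b')"])
qed

text \<open>
  Lower bound: the windows at which a time is chosen meet \<open>cover A\<close> in disjoint sets
  without free times, as each of them starts after the time chosen for its predecessor.
\<close>

lemma greedy_invariant:
  assumes ok: "intervals_ok T A" and d: "0 < d" and F: "F \<subseteq> cover A"
  shows "\<exists>M. F \<subseteq> M \<and> M \<subseteq> cover A \<and> card (M - F) = snd (greedy d A F i) \<and>
      M - F \<subseteq> {..fst (greedy d A F i)} \<and> fst (greedy d A F i) \<le> i + d - 1 \<and>
      (fst (greedy d A F i) = 0 \<or> fst (greedy d A F i) \<in> M) \<and>
      (\<forall>\<tau>. 1 \<le> \<tau> \<and> \<tau> \<le> i \<and> is_start d A \<tau> \<longrightarrow> (\<exists>t\<in>M. \<tau> \<le> t \<and> t \<le> \<tau> + d - 1))"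
    and "feasible d A M' \<Longrightarrow> snd (greedy d A F i) \<le> card ((M' - F) \<inter> {..fst (greedy d A F i)})"
proof (induction i)
  case 0
  { case 1 show ?case using F by (intro exI[of _ F]) auto }
  { case 2 show ?case by simp }
next
  case (Suc i)
  obtain l c where lc: "greedy d A F i = (l, c)" by force
  let ?new = "is_start d A (Suc i) \<and> l < Suc i \<and> \<not> (\<exists>t\<in>F. Suc i \<le> t \<and> t \<le> i + d)"
  let ?p = "latest d A (Suc i)"
  note p = latest_props[OF ok _ d, of "Suc i"]
  {
    case 1
    obtain M where M: "F \<subseteq> M" "M \<subseteq> cover A" "card (M - F) = c" "M - F \<subseteq> {..l}" "l \<le> i + d - 1"
      "l = 0 \<or> l \<in> M"
      "\<And>\<tau>. 1 \<le> \<tau> \<Longrightarrow> \<tau> \<le> i \<Longrightarrow> is_start d A \<tau> \<Longrightarrow> \<exists>t\<in>M. \<tau> \<le> t \<and> t \<le> \<tau> + d - 1"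
      using Suc(1) by (auto simp: lc)
    show ?case
    proof (cases ?new)
      case True
      have pF: "?p \<notin> F" using True p by auto
      have "?p \<notin> M" using pF M(4) True p by fastforce
      moreover have "finite M" using M(2) cover_finite[OF ok] finite_subset by blast
      moreover have "insert ?p M - F = insert ?p (M - F)" using pF by blast
      ultimately have card: "card (insert ?p M - F) = Suc c" using M(3) by simp
      have lp: "l \<le> ?p" using True p by fastforce
      have G: "greedy d A F (Suc i) = (?p, Suc c)" using True lc by simp
      show ?thesis unfolding G fst_conv snd_conv
      proof (intro exI[of _ "insert ?p M"] conjI allI impI)
        fix \<tau> assume \<tau>: "1 \<le> \<tau> \<and> \<tau> \<le> Suc i \<and> is_start d A \<tau>"
        show "\<exists>t\<in>insert ?p M. \<tau> \<le> t \<and> t \<le> \<tau> + d - 1"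
        proof (cases "\<tau> = Suc i")
          case True
          then show ?thesis using p \<tau> by blast
        next
          case False
          then show ?thesis using M(7)[of \<tau>] \<tau> by auto
        qed
      qed (use True M lp p card in \<open>auto dest!: subsetD\<close>)
    next
      case False
      have new: "\<exists>t\<in>M. Suc i \<le> t \<and> t \<le> Suc i + d - 1" if "is_start d A (Suc i)"
      proof (cases "l < Suc i")
        case True
        then show ?thesis using that False M(1) by auto
      next
        case l: False
        then show ?thesis using M(5,6) by (intro bexI[of _ l]) auto
      qed
      have G: "greedy d A F (Suc i) = (l, c)" using False lc by auto
      show ?thesis unfolding G fst_conv snd_conv
      proof (intro exI[of _ M] conjI allI impI)
        fix \<tau> assume \<tau>: "1 \<le> \<tau> \<and> \<tau> \<le> Suc i \<and> is_start d A \<tau>"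
        show "\<exists>t\<in>M. \<tau> \<le> t \<and> t \<le> \<tau> + d - 1"
          using new M(7)[of \<tau>] \<tau> by (cases "\<tau> = Suc i") auto
      qed (use M in auto)
    qed
  }
  {
    case 2
    then have IH: "c \<le> card ((M' - F) \<inter> {..l})" using Suc(2) lc by simp
    show ?case
    proof (cases ?new)
      case True
      have G: "greedy d A F (Suc i) = (?p, Suc c)" using True lc by simp
      \<comment> \<open>The competitor hits this window at a time that is not free and lies after
        \<open>l\<close>, hence has not been counted yet; as it cannot lie after
        \<open>latest\<close>, it is counted now.\<close>
      obtain t where t: "t \<in> M'" "Suc i \<le> t" "t \<le> Suc i + d - 1"
        using True 2 unfolding feasible_def by blast
      have "t \<le> ?p" using p(4) True t 2 unfolding feasible_def by blast
      moreover have "t \<notin> F" using t True by auto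
      moreover have "l < ?p" using p(2) True by linarith
      ultimately have "insert t ((M' - F) \<inter> {..l}) \<subseteq> (M' - F) \<inter> {..?p}" using t by auto
      then have "card (insert t ((M' - F) \<inter> {..l})) \<le> card ((M' - F) \<inter> {..?p})"
        by (intro card_mono) auto
      moreover have "t \<notin> (M' - F) \<inter> {..l}" using t True by auto
      ultimately show ?thesis unfolding G fst_conv snd_conv using IH by simp
    next
      case False
      then have G: "greedy d A F (Suc i) = (l, c)" using lc by auto
      show ?thesis unfolding G fst_conv snd_conv by (rule IH)
    qed
  }
qed

lemma card_sym_diff: "finite A \<Longrightarrow> finite B \<Longrightarrow> card (sym_diff A B) = card (A - B) + card (B - A)"
  by (intro card_Un_disjoint) auto

text \<open>The greedy choice only adds to the free times, so exactly the uncovered original times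
  are deleted.\<close>

lemma edit_cost_attained:
  assumes ok: "intervals_ok T A" and d: "0 < d" and O': "finite O'"
  shows "\<exists>M. feasible d A M \<and> card (sym_diff O' M) = edit_cost d T A O'"
proof -
  let ?F = "O' \<inter> cover A"
  obtain M where M: "?F \<subseteq> M" "M \<subseteq> cover A" "card (M - ?F) = snd (greedy d A ?F T)"
    "\<And>\<tau>. 1 \<le> \<tau> \<Longrightarrow> \<tau> \<le> T \<Longrightarrow> is_start d A \<tau> \<Longrightarrow> \<exists>t\<in>M. \<tau> \<le> t \<and> t \<le> \<tau> + d - 1"
    using greedy_invariant(1)[OF ok d, of ?F T] by auto
  have "1 \<le> \<tau> \<and> \<tau> \<le> T" if "is_start d A \<tau>" for \<tau>
    using that ok d by (fastforce simp: is_start_def intervals_ok_def)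
  with M have "feasible d A M" unfolding feasible_def by blast
  moreover have eq: "O' - M = O' - cover A" "M - O' = M - ?F" using M by auto
  have "finite M" using M(2) cover_finite[OF ok] finite_subset by blast
  then have "card (sym_diff O' M) = edit_cost d T A O'"
    unfolding card_sym_diff[OF O' \<open>finite M\<close>] unfolding edit_cost_def eq M(3) by simp
  ultimately show ?thesis by blast
qed

text \<open>Deletions and additions are bounded separately: a feasible set lies inside the cover,
  which forces the deletions, and the greedy lower bound applies to the additions.\<close>

lemma edit_cost_le:
  assumes ok: "intervals_ok T A" and d: "0 < d" and O': "finite O'" and M: "feasible d A M"
  shows "edit_cost d T A O' \<le> card (sym_diff O' M)"
proof -
  let ?F = "O' \<inter> cover A"
  have MU: "M \<subseteq> cover A" using M by (simp add: feasible_def)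
  then have fin: "finite M" using cover_finite[OF ok] finite_subset by blast
  have "snd (greedy d A ?F T) \<le> card ((M - ?F) \<inter> {..fst (greedy d A ?F T)})"
    by (rule greedy_invariant(2)[OF ok d _ M]) simp
  also have "\<dots> \<le> card (M - O')" using MU fin by (intro card_mono) auto
  finally have "snd (greedy d A ?F T) \<le> card (M - O')" .
  moreover have "card (O' - cover A) \<le> card (O' - M)" using MU O' by (intro card_mono) auto
  ultimately show ?thesis using fin O' by (simp add: edit_cost_def card_sym_diff)
qed

lemma greedy_le: "snd (greedy d A F i) \<le> i"
  by (induction i) (auto simp: case_prod_beta Let_def)

section \<open>Templates on a path\<close>

text \<open>
  A slot \<open>(a, b, s)\<close> belonging to the \<open>r\<close>-th edge of the path stands for a template with
  interval \<open>[a, b]\<close> whose vertex set is a run of consecutive vertices that starts with the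
  \<open>s\<close>-th one and contains the \<open>r\<close>-th edge.
\<close>

type_synonym slot = "nat \<times> nat \<times> nat"

definition slots_ok :: "nat \<Rightarrow> nat \<Rightarrow> slot set \<Rightarrow> bool" where
  "slots_ok T r S \<longleftrightarrow> (\<forall>(a, b, s)\<in>S. 1 \<le> a \<and> a \<le> b \<and> b \<le> T \<and> s \<le> r)"

definition apart :: "nat \<Rightarrow> slot \<Rightarrow> slot \<Rightarrow> bool" where
  "apart d = (\<lambda>(a, b, s) (a', b', s'). b + d \<le> a' \<or> b' + d \<le> a)"

text \<open>\<open>S\<close> belongs to the edge before the \<open>r\<close>-th one. All runs on the
  two edges contain the \<open>r\<close>-th vertex, so their templates have to coincide or be
  separated in time; two members of \<open>S\<close> have already been compared one edge earlier. A
  slot that is not inherited must start here.\<close>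

definition linked :: "nat \<Rightarrow> nat \<Rightarrow> slot set \<Rightarrow> slot set \<Rightarrow> bool" where
  "linked d r S S' \<longleftrightarrow> (\<forall>(a, b, s)\<in>S'. s = r \<or> (a, b, s) \<in> S) \<and>
     (\<forall>x\<in>S \<union> S'. \<forall>y\<in>S'. x = y \<or> apart d x y)"

text \<open>The intervals of those templates that contain the \<open>u\<close>-th vertex together
  with the right end of the edge to which \<open>S\<close> belongs.\<close>

definition started_by :: "slot set \<Rightarrow> nat \<Rightarrow> (nat \<times> nat) set" where
  "started_by S u = {(a, b). \<exists>s\<le>u. (a, b, s) \<in> S}"

lemma in_cover: "(a, b) \<in> A \<Longrightarrow> a \<le> t \<Longrightarrow> t \<le> b \<Longrightarrow> t \<in> cover A"
  by (force simp: cover_def)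

lemma apart_commute: "apart d x y \<longleftrightarrow> apart d y x"
  by (auto simp: apart_def)

text \<open>Overlapping intervals share a time, and its distance 0 is excluded by
  \<open>0 < d\<close>; for disjoint intervals the two ends that face each other decide.\<close>

lemma apart_iff:
  assumes "a \<le> b" "a' \<le> b'" "0 < d"
  shows "(\<forall>s\<in>{a..b}. \<forall>t\<in>{a'..b'}. int d \<le> \<bar>int s - int t\<bar>) \<longleftrightarrow> b + d \<le> a' \<or> b' + d \<le> a"
proof
  assume *: "\<forall>s\<in>{a..b}. \<forall>t\<in>{a'..b'}. int d \<le> \<bar>int s - int t\<bar>"
  consider "b < a'" | "b' < a" | "a \<le> a'" "a' \<le> b" | "a' \<le> a" "a \<le> b'" by linarith
  then show "b + d \<le> a' \<or> b' + d \<le> a"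
  proof cases
    case 1
    then show ?thesis using *[rule_format, of b a'] assms by auto
  next
    case 2
    then show ?thesis using *[rule_format, of a b'] assms by auto
  next
    case 3
    then show ?thesis using *[rule_format, of a' a'] assms by auto
  next
    case 4
    then show ?thesis using *[rule_format, of a a] assms by auto
  qed
qed auto

lemma intervals_ok_started_by: "slots_ok T r S \<Longrightarrow> intervals_ok T (started_by S u)"
  by (fastforce simp: slots_ok_def intervals_ok_def started_by_def)

locale path_graph =
  fixes G :: "'a temporal_graph" and vs :: "'a list"
  assumes temporal: "is_temporal_graph G"
    and distinct: "distinct vs" and verts: "set vs = tg_verts G"
    and edges: "tg_edges G = {{vs ! i, vs ! Suc i} | i. Suc i < length vs}"
begin

abbreviation "m \<equiv> length vs - 1"

text \<open>A vertex pair is indexed by its left vertex and by the path edge with the same right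
  end. With \<open>u \<le> w\<close> the indexing is unique, and the path edges are the pairs with
  \<open>u = w\<close>.\<close>

definition vpair :: "nat \<Rightarrow> nat \<Rightarrow> 'a set" where
  "vpair u w = {vs ! u, vs ! Suc w}"

definition tms :: "nat \<Rightarrow> nat set" where
  "tms w = tg_times G (vpair w w)"

definition orig :: "nat \<Rightarrow> nat \<Rightarrow> nat set" where
  "orig u w = (if u = w then tms w else {})"

abbreviation edits :: "(nat \<Rightarrow> nat \<Rightarrow> nat set) \<Rightarrow> nat" where
  "edits M \<equiv> \<Sum>r<m. \<Sum>u\<le>r. card (sym_diff (orig u r) (M u r))"

text \<open>The sequence \<open>Q\<close> is shifted by one: \<open>Q (Suc r)\<close> belongs to the
  \<open>r\<close>-th edge, and \<open>Q 0\<close> stands for the situation before the path.\<close>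

abbreviation pair_cost :: "nat \<Rightarrow> (nat \<Rightarrow> slot set) \<Rightarrow> nat \<Rightarrow> nat \<Rightarrow> nat" where
  "pair_cost d Q u r \<equiv> edit_cost d (lifetime G) (started_by (Q (Suc r)) u) (orig u r)"

lemma vpair_eq_iff:
  "u \<le> w \<Longrightarrow> w < m \<Longrightarrow> u' \<le> w' \<Longrightarrow> w' < m \<Longrightarrow> vpair u w = vpair u' w' \<longleftrightarrow> u = u' \<and> w = w'"
  using distinct by (auto simp: vpair_def doubleton_eq_iff nth_eq_iff_index_eq)

lemma vpair_possible: "u \<le> w \<Longrightarrow> w < m \<Longrightarrow> vpair u w \<subseteq> tg_verts G \<and> card (vpair u w) = 2"
  using distinct verts[symmetric] by (auto simp: vpair_def nth_eq_iff_index_eq card_2_iff)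

lemma edge_iff: "u \<le> w \<Longrightarrow> w < m \<Longrightarrow> vpair u w \<in> tg_edges G \<longleftrightarrow> u = w"
proof -
  assume uw: "u \<le> w" "w < m"
  have "tg_edges G = {vpair i i | i. i < m}" by (auto simp: edges vpair_def)
  then show ?thesis using uw by (auto simp: vpair_eq_iff)
qed

lemma time_edges_iff:
  "u \<le> w \<Longrightarrow> w < m \<Longrightarrow> (vpair u w, t) \<in> time_edges G \<longleftrightarrow> t \<in> orig u w"
  by (auto simp: time_edges_def edge_iff orig_def tms_def)

lemma finite_time_edges: "finite (time_edges G)"
proof -
  have "finite (tg_edges G)"
    using temporal by (auto simp: is_temporal_graph_def intro: finite_subset[of _ "Pow (tg_verts G)"])
  moreover have "time_edges G = (SIGMA e:tg_edges G. tg_times G e)" by (auto simp: time_edges_def)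
  ultimately show ?thesis using temporal by (auto simp: is_temporal_graph_def)
qed

lemma tms_props:
  assumes "w < m"
  shows "finite (tms w)" "tms w \<subseteq> {1..lifetime G}" "tms w \<noteq> {}"
proof -
  have e: "vpair w w \<in> tg_edges G" using assms by (simp add: edge_iff)
  then show "finite (tms w)" "tms w \<noteq> {}"
    using temporal by (auto simp: is_temporal_graph_def tms_def)
  show "tms w \<subseteq> {1..lifetime G}"
  proof
    fix t assume t: "t \<in> tms w"
    then have te: "(vpair w w, t) \<in> time_edges G" using e by (auto simp: time_edges_def tms_def)
    then have "t \<le> Max (snd ` time_edges G)" using finite_time_edges by (force intro: Max_ge)
    then have "t \<le> lifetime G" using te by (auto simp: lifetime_def)
    moreover have "1 \<le> t" using temporal e t by (auto simp: is_temporal_graph_def tms_def)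
    ultimately show "t \<in> {1..lifetime G}" by simp
  qed
qed

lemma finite_orig: "w < m \<Longrightarrow> finite (orig u w)"
  by (simp add: orig_def tms_props)

lemma time_edges_modify:
  "time_edges (modify G \<Pi>) = (time_edges G - \<Pi>) \<union> (\<Pi> - time_edges G)"
  by (force simp: time_edges_def modify_def Let_def)

lemma modify_simps:
  "tg_verts (modify G \<Pi>) = tg_verts G"
  "e \<in> tg_edges (modify G \<Pi>) \<longleftrightarrow> (\<exists>t. (e, t) \<in> time_edges (modify G \<Pi>))"
  "tg_times (modify G \<Pi>) e = {t. (e, t) \<in> time_edges (modify G \<Pi>)}"
proof -
  let ?M = "time_edges G - \<Pi> \<union> (\<Pi> - time_edges G)"
  show "tg_verts (modify G \<Pi>) = tg_verts G" by (simp add: modify_def Let_def)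
  have "e \<in> tg_edges (modify G \<Pi>) \<longleftrightarrow> e \<in> fst ` ?M" by (simp add: modify_def Let_def)
  then show "e \<in> tg_edges (modify G \<Pi>) \<longleftrightarrow> (\<exists>t. (e, t) \<in> time_edges (modify G \<Pi>))"
    unfolding time_edges_modify by force
  show "tg_times (modify G \<Pi>) e = {t. (e, t) \<in> time_edges (modify G \<Pi>)}"
    unfolding time_edges_modify by (simp add: modify_def Let_def)
qed

subsection \<open>From templates to slots\<close>

text \<open>
  Every template is cut at the path edges that have no appearance during its interval.
\<close>

definition good :: "'a template \<Rightarrow> nat \<Rightarrow> bool" where
  "good c j \<longleftrightarrow> vpair j j \<subseteq> fst c \<and> (\<exists>t\<in>tms j. fst (snd c) \<le> t \<and> t \<le> snd (snd c))"

text \<open>The condition is vacuous for \<open>s = Suc r\<close>, so the minimum exists; it exceeds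
  \<open>r\<close> exactly when the \<open>r\<close>-th edge is not good.\<close>

definition run_start :: "'a template \<Rightarrow> nat \<Rightarrow> nat" where
  "run_start c r = (LEAST s. \<forall>j\<in>{s..r}. good c j)"

text \<open>The truncation keeps slots within the original lifetime although additions may have
  prolonged the life of the edited graph.\<close>

definition slot_of :: "'a template \<Rightarrow> nat \<Rightarrow> slot" where
  "slot_of c r = (fst (snd c), min (snd (snd c)) (lifetime G), run_start c r)"

lemma run_start_le: "\<forall>j\<in>{s..r}. good c j \<Longrightarrow> run_start c r \<le> s"
  unfolding run_start_def by (rule Least_le)

lemma run_start_good: "j \<in> {run_start c r..r} \<Longrightarrow> good c j"
proof -
  have "\<forall>j\<in>{run_start c r..r}. good c j" unfolding run_start_def
    by (rule LeastI[of _ "Suc r"]) simp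
  then show "j \<in> {run_start c r..r} \<Longrightarrow> good c j" by blast
qed

lemma run_start_Suc:
  assumes "run_start c (Suc r) \<le> r"
  shows "run_start c (Suc r) = run_start c r"
proof (rule antisym)
  have g: "good c (Suc r)" using assms by (intro run_start_good) auto
  show "run_start c r \<le> run_start c (Suc r)"
    using run_start_good[of _ c "Suc r"] by (intro run_start_le) auto
  then show "run_start c (Suc r) \<le> run_start c r"
    using g run_start_good[of _ c r] by (intro run_start_le) (auto simp: le_Suc_eq)
qed

text \<open>Cutting and truncating templates leaves some of the edited times uncovered, so new time
  sets \<open>M\<close> are needed. They cost no more because an original time that was kept makes
  its own template good, stays covered and does not move.\<close>

lemma slots_of_realisation:
  assumes re: "realises d1 d2 (modify G \<Pi>) \<C>"
    and \<Pi>: "finite \<Pi>" and d: "0 < d1" "0 < d2"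
  shows "\<exists>Q M. Q 0 = {} \<and>
    (\<forall>r<m. slots_ok (lifetime G) r (Q (Suc r)) \<and> finite (Q (Suc r)) \<and>
       card (Q (Suc r)) \<le> card (tms r) \<and> linked d2 r (Q r) (Q (Suc r)) \<and>
       (\<forall>u\<le>r. feasible d1 (started_by (Q (Suc r)) u) (M u r))) \<and>
    edits M \<le> card \<Pi>"
proof -
  let ?T = "lifetime G" and ?G = "modify G \<Pi>"
  have C1: "X \<subseteq> tg_verts G \<and> 1 \<le> a \<and> a \<le> b" if "(X, a, b) \<in> \<C>" for X a b
    using re that by (fastforce simp: realises_def modify_simps)
  have C2: "b + d2 \<le> a' \<or> b' + d2 \<le> a"
    if "(X, a, b) \<in> \<C>" "(Y, a', b') \<in> \<C>" "(X, a, b) \<noteq> (Y, a', b')" "x \<in> X" "x \<in> Y" for X a b Y a' b' x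
  proof -
    have "independent_templates d2 (X, a, b) (Y, a', b')"
      using re that by (auto simp: realises_def pairwise_def)
    then have "\<forall>s\<in>{a..b}. \<forall>t\<in>{a'..b'}. int d2 \<le> \<bar>int s - int t\<bar>"
      using that by (auto simp: independent_templates_def)
    then show ?thesis using apart_iff[of a b a' b' d2] C1[OF that(1)] C1[OF that(2)] d by blast
  qed
  have C3: "\<exists>X a b. (X, a, b) \<in> \<C> \<and> e \<subseteq> X \<and> a \<le> t \<and> t \<le> b" if "(e, t) \<in> time_edges ?G" for e t
    using re that by (fastforce simp: realises_def)
  have C4: "dense_in ?G d1 {x, y} a b" if "(X, a, b) \<in> \<C>" "x \<in> X" "y \<in> X" "x \<noteq> y" for X a b x y
  proof -
    have "\<forall>(X, a, b)\<in>\<C>. \<forall>x\<in>X. \<forall>y\<in>X. x \<noteq> y \<longrightarrow>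
        {x, y} \<in> tg_edges ?G \<and> dense_in ?G d1 {x, y} a b" using re by (simp add: realises_def)
    from bspec[OF this that(1)] that show ?thesis by simp
  qed

  define Cr where "Cr r = {c \<in> \<C>. good c r}" for r
  define Q where "Q r = (case r of 0 \<Rightarrow> {} | Suc r \<Rightarrow> (\<lambda>c. slot_of c r) ` Cr r)" for r
  \<comment> \<open>An original appearance lies in the interval, so the interval truncated at
    \<open>?T\<close> is not empty.\<close>
  have goodT: "a \<le> ?T" if "good (X, a, b) r" "r < m" for X a b r
    using that tms_props(2)[of r] by (fastforce simp: good_def)
  have rs: "run_start c r \<le> r" if "good c r" for c r using that by (intro run_start_le) auto
  have ok: "slots_ok ?T r (Q (Suc r))" if "r < m" for r
    unfolding slots_ok_def
  proof
    fix x assume "x \<in> Q (Suc r)"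
    then obtain X a b where c: "(X, a, b) \<in> \<C>" "good (X, a, b) r" "x = slot_of (X, a, b) r"
      by (auto simp: Q_def Cr_def)
    then show "case x of (a, b, s) \<Rightarrow> 1 \<le> a \<and> a \<le> b \<and> b \<le> ?T \<and> s \<le> r"
      using C1[OF c(1)] goodT[OF c(2) that] rs[OF c(2)] by (simp add: slot_of_def)
  qed
  \<comment> \<open>Truncation only shortens intervals, so the separation in time of templates with
    a common vertex is inherited by their slots.\<close>
  have disj: "c = c' \<or> apart d2 (slot_of c r) (slot_of c' r')"
    if "c \<in> \<C>" "c' \<in> \<C>" "x \<in> fst c" "x \<in> fst c'" for c c' r r' x
    using C2[of "fst c" "fst (snd c)" "snd (snd c)" "fst c'" "fst (snd c')" "snd (snd c')" x] that
    by (auto simp: apart_def slot_of_def)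
  have vgood: "vs ! r \<in> fst c" "vs ! Suc r \<in> fst c" if "good c r" for c r
    using that by (auto simp: good_def vpair_def)
  have lnk: "linked d2 r (Q r) (Q (Suc r))" if r: "r < m" for r
    unfolding linked_def
  proof (intro conjI ballI)
    fix y assume "y \<in> Q (Suc r)"
    then obtain c where c: "c \<in> \<C>" "good c r" "y = slot_of c r" by (auto simp: Q_def Cr_def)
    show "case y of (a, b, s) \<Rightarrow> s = r \<or> (a, b, s) \<in> Q r"
    proof (cases "run_start c r = r")
      case True
      then show ?thesis using c by (auto simp: slot_of_def)
    next
      case False
      then have lt: "run_start c r < r" using rs[OF c(2)] by simp
      then obtain r' where r': "r = Suc r'" by (cases r) auto
      then have "run_start c r = run_start c r'" using lt run_start_Suc by simp
      then have "y = slot_of c r'" using c by (simp add: slot_of_def)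
      moreover have "good c r'" using lt r' by (intro run_start_good[of r' c r]) auto
      then have "slot_of c r' \<in> Q r" using c r' by (auto simp: Q_def Cr_def)
      ultimately show ?thesis by (cases y) auto
    qed
  next
    fix x y assume "x \<in> Q r \<union> Q (Suc r)" "y \<in> Q (Suc r)"
    then obtain c where c: "c \<in> \<C>" "good c r" "y = slot_of c r" by (auto simp: Q_def Cr_def)
    show "x = y \<or> apart d2 x y"
    proof (cases "x \<in> Q (Suc r)")
      case True
      then obtain c' where c': "c' \<in> \<C>" "good c' r" "x = slot_of c' r" by (auto simp: Q_def Cr_def)
      then show ?thesis using disj[OF c'(1) c(1), of "vs ! r" r r] vgood c by blast
    next
      case False
      then have "x \<in> Q r" using \<open>x \<in> Q r \<union> Q (Suc r)\<close> by blast
      then obtain r' c' where c': "r = Suc r'" "c' \<in> \<C>" "good c' r'" "x = slot_of c' r'"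
        by (cases r) (auto simp: Q_def Cr_def)
      show ?thesis
      proof (cases "c = c'")
        case True
        \<comment> \<open>A template that is good on two consecutive edges has one run through both,
          hence the same slot on both.\<close>
        have "\<forall>j\<in>{r'..Suc r'}. good c j" using c c' True by (auto simp: le_Suc_eq)
        then have "run_start c r \<le> r'" using c'(1) run_start_le by blast
        then show ?thesis using True c c' run_start_Suc[of c r'] by (auto simp: slot_of_def)
      next
        case False
        then show ?thesis
          using disj[OF c'(2) c(1), of "vs ! r" r' r] vgood(2)[OF c'(3)] vgood(1)[OF c(2)] c c' by auto
      qed
    qed
  qed
  have crd: "finite (Q (Suc r)) \<and> card (Q (Suc r)) \<le> card (tms r)" if r: "r < m" for r
  proof -
    have "\<forall>c\<in>Cr r. \<exists>t. t \<in> tms r \<and> fst (snd c) \<le> t \<and> t \<le> snd (snd c)"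
      by (auto simp: Cr_def good_def)
    then obtain f where f: "\<And>c. c \<in> Cr r \<Longrightarrow> f c \<in> tms r \<and> fst (snd c) \<le> f c \<and> f c \<le> snd (snd c)"
      by metis
    \<comment> \<open>Templates through one edge have disjoint intervals, so each claims an original
      appearance of its own.\<close>
    have "inj_on f (Cr r)"
    proof (rule inj_onI, rule ccontr)
      fix c c' assume cc: "c \<in> Cr r" "c' \<in> Cr r" "f c = f c'" "c \<noteq> c'"
      then have "snd (snd c) + d2 \<le> fst (snd c') \<or> snd (snd c') + d2 \<le> fst (snd c)"
        using C2[of "fst c" "fst (snd c)" "snd (snd c)" "fst c'" "fst (snd c')" "snd (snd c')" "vs ! r"]
          vgood[of c r] vgood[of c' r] by (auto simp: Cr_def)
      then show False using f[OF cc(1)] f[OF cc(2)] cc(3) d by auto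
    qed
    moreover have "f ` Cr r \<subseteq> tms r" using f by blast
    ultimately have "finite (Cr r)" "card (Cr r) \<le> card (tms r)"
      using tms_props(1)[OF r] by (meson inj_on_finite card_inj_on_le)+
    then show ?thesis using card_image_le[of "Cr r" "\<lambda>c. slot_of c r"] by (auto simp: Q_def)
  qed

  (* A time that is not covered any more moves back to the latest covered time before it. As every
     start of a window is covered, this does not leave any window the time was in. *)
  define Mold where "Mold u w = {t. (vpair u w, t) \<in> time_edges ?G}" for u w
  define U where "U u w = cover (started_by (Q (Suc w)) u)" for u w
  define \<phi> where "\<phi> u w t = Max (U u w \<inter> {..t})" for u w t
  define M where "M u w = \<phi> u w ` {t \<in> Mold u w. U u w \<inter> {..t} \<noteq> {}}" for u w
  have fin_tg: "finite (time_edges ?G)" unfolding time_edges_modify using \<Pi> finite_time_edges by simp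
  have finM: "finite (Mold u w)" for u w
    by (rule finite_surj[OF fin_tg, of _ snd]) (force simp: Mold_def)
  have finU: "finite (U u w)" if "w < m" for u w
    unfolding U_def using ok[OF that] intervals_ok_started_by cover_finite by blast
  \<comment> \<open>The run at \<open>w\<close> reaches back to \<open>u\<close> exactly when all
    edges in between are good.\<close>
  have started: "started_by (Q (Suc w)) u =
      {(a, min b ?T) | a b X. (X, a, b) \<in> \<C> \<and> (\<forall>j\<in>{u..w}. good (X, a, b) j)}"
    if uw: "u \<le> w" for u w
  proof (rule set_eqI, clarify)
    fix a b'
    have "(a, b') \<in> started_by (Q (Suc w)) u \<longleftrightarrow>
      (\<exists>c\<in>\<C>. good c w \<and> a = fst (snd c) \<and> b' = min (snd (snd c)) ?T \<and> run_start c w \<le> u)"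
      by (auto simp: started_by_def Q_def Cr_def slot_of_def)
    also have "\<dots> \<longleftrightarrow> (\<exists>c\<in>\<C>. a = fst (snd c) \<and> b' = min (snd (snd c)) ?T \<and> (\<forall>j\<in>{u..w}. good c j))"
      using uw run_start_le[of u w] run_start_good[of _ _ w] by (intro bex_cong refl) fastforce
    finally show "(a, b') \<in> started_by (Q (Suc w)) u \<longleftrightarrow> (a, b') \<in>
      {(a, min b ?T) | a b X. (X, a, b) \<in> \<C> \<and> (\<forall>j\<in>{u..w}. good (X, a, b) j)}" by fastforce
  qed
  have feas: "feasible d1 (started_by (Q (Suc w)) u) (M u w)" if uw: "u \<le> w" "w < m" for u w
    unfolding feasible_def
  proof (intro conjI allI impI)
    have "\<phi> u w t \<in> U u w" if "U u w \<inter> {..t} \<noteq> {}" for t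
      using Max_in[of "U u w \<inter> {..t}"] that finU[OF uw(2)] by (auto simp: \<phi>_def)
    then show "M u w \<subseteq> cover (started_by (Q (Suc w)) u)" by (auto simp: M_def U_def)
  next
    fix \<tau> assume "is_start d1 (started_by (Q (Suc w)) u) \<tau>"
    then obtain X a b where c: "(X, a, b) \<in> \<C>" "\<forall>j\<in>{u..w}. good (X, a, b) j"
      "a \<le> \<tau>" "\<tau> \<le> max a (min b ?T + 1 - d1)"
      unfolding is_start_def started[OF uw(1)] by auto
    have g: "good (X, a, b) u" "good (X, a, b) w" using c uw by auto
    have ab: "a \<le> b" "1 \<le> a" "a \<le> ?T" using C1[OF c(1)] goodT[OF g(2) uw(2)] by auto
    have "\<tau> \<le> min b ?T" using c ab d by auto
    moreover have "(a, min b ?T) \<in> started_by (Q (Suc w)) u" unfolding started[OF uw(1)] using c by blast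
    ultimately have \<tau>U: "\<tau> \<in> U u w" using c(3) unfolding U_def by (intro in_cover)
    have "vs ! u \<noteq> vs ! Suc w" using distinct uw by (simp add: nth_eq_iff_index_eq)
    then have dense: "dense_in ?G d1 (vpair u w) a b"
      using C4[OF c(1)] vgood[OF g(1)] vgood[OF g(2)] by (auto simp: vpair_def)
    \<comment> \<open>Each window of the truncated interval is a window of the full interval, for
      which density is known.\<close>
    have "\<tau> \<in> {a..max a (b + 1 - d1)}" using c by auto
    from dense[unfolded dense_in_def, rule_format, OF this]
    obtain t where t: "t \<in> Mold u w" "\<tau> \<le> t" "t \<le> \<tau> + d1 - 1"
      by (auto simp: modify_simps Mold_def)
    have "\<tau> \<in> U u w \<inter> {..t}" using \<tau>U t by simp
    moreover from this have "\<phi> u w t \<in> U u w \<inter> {..t}"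
      unfolding \<phi>_def using finU[OF uw(2)] by (intro Max_in) auto
    ultimately have "\<tau> \<le> \<phi> u w t" "\<phi> u w t \<le> t" "\<phi> u w t \<in> M u w"
      using finU[OF uw(2)] t unfolding M_def by (auto simp: \<phi>_def intro: Max_ge)
    then show "\<exists>t\<in>M u w. \<tau> \<le> t \<and> t \<le> \<tau> + d1 - 1" using t by (meson le_trans)
  qed
  \<comment> \<open>A surviving original time is itself the appearance that makes its template good,
    so the cut does not uncover it. For pairs that are not path edges there are no original
    times.\<close>
  have keep: "t \<in> U u w" if "t \<in> orig u w" "t \<in> Mold u w" "u \<le> w" "w < m" for t u w
  proof -
    have [simp]: "u = w" and t: "t \<in> tms w" using that by (auto simp: orig_def split: if_splits)
    have "(vpair w w, t) \<in> time_edges ?G" using that by (simp add: Mold_def)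
    from C3[OF this] obtain X a b where c: "(X, a, b) \<in> \<C>" "vpair w w \<subseteq> X" "a \<le> t" "t \<le> b"
      by blast
    then have "good (X, a, b) w" using t by (auto simp: good_def)
    then have "(a, min b ?T) \<in> started_by (Q (Suc w)) w" unfolding started[OF order_refl] using c by auto
    moreover have "t \<le> ?T" using tms_props(2)[OF that(4)] t by auto
    ultimately show ?thesis unfolding U_def using c by (intro in_cover[of a "min b ?T"]) auto
  qed
  have fixed: "\<phi> u w t = t" if "t \<in> U u w" "w < m" for t u w
    unfolding \<phi>_def using that finU[OF that(2)] by (intro Max_eqI) auto
  have card_le: "card (sym_diff (orig u w) (M u w)) \<le> card (sym_diff (orig u w) (Mold u w))"
    if uw: "u \<le> w" "w < m" for u w
  proof -
    have "M u w - orig u w \<subseteq> \<phi> u w ` (Mold u w - orig u w)"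
    proof
      fix x assume x: "x \<in> M u w - orig u w"
      then obtain t where t: "t \<in> Mold u w" "x = \<phi> u w t" by (auto simp: M_def)
      have "t \<notin> orig u w" using keep[of t u w] fixed[of t u w] t x uw by auto
      then show "x \<in> \<phi> u w ` (Mold u w - orig u w)" using t by blast
    qed
    then have "card (M u w - orig u w) \<le> card (Mold u w - orig u w)"
      using finM by (meson surj_card_le finite_Diff)
    moreover have "orig u w - M u w \<subseteq> orig u w - Mold u w"
    proof
      fix t assume t: "t \<in> orig u w - M u w"
      have "t \<in> M u w" if "t \<in> Mold u w"
        using keep[of t u w] fixed[of t u w] t uw that unfolding M_def by force
      then show "t \<in> orig u w - Mold u w" using t by blast
    qed
    then have "card (orig u w - M u w) \<le> card (orig u w - Mold u w)"
      using finite_orig[OF uw(2)] by (intro card_mono) auto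
    moreover have "finite (M u w)" using finM by (simp add: M_def)
    ultimately show ?thesis using finM finite_orig[OF uw(2)] by (simp add: card_sym_diff)
  qed
  let ?I = "SIGMA p:(SIGMA r:{..<m}. {..r}). sym_diff (orig (snd p) (fst p)) (Mold (snd p) (fst p))"
  have "edits M
      \<le> edits Mold"
    using card_le by (intro sum_mono) auto
  also have "\<dots> = card ?I"
    using finM finite_orig by (subst card_SigmaI) (auto simp: sum.Sigma case_prod_beta)
  also have "\<dots> \<le> card \<Pi>"
  proof (rule card_inj_on_le[OF _ _ \<Pi>])
    let ?f = "\<lambda>((r, u), t). (vpair u r, t)"
    show "inj_on ?f ?I"
      by (auto intro!: inj_onI simp: vpair_eq_iff)
    have "(vpair u r, t) \<in> \<Pi>" if "r < m" "u \<le> r" "t \<in> sym_diff (orig u r) (Mold u r)" for r u t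
      using that time_edges_iff[OF that(2,1), of t] unfolding Mold_def time_edges_modify by auto
    then show "?f ` ?I \<subseteq> \<Pi>"
      by auto
  qed
  finally show ?thesis using ok lnk crd feas
    by (intro exI[of _ Q] exI[of _ M]) (auto simp: Q_def[of 0])
qed

end

context path_graph
begin

subsection \<open>From slots to templates\<close>

lemma time_edge_vpair: "(e, t) \<in> time_edges G \<Longrightarrow> \<exists>r<m. e = vpair r r"
  unfolding time_edges_def edges vpair_def by (clarify, rule_tac x = i in exI) auto

text \<open>By \<open>linked\<close>, a slot found on some edge is found on all edges back to its
  start. Its occurrences thus form one run of edges, and the vertices of that run become a
  template.\<close>

lemma realisation_of_slots:
  assumes ok: "\<And>r. r < m \<Longrightarrow> slots_ok T r (Q (Suc r))"
    and lnk: "\<And>r. r < m \<Longrightarrow> linked d2 r (Q r) (Q (Suc r))"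
    and feas: "\<And>u r. r < m \<Longrightarrow> u \<le> r \<Longrightarrow> feasible d1 (started_by (Q (Suc r)) u) (M u r)"
    and d: "0 < d1" "0 < d2"
  shows "\<exists>\<Pi>. \<Pi> \<subseteq> possible_time_edges G \<and> finite \<Pi> \<and>
    card \<Pi> \<le> edits M \<and>
    cluster_temporal_graph d1 d2 (modify G \<Pi>)"
proof -
  define I where "I = (SIGMA p:(SIGMA r:{..<m}. {..r}). sym_diff (orig (snd p) (fst p)) (M (snd p) (fst p)))"
  define \<Pi> where "\<Pi> = (\<lambda>((r, u), t). (vpair u r, t)) ` I"
  have M_cover: "M u r \<subseteq> cover (started_by (Q (Suc r)) u)" if "r < m" "u \<le> r" for u r
    using feas[OF that] by (simp add: feasible_def)
  have M_T: "M u r \<subseteq> {1..T}" if "r < m" "u \<le> r" for u r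
    using M_cover[OF that] cover_subset[OF intervals_ok_started_by[OF ok[OF that(1)]]] by blast
  have finM: "finite (M u r)" if "r < m" "u \<le> r" for u r
    using M_T[OF that] finite_subset by blast
  have finI: "finite I" unfolding I_def using finM finite_orig by auto
  have in_\<Pi>: "(vpair u r, t) \<in> \<Pi> \<longleftrightarrow> t \<in> sym_diff (orig u r) (M u r)" if "r < m" "u \<le> r" for u r t
  proof
    assume "(vpair u r, t) \<in> \<Pi>"
    then obtain r' u' where "r' < m" "u' \<le> r'" "vpair u r = vpair u' r'" "t \<in> sym_diff (orig u' r') (M u' r')"
      by (auto simp: \<Pi>_def I_def)
    then show "t \<in> sym_diff (orig u r) (M u r)" using that by (simp add: vpair_eq_iff)
  next
    assume "t \<in> sym_diff (orig u r) (M u r)"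
    then have "((r, u), t) \<in> I" using that by (auto simp: I_def)
    then show "(vpair u r, t) \<in> \<Pi>" unfolding \<Pi>_def by force
  qed
  have \<Pi>_vpair: "\<exists>r<m. \<exists>u\<le>r. e = vpair u r" if "(e, t) \<in> \<Pi>" for e t
    using that by (auto simp: \<Pi>_def I_def)
  let ?G = "modify G \<Pi>"
  have te_vpair: "(vpair u r, t) \<in> time_edges ?G \<longleftrightarrow> t \<in> M u r" if "r < m" "u \<le> r" for u r t
    unfolding time_edges_modify using in_\<Pi>[OF that] time_edges_iff[OF that(2,1)]
    by auto
  have te_dest: "\<exists>r<m. \<exists>u\<le>r. e = vpair u r \<and> t \<in> M u r" if "(e, t) \<in> time_edges ?G" for e t
  proof -
    have "\<exists>r<m. \<exists>u\<le>r. e = vpair u r"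
      using that time_edge_vpair[of e t] \<Pi>_vpair[of e t] unfolding time_edges_modify by auto
    then show ?thesis using te_vpair that by blast
  qed
  have "card \<Pi> \<le> card I" unfolding \<Pi>_def by (rule card_image_le[OF finI])
  also have "card I = edits M"
    unfolding I_def using finM finite_orig by (subst card_SigmaI) (auto simp: sum.Sigma case_prod_beta)
  finally have card: "card \<Pi> \<le> edits M" .
  have poss: "\<Pi> \<subseteq> possible_time_edges G"
  proof
    fix x assume "x \<in> \<Pi>"
    then obtain r u t where x: "x = (vpair u r, t)" "r < m" "u \<le> r" "t \<in> sym_diff (orig u r) (M u r)"
      by (auto simp: \<Pi>_def I_def)
    have "1 \<le> t" using x(4) M_T[OF x(2,3)] tms_props(2)[OF x(2)]
      by (auto simp: orig_def split: if_splits)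
    then show "x \<in> possible_time_edges G"
      using vpair_possible[OF x(3,2)] x(1) by (simp add: possible_time_edges_def)
  qed
  \<comment> \<open>Deletions can lower the lifetime, and templates must end within it; this is why
    they are given the end \<open>min b L\<close> below.\<close>
  define L where "L = lifetime ?G"
  have fin_te: "finite (time_edges ?G)" unfolding time_edges_modify
    using finI finite_time_edges by (simp add: \<Pi>_def)
  have le_L: "t \<le> L" if "(e, t) \<in> time_edges ?G" for e t
  proof -
    have "t \<in> snd ` time_edges ?G" using that by force
    then have "t \<le> Max (snd ` time_edges ?G)" using fin_te by (intro Max_ge) auto
    then show ?thesis using that by (auto simp: L_def lifetime_def)
  qed

  define last where "last x w \<longleftrightarrow> w < m \<and> x \<in> Q (Suc w) \<and> (Suc w < m \<longrightarrow> x \<notin> Q (Suc (Suc w)))" for x w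
  have down: "(a, b, s) \<in> Q (Suc w) \<Longrightarrow> w < m \<Longrightarrow> s \<le> u \<Longrightarrow> u \<le> w \<Longrightarrow> (a, b, s) \<in> Q (Suc u)" for a b s w u
  proof (induction w)
    case (Suc w)
    show ?case
    proof (cases "u = Suc w")
      case False
      then have "(a, b, s) \<in> Q (Suc w)" using lnk[OF Suc.prems(2)] Suc.prems by (auto simp: linked_def)
      then show ?thesis using Suc False by simp
    qed (use Suc in simp)
  qed simp
  have up: "x \<in> Q (Suc w) \<Longrightarrow> w < m \<Longrightarrow> \<exists>w'\<ge>w. last x w'" for x w
  proof (induction "m - w" arbitrary: w)
    case (Suc k)
    show ?case
    proof (cases "last x w")
      case False
      then have "Suc w < m" "x \<in> Q (Suc (Suc w))" using Suc.prems by (auto simp: last_def)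
      moreover have "k = m - Suc w" using Suc(2) by simp
      ultimately obtain w' where "w' \<ge> Suc w" "last x w'" using Suc(1)[of "Suc w"] by blast
      then show ?thesis by (intro exI[of _ w']) auto
    qed auto
  qed simp
  have pos: "1 \<le> a \<and> a \<le> b \<and> s \<le> w" if "(a, b, s) \<in> Q (Suc w)" "w < m" for a b s w
    using ok[OF that(2)] that(1) by (auto simp: slots_ok_def)
  have near: "x = y \<or> apart d2 x y"
    if "x \<in> Q (Suc i)" "y \<in> Q (Suc j)" "i < m" "j < m" "i \<le> Suc j" "j \<le> Suc i" for x y i j
  proof -
    from that(5,6) consider "i = j" | "j = Suc i" | "i = Suc j" by linarith
    then show ?thesis
    proof cases
      case 1
      then show ?thesis using lnk[of i] that by (auto simp: linked_def)
    next
      case 2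
      then show ?thesis using lnk[of j] that by (auto simp: linked_def)
    next
      case 3
      then have "y = x \<or> apart d2 y x" using lnk[of i] that by (auto simp: linked_def)
      then show ?thesis using apart_commute by blast
    qed
  qed
  \<comment> \<open>A run through the \<open>p\<close>-th vertex contains the \<open>p\<close>-th
    edge, or the edge before it if \<open>p\<close> is its right end. The index
    \<open>min p w\<close> covers both cases, so the two edges to be compared are equal or
    adjacent.\<close>
  have sep: "((a, b, s) = (a', b', s') \<and> w = w') \<or> b + d2 \<le> a' \<or> b' + d2 \<le> a"
    if l: "last (a, b, s) w" "last (a', b', s') w'" and p: "s \<le> p" "p \<le> Suc w" "s' \<le> p" "p \<le> Suc w'"
    for a b s w a' b' s' w' p
  proof -
    have Q: "(a, b, s) \<in> Q (Suc w)" "(a', b', s') \<in> Q (Suc w')" "w < m" "w' < m"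
      using l by (auto simp: last_def)
    have "(a, b, s) \<in> Q (Suc (min p w))" "(a', b', s') \<in> Q (Suc (min p w'))"
      using down[OF Q(1,3), of "min p w"] down[OF Q(2,4), of "min p w'"] p pos[OF Q(1,3)] pos[OF Q(2,4)]
      by auto
    then have n: "(a, b, s) = (a', b', s') \<or> apart d2 (a, b, s) (a', b', s')"
      using p Q by (intro near[of _ "min p w" _ "min p w'"]) auto
    \<comment> \<open>The run ending at \<open>w\<close> would continue on the next edge, against
      \<open>last\<close>.\<close>
    have False if "(a, b, s) = (a', b', s')" "w < w'"
    proof -
      have "(a, b, s) \<in> Q (Suc (Suc w))" using down[of a b s w' "Suc w"] that Q pos[OF Q(1,3)] by auto
      then show False using l that Q by (auto simp: last_def)
    qed
    moreover have False if "(a, b, s) = (a', b', s')" "w' < w"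
    proof -
      have "(a, b, s) \<in> Q (Suc (Suc w'))" using down[of a b s w "Suc w'"] that Q pos[OF Q(2,4)] by auto
      then show False using l that Q by (auto simp: last_def)
    qed
    ultimately show ?thesis using n by (fastforce simp: apart_def)
  qed
  define \<C> where "\<C> = {((!) vs ` {s..Suc w}, a, min b L) | s w a b. last (a, b, s) w}"
  have dense: "dense_in ?G d1 (vpair u r) a (min b L) \<and> vpair u r \<in> tg_edges ?G \<and> a \<le> L"
    if "(a, b, s) \<in> Q (Suc w)" "w < m" "s \<le> u" "u \<le> r" "r \<le> w" for a b s w u r
  proof -
    have "(a, b, s) \<in> Q (Suc r)" using down[OF that(1,2), of r] that by auto
    then have st: "(a, b) \<in> started_by (Q (Suc r)) u" using that by (auto simp: started_by_def)
    have r: "r < m" using that by simp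
    have hit: "\<exists>t. (vpair u r, t) \<in> time_edges ?G \<and> \<tau> \<le> t \<and> t \<le> \<tau> + d1 - 1"
      if "\<tau> \<in> {a..max a (min b L + 1 - d1)}" for \<tau>
    proof -
      have "is_start d1 (started_by (Q (Suc r)) u) \<tau>"
        unfolding is_start_def using st that by (intro bexI[of _ "(a, b)"]) (auto simp: max_def split: if_splits)
      then show ?thesis using feas[OF r \<open>u \<le> r\<close>] te_vpair[OF r \<open>u \<le> r\<close>] by (auto simp: feasible_def)
    qed
    have "dense_in ?G d1 (vpair u r) a (min b L)"
      unfolding dense_in_def modify_simps using hit by blast
    \<comment> \<open>The window that starts at \<open>a\<close> is hit at some time from
      \<open>a\<close> on; this makes the pair an edge of the new graph and places \<open>a\<close>
      within the new lifetime.\<close>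
    moreover obtain t where t: "(vpair u r, t) \<in> time_edges ?G" "a \<le> t" using hit[of a] by auto
    moreover have "vpair u r \<in> tg_edges ?G" using t(1) modify_simps(2) by blast
    ultimately show ?thesis using le_L[of "vpair u r" t] by simp
  qed
  have "realises d1 d2 ?G \<C>"
    unfolding realises_def
  proof (intro conjI ballI)
    fix c assume "c \<in> \<C>"
    then obtain s w a b where c: "c = ((!) vs ` {s..Suc w}, a, min b L)" and l: "last (a, b, s) w"
      by (auto simp: \<C>_def)
    have Q: "(a, b, s) \<in> Q (Suc w)" "w < m" using l by (auto simp: last_def)
    note p = pos[OF Q]
    have "(!) vs ` {s..Suc w} \<subseteq> tg_verts G" unfolding verts[symmetric]
      using Q(2) by (intro image_subsetI nth_mem) auto
    moreover have "a \<le> L" using dense[OF Q, of w w] p by simp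
    ultimately show "case c of (X, a, b) \<Rightarrow> X \<subseteq> tg_verts ?G \<and> 1 \<le> a \<and> a \<le> b \<and> b \<le> lifetime ?G"
      unfolding c L_def[symmetric] prod.case using p by (simp add: modify_simps(1))
    have "{x, y} \<in> tg_edges ?G \<and> dense_in ?G d1 {x, y} a (min b L)"
      if xy: "x \<in> (!) vs ` {s..Suc w}" "y \<in> (!) vs ` {s..Suc w}" "x \<noteq> y" for x y
    proof -
      obtain i j where ij: "x = vs ! i" "y = vs ! j" "i \<in> {s..Suc w}" "j \<in> {s..Suc w}" using xy by blast
      then have "i \<noteq> j" using xy by auto
      then consider "i < j" | "j < i" by linarith
      then show ?thesis
      proof cases
        case 1
        then have "{x, y} = vpair i (j - 1)" using ij by (simp add: vpair_def)
        then show ?thesis using dense[OF Q, of i "j - 1"] 1 ij by auto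
      next
        case 2
        then have "{x, y} = vpair j (i - 1)" using ij by (auto simp: vpair_def)
        then show ?thesis using dense[OF Q, of j "i - 1"] 2 ij by auto
      qed
    qed
    then show "case c of (X, a, b) \<Rightarrow> \<forall>x\<in>X. \<forall>y\<in>X. x \<noteq> y \<longrightarrow>
        {x, y} \<in> tg_edges ?G \<and> dense_in ?G d1 {x, y} a b" unfolding c prod.case by (intro ballI impI)
  next
    show "pairwise (independent_templates d2) \<C>"
    proof (rule pairwiseI)
      fix c c' assume "c \<in> \<C>" "c' \<in> \<C>" and ne: "c \<noteq> c'"
      from \<open>c \<in> \<C>\<close> obtain s w a b where
        c: "c = ((!) vs ` {s..Suc w}, a, min b L)" and l: "last (a, b, s) w" unfolding \<C>_def by blast
      from \<open>c' \<in> \<C>\<close> obtain s' w' a' b' where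
        c': "c' = ((!) vs ` {s'..Suc w'}, a', min b' L)" and l': "last (a', b', s') w'"
        unfolding \<C>_def by blast
      have w: "w < m" "w' < m" using l l' by (auto simp: last_def)
      show "independent_templates d2 c c'"
      proof (cases "(!) vs ` {s..Suc w} \<inter> (!) vs ` {s'..Suc w'} = {}")
        case False
        then obtain p p' where "p \<in> {s..Suc w}" "p' \<in> {s'..Suc w'}" "vs ! p = vs ! p'" by blast
        moreover from this have "p < length vs" "p' < length vs" using w by auto
        moreover from calculation have "p = p'" using distinct by (simp add: nth_eq_iff_index_eq)
        ultimately have "b + d2 \<le> a' \<or> b' + d2 \<le> a" using sep[OF l l', of p] ne c c' by auto
        then show ?thesis by (auto simp: c c' independent_templates_def)
      qed (simp add: c c' independent_templates_def)
    qed
  next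
    fix et assume "et \<in> time_edges ?G"
    then obtain e t where et: "et = (e, t)" "(e, t) \<in> time_edges ?G" by (cases et) auto
    then obtain r u where r: "r < m" "u \<le> r" "e = vpair u r" "t \<in> M u r" using te_dest by blast
    then obtain a b where "(a, b) \<in> started_by (Q (Suc r)) u" "a \<le> t" "t \<le> b"
      using M_cover[OF r(1,2)] by (auto simp: cover_def)
    then obtain s where s: "s \<le> u" "(a, b, s) \<in> Q (Suc r)" by (auto simp: started_by_def)
    then obtain w where w: "r \<le> w" "last (a, b, s) w" using up r by blast
    have "((!) vs ` {s..Suc w}, a, min b L) \<in> \<C>" using w by (auto simp: \<C>_def)
    moreover have "e \<subseteq> (!) vs ` {s..Suc w}" using r w s by (auto simp: vpair_def)
    moreover have "t \<in> {a..min b L}" using \<open>a \<le> t\<close> \<open>t \<le> b\<close> le_L[OF et(2)] by simp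
    ultimately show "case et of (e, t) \<Rightarrow> \<exists>(X, a, b)\<in>\<C>. e \<subseteq> X \<and> t \<in> {a..b}"
      unfolding et(1) prod.case by (intro bexI[of _ "((!) vs ` {s..Suc w}, a, min b L)"]) auto
  qed
  then show ?thesis using poss card finI unfolding cluster_temporal_graph_def \<Pi>_def by blast
qed

definition plan :: "nat \<Rightarrow> nat \<Rightarrow> nat \<Rightarrow> nat \<Rightarrow> (nat \<Rightarrow> slot set) \<Rightarrow> bool" where
  "plan d1 d2 \<sigma> k Q \<longleftrightarrow> Q 0 = {} \<and>
    (\<forall>r<m. slots_ok (lifetime G) r (Q (Suc r)) \<and> finite (Q (Suc r)) \<and> card (Q (Suc r)) \<le> \<sigma> \<and>
      linked d2 r (Q r) (Q (Suc r))) \<and>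
    (\<Sum>r<m. \<Sum>u\<le>r. pair_cost d1 Q u r) \<le> k"

text \<open>Once the slots are fixed, the requirements on different vertex pairs do not interact, so
  the optimum is the sum of the optima of the single pairs.\<close>

theorem ETC_iff_slots:
  assumes d: "0 < d1" "0 < d2" and \<sigma>: "\<And>r. r < m \<Longrightarrow> card (tms r) \<le> \<sigma>"
  shows "ETC G d1 d2 k \<longleftrightarrow> (\<exists>Q. plan d1 d2 \<sigma> k Q)" (is "_ \<longleftrightarrow> (\<exists>Q. ?plan Q)")
proof
  let ?T = "lifetime G"
  assume "ETC G d1 d2 k"
  then obtain \<Pi> \<C> where \<Pi>: "finite \<Pi>" "card \<Pi> \<le> k" "realises d1 d2 (modify G \<Pi>) \<C>"
    by (auto simp: ETC_def cluster_temporal_graph_def)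
  from slots_of_realisation[OF \<Pi>(3,1) d] obtain Q M where Q: "Q 0 = {}"
    "\<forall>r<m. slots_ok ?T r (Q (Suc r)) \<and> finite (Q (Suc r)) \<and>
       card (Q (Suc r)) \<le> card (tms r) \<and> linked d2 r (Q r) (Q (Suc r)) \<and>
       (\<forall>u\<le>r. feasible d1 (started_by (Q (Suc r)) u) (M u r))"
    "edits M \<le> card \<Pi>" by blast
  have "(\<Sum>r<m. \<Sum>u\<le>r. pair_cost d1 Q u r)
      \<le> edits M"
    using Q(2) d finite_orig by (intro sum_mono edit_cost_le intervals_ok_started_by) auto
  then have "(\<Sum>r<m. \<Sum>u\<le>r. pair_cost d1 Q u r) \<le> k"
    using Q(3) \<Pi>(2) by linarith
  moreover have "card (Q (Suc r)) \<le> \<sigma>" if "r < m" for r using Q(2) \<sigma> that le_trans by blast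
  ultimately show "\<exists>Q. ?plan Q" using Q unfolding plan_def by (intro exI[of _ Q]) auto
next
  let ?T = "lifetime G"
  assume "\<exists>Q. ?plan Q"
  then obtain Q where Q: "\<forall>r<m. slots_ok ?T r (Q (Suc r)) \<and> linked d2 r (Q r) (Q (Suc r))"
    "(\<Sum>r<m. \<Sum>u\<le>r. pair_cost d1 Q u r) \<le> k"
    unfolding plan_def by blast
  define opt where "opt u r M \<longleftrightarrow> feasible d1 (started_by (Q (Suc r)) u) M \<and>
      card (sym_diff (orig u r) M) = pair_cost d1 Q u r" for u r M
  define M where "M u r = (SOME M. opt u r M)" for u r
  have "opt u r (M u r)" if "r < m" for u r
  proof -
    have "intervals_ok ?T (started_by (Q (Suc r)) u)" using Q(1) that intervals_ok_started_by by blast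
    from edit_cost_attained[OF this d(1) finite_orig[OF that, of u]]
    have "\<exists>M. opt u r M" by (simp add: opt_def)
    then show ?thesis unfolding M_def by (rule someI_ex)
  qed
  then have M: "feasible d1 (started_by (Q (Suc r)) u) (M u r)"
      "card (sym_diff (orig u r) (M u r)) = pair_cost d1 Q u r"
    if "r < m" for u r using that by (auto simp: opt_def)
  have "\<exists>\<Pi>. \<Pi> \<subseteq> possible_time_edges G \<and> finite \<Pi> \<and>
    card \<Pi> \<le> edits M \<and>
    cluster_temporal_graph d1 d2 (modify G \<Pi>)"
    using Q M d by (intro realisation_of_slots[of ?T Q]) auto
  moreover have "edits M \<le> k"
    using Q(2) M(2) by simp
  ultimately show "ETC G d1 d2 k" unfolding ETC_def by (elim exE conjE) (intro exI conjI; simp)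
qed

end

section \<open>Dynamic programming over encoded slot sets\<close>

text \<open>Mixed radix for numbers below \<open>n * T * T\<close>; the ends of the interval are
  shifted by 1 because times are positive.\<close>

definition decode :: "nat \<Rightarrow> nat \<Rightarrow> slot" where
  "decode T x = (x mod T + 1, x div T mod T + 1, x div (T * T))"

text \<open>The number \<open>r\<close> counts edges: the slots of the \<open>r\<close>-th edge are
  those with \<open>valid (Suc r)\<close>. The bounds 1 and \<open>T\<close> on times are ensured by
  \<open>decode\<close>.\<close>

fun valid :: "nat \<Rightarrow> slot \<Rightarrow> bool" where
  "valid r (a, b, s) \<longleftrightarrow> a \<le> b \<and> s < r"

text \<open>
  The digits of \<open>q\<close> in base \<open>K\<close> are read as slots; those that are not \<open>valid r\<close> do not
  count, so that \<open>state T K j 0 q\<close> is always empty.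
\<close>

definition state :: "nat \<Rightarrow> nat \<Rightarrow> nat \<Rightarrow> nat \<Rightarrow> nat \<Rightarrow> slot set" where
  "state T K j r q = {x. \<exists>i<j. x = decode T (q div K ^ i mod K) \<and> valid r x}"

lemma state_0 [simp]: "state T K 0 r q = {}"
  by (simp add: state_def)

lemma state_Suc:
  "state T K (Suc j) r q = (let x = decode T (q div K ^ j mod K) in
     if valid r x then insert x (state T K j r q) else state T K j r q)"
  by (auto simp: state_def less_Suc_eq Let_def)

lemma mem_state:
  "(a, b, s) \<in> state T K j r q \<longleftrightarrow> a \<le> b \<and> s < r \<and> (\<exists>i<j. (a, b, s) = decode T (q div K ^ i mod K))"
  unfolding state_def mem_Collect_eq valid.simps by blast

lemma state_row_0: "state T K j 0 q = {}"
  using mem_state[of _ _ _ T K j 0 q] by (metis equals0I less_zeroE prod_cases3)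

lemma slots_ok_state: "0 < T \<Longrightarrow> slots_ok T r (state T K j (Suc r) q)"
  by (auto simp: slots_ok_def state_def decode_def Suc_le_eq)

lemma card_state: "finite (state T K j r q) \<and> card (state T K j r q) \<le> j"
proof -
  have "state T K j r q \<subseteq> (\<lambda>i. decode T (q div K ^ i mod K)) ` {..<j}" by (auto simp: state_def)
  moreover have "card ((\<lambda>i. decode T (q div K ^ i mod K)) ` {..<j}) \<le> j"
    using card_image_le[of "{..<j}"] by simp
  ultimately show ?thesis by (meson card_mono finite_imageI finite_lessThan finite_subset le_trans)
qed

text \<open>Restricting a state to the runs started by \<open>u\<close> amounts to reading the same
  number as a state of the earlier edge \<open>u\<close>.\<close>

lemma started_by_state:
  "u \<le> r \<Longrightarrow> started_by (state T K j (Suc r) q) u = (\<lambda>(a, b, s). (a, b)) ` state T K j (Suc u) q"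
proof (rule set_eqI, clarify)
  fix a b assume u: "u \<le> r"
  have "(a, b) \<in> started_by (state T K j (Suc r) q) u \<longleftrightarrow> (\<exists>s. (a, b, s) \<in> state T K j (Suc u) q)"
    using u by (auto simp: started_by_def mem_state less_Suc_eq_le)
  also have "\<dots> \<longleftrightarrow> (a, b) \<in> (\<lambda>(a, b, s). (a, b)) ` state T K j (Suc u) q" by (force simp: image_iff)
  finally show "(a, b) \<in> started_by (state T K j (Suc r) q) u \<longleftrightarrow>
    (a, b) \<in> (\<lambda>(a, b, s). (a, b)) ` state T K j (Suc u) q" .
qed

lemma obtain_digits:
  assumes "\<And>i. i < j \<Longrightarrow> f i < (K :: nat)"
  shows "\<exists>q<K ^ j. \<forall>i<j. q div K ^ i mod K = f i"
  using assms
proof (induction j)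
  case (Suc j)
  then obtain q where q: "q < K ^ j" "\<forall>i<j. q div K ^ i mod K = f i" by auto
  define q' where "q' = q + K ^ j * f j"
  have K: "0 < K" using Suc.prems[of j] by auto
  have "q' < K ^ j + K ^ j * f j" using q(1) by (simp add: q'_def)
  also have "\<dots> = K ^ j * Suc (f j)" by simp
  also have "\<dots> \<le> K ^ j * K" using Suc.prems[of j] by (intro mult_le_mono2) simp
  finally have "q' < K ^ Suc j" by (simp add: mult.commute)
  moreover have "q' div K ^ i mod K = f i" if "i < Suc j" for i
  proof (cases "i = j")
    case True
    then show ?thesis using q(1) K Suc.prems[of j] by (simp add: q'_def)
  next
    case False
    with that less_imp_Suc_add[of i j] obtain l where l: "j = i + Suc l" by auto
    have "q' div K ^ i = q div K ^ i + K * (K ^ l * f j)"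
    proof -
      have "q' = q + K ^ i * (K * (K ^ l * f j))" by (simp add: q'_def l power_add ac_simps)
      then show ?thesis using K by simp
    qed
    then show ?thesis using q(2) that False by simp
  qed
  ultimately show ?case by blast
qed simp

lemma obtain_state:
  assumes S: "slots_ok T r S" "finite S" "card S \<le> \<sigma>" and T: "0 < T" and r: "Suc r < n"
  shows "\<exists>q<(n * T * T) ^ \<sigma>. state T (n * T * T) \<sigma> (Suc r) q = S"
proof -
  let ?K = "n * T * T"
  define enc where "enc = (\<lambda>(a, b, s). (a - 1) + T * ((b - 1) + T * s))"
  have enc: "decode T (enc (a, b, s)) = (a, b, s) \<and> enc (a, b, s) < ?K"
    if "1 \<le> a" "a \<le> T" "1 \<le> b" "b \<le> T" "s < n" for a b s
  proof -
    have lt: "a - 1 < T" "b - 1 < T" using that by auto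
    have "(b - 1) + T * s < T * n"
    proof -
      have "(b - 1) + T * s < T * Suc s" using lt by simp
      also have "\<dots> \<le> T * n" using that by (intro mult_le_mono2) simp
      finally show ?thesis .
    qed
    then have "enc (a, b, s) < T * (T * n)"
    proof -
      have "enc (a, b, s) < T * Suc ((b - 1) + T * s)" using lt by (simp add: enc_def)
      also have "\<dots> \<le> T * (T * n)" using \<open>(b - 1) + T * s < T * n\<close> by (intro mult_le_mono2) simp
      finally show ?thesis .
    qed
    moreover have "enc (a, b, s) div (T * T) = s" "enc (a, b, s) div T mod T = b - 1" "enc (a, b, s) mod T = a - 1"
      using lt T by (simp_all add: enc_def div_mult2_eq)
    ultimately show ?thesis using that by (simp add: decode_def ac_simps)
  qed
  \<comment> \<open>Spare digits encode a slot starting at the last vertex, which is not the left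
    end of an edge; such digits do not count.\<close>
  have dummy: "\<not> valid (Suc r) (1, 1, n - 1)" using r by simp
  obtain h where h: "bij_betw h {0..<card S} S" using ex_bij_betw_nat_finite[OF S(2)] by blast
  define f where "f i = (if i < card S then h i else (1, 1, n - 1))" for i
  have fS: "h i \<in> S" if "i < card S" for i using h that by (auto simp: bij_betw_def)
  have f: "decode T (enc (f i)) = f i \<and> enc (f i) < ?K" for i
  proof -
    obtain a b s where abs: "f i = (a, b, s)" by (cases "f i") auto
    have "1 \<le> a \<and> a \<le> T \<and> 1 \<le> b \<and> b \<le> T \<and> s < n"
    proof (cases "i < card S")
      case True
      then have "(a, b, s) \<in> S" using fS[of i] abs by (simp add: f_def)
      then show ?thesis using S(1) r by (auto simp: slots_ok_def)
    next
      case False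
      then show ?thesis using abs T r by (auto simp: f_def)
    qed
    then show ?thesis using enc abs by simp
  qed
  obtain q where q: "q < ?K ^ \<sigma>" "\<forall>i<\<sigma>. q div ?K ^ i mod ?K = enc (f i)"
    using obtain_digits[of \<sigma> "\<lambda>i. enc (f i)" ?K] f by blast
  have val: "valid (Suc r) x" if "x \<in> S" for x using that S(1) by (auto simp: slots_ok_def less_Suc_eq_le)
  have "state T ?K \<sigma> (Suc r) q = {x. \<exists>i<\<sigma>. x = f i \<and> valid (Suc r) x}"
    using q f by (auto simp: state_def)
  also have "\<dots> = h ` {0..<card S}"
  proof (intro equalityI subsetI)
    fix x assume "x \<in> {x. \<exists>i<\<sigma>. x = f i \<and> valid (Suc r) x}"
    then obtain i where "x = f i" "valid (Suc r) (f i)" by blast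
    then show "x \<in> h ` {0..<card S}" using dummy by (cases "i < card S") (auto simp: f_def)
  next
    fix x assume "x \<in> h ` {0..<card S}"
    then obtain i where "x = h i" "i < card S" by auto
    then show "x \<in> {x. \<exists>i<\<sigma>. x = f i \<and> valid (Suc r) x}"
      using val[OF fS] S(3) by (auto simp: f_def intro!: exI[of _ i])
  qed
  also have "\<dots> = S" using h by (simp add: bij_betw_def)
  finally show ?thesis using q by blast
qed

section \<open>The table of remaining budgets\<close>

primrec max_below :: "(nat \<Rightarrow> nat) \<Rightarrow> nat \<Rightarrow> nat" where
  "max_below f 0 = 0"
| "max_below f (Suc j) = max (max_below f j) (f j)"

lemma less_max_below_iff: "x < max_below f j \<longleftrightarrow> (\<exists>i<j. x < f i)"
  by (induction j) (auto simp: less_Suc_eq less_max_iff_disj)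

text \<open>
  Entries are one more than the largest budget that remains, and 0 when the budget \<open>k\<close> is exceeded.
\<close>

fun table :: "(nat \<Rightarrow> nat \<Rightarrow> nat \<Rightarrow> bool) \<Rightarrow> (nat \<Rightarrow> nat \<Rightarrow> nat) \<Rightarrow> nat \<Rightarrow> nat \<Rightarrow> nat \<Rightarrow> nat \<Rightarrow> nat" where
  "table L c N k 0 q = (if q = 0 then k + 1 else 0)"
| "table L c N k (Suc r) q = max_below (\<lambda>p. if L r p q then table L c N k r p - c r q else 0) N"

text \<open>Storing what is left of the budget instead of accumulated costs bounds the entries by
  the input, so they fit into a word.\<close>

lemma table_le: "table L c N k r q \<le> k + 1"
proof (induction r arbitrary: q)
  case (Suc r)
  have "\<not> k + 1 < (if L r p q then table L c N k r p - c r q else 0)" for p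
    using Suc.IH[of p] by auto
  then show ?case using less_max_below_iff[of "k + 1" _ N] by (simp add: not_less[symmetric])
qed simp

text \<open>Before the first edge every number encodes the empty state; \<open>f 0 = 0\<close>
  selects one representative, matching row 0 of the table.\<close>

definition walk :: "(nat \<Rightarrow> nat \<Rightarrow> nat \<Rightarrow> bool) \<Rightarrow> (nat \<Rightarrow> nat \<Rightarrow> nat) \<Rightarrow> nat \<Rightarrow> nat \<Rightarrow> nat \<Rightarrow> (nat \<Rightarrow> nat) \<Rightarrow> bool" where
  "walk L c N k r f \<longleftrightarrow> f 0 = 0 \<and> (\<forall>i<r. f i < N \<and> L i (f i) (f (Suc i))) \<and> (\<Sum>i<r. c i (f (Suc i))) \<le> k"

text \<open>Strict inequalities commute with truncated subtraction: \<open>x < t - c\<close> says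
  \<open>x + c < t\<close>. The entry 0 can thus stand both for an unreachable state and for an
  exhausted budget, without an infinite value.\<close>

lemma less_table_iff:
  "x < table L c N k r q \<longleftrightarrow> x \<le> k \<and> (\<exists>f. f r = q \<and> walk L c N (k - x) r f)"
proof (induction r arbitrary: q x)
  case 0
  show ?case by (auto simp: walk_def intro!: exI[of _ "\<lambda>_. 0"])
next
  case (Suc r)
  have "x < table L c N k (Suc r) q \<longleftrightarrow> (\<exists>p<N. L r p q \<and> x + c r q < table L c N k r p)"
    by (auto simp: less_max_below_iff less_diff_conv)
  also have "\<dots> \<longleftrightarrow> (\<exists>p<N. L r p q \<and> x + c r q \<le> k \<and> (\<exists>f. f r = p \<and> walk L c N (k - (x + c r q)) r f))"
    unfolding Suc.IH ..
  also have "\<dots> \<longleftrightarrow> x \<le> k \<and> (\<exists>f. f (Suc r) = q \<and> walk L c N (k - x) (Suc r) f)"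
  proof
    assume "\<exists>p<N. L r p q \<and> x + c r q \<le> k \<and> (\<exists>f. f r = p \<and> walk L c N (k - (x + c r q)) r f)"
    then obtain f where f: "f r < N" "L r (f r) q" "x + c r q \<le> k" "walk L c N (k - (x + c r q)) r f" by auto
    let ?g = "f(Suc r := q)"
    have "(\<Sum>i<r. c i (?g (Suc i))) = (\<Sum>i<r. c i (f (Suc i)))" by (intro sum.cong) auto
    then show "x \<le> k \<and> (\<exists>f. f (Suc r) = q \<and> walk L c N (k - x) (Suc r) f)"
      using f by (intro conjI exI[of _ ?g]) (auto simp: walk_def less_Suc_eq)
  next
    assume "x \<le> k \<and> (\<exists>f. f (Suc r) = q \<and> walk L c N (k - x) (Suc r) f)"
    then obtain f where "x \<le> k" "f (Suc r) = q" "walk L c N (k - x) (Suc r) f" by blast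
    then show "\<exists>p<N. L r p q \<and> x + c r q \<le> k \<and> (\<exists>f. f r = p \<and> walk L c N (k - (x + c r q)) r f)"
      by (intro exI[of _ "f r"] conjI exI[of _ f]) (auto simp: walk_def)
  qed
  finally show ?case .
qed

definition compat :: "nat \<Rightarrow> nat \<Rightarrow> nat \<Rightarrow> nat \<Rightarrow> nat \<Rightarrow> nat \<Rightarrow> nat \<Rightarrow> bool" where
  "compat d T K \<sigma> r p q \<longleftrightarrow> linked d r (state T K \<sigma> r p) (state T K \<sigma> (Suc r) q)"

definition state_cost :: "nat \<Rightarrow> nat \<Rightarrow> nat \<Rightarrow> nat \<Rightarrow> (nat \<Rightarrow> nat set) \<Rightarrow> nat \<Rightarrow> nat \<Rightarrow> nat" where
  "state_cost d T K \<sigma> tm r q = (\<Sum>u\<le>r. edit_cost d T ((\<lambda>(a, b, s). (a, b)) ` state T K \<sigma> (Suc u) q)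
     (if u = r then tm r else {}))"

context path_graph
begin

text \<open>Every admissible set of at most \<open>\<sigma>\<close> slots is the
  \<open>state\<close> of a number below \<open>K ^ \<sigma>\<close>, and conversely every number
  yields an admissible set. Plans thus become walks through numbers.\<close>

theorem ETC_iff_table:
  fixes \<sigma> :: nat
  defines "K \<equiv> length vs * lifetime G * lifetime G"
  assumes d: "0 < d1" "0 < d2" and \<sigma>: "\<And>r. r < m \<Longrightarrow> card (tms r) \<le> \<sigma>" and T: "0 < lifetime G"
    and m: "0 < m"
  shows "ETC G d1 d2 k \<longleftrightarrow>
    (\<exists>q<K ^ \<sigma>. 0 < table (compat d2 (lifetime G) K \<sigma>) (state_cost d1 (lifetime G) K \<sigma> tms) (K ^ \<sigma>) k m q)"
    (is "_ \<longleftrightarrow> ?R")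
proof -
  let ?T = "lifetime G" and ?N = "K ^ \<sigma>"
  let ?S = "state ?T K \<sigma>"
  have K: "0 < K" using T m by (cases vs) (auto simp: K_def)
  have cost: "state_cost d1 ?T K \<sigma> tms r q = (\<Sum>u\<le>r. edit_cost d1 ?T (started_by (?S (Suc r) q) u) (orig u r))"
    for r q unfolding state_cost_def by (intro sum.cong) (auto simp: started_by_state orig_def)
  let ?walk = "walk (compat d2 ?T K \<sigma>) (state_cost d1 ?T K \<sigma> tms) ?N k m"
  have R: "?R \<longleftrightarrow> (\<exists>f. f m < ?N \<and> ?walk f)"
    by (auto simp: less_table_iff)
  show ?thesis unfolding R
  proof (subst ETC_iff_slots[OF d \<sigma>], assumption, rule iffI)
    assume "\<exists>Q. plan d1 d2 \<sigma> k Q"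
    then obtain Q where Q: "Q 0 = {}" "\<And>r. r < m \<Longrightarrow> slots_ok ?T r (Q (Suc r)) \<and> finite (Q (Suc r)) \<and>
       card (Q (Suc r)) \<le> \<sigma> \<and> linked d2 r (Q r) (Q (Suc r))"
      "(\<Sum>r<m. \<Sum>u\<le>r. pair_cost d1 Q u r) \<le> k"
      unfolding plan_def by blast
    have ex: "\<exists>q. q < ?N \<and> ?S (Suc r) q = Q (Suc r)" if "r < m" for r
      using obtain_state[of ?T r "Q (Suc r)" \<sigma> "length vs"] Q(2)[OF that] that T by (auto simp: K_def)
    define f where "f i = (case i of 0 \<Rightarrow> 0 | Suc r \<Rightarrow> SOME q. q < ?N \<and> ?S (Suc r) q = Q (Suc r))" for i
    have f: "f (Suc r) < ?N \<and> ?S (Suc r) (f (Suc r)) = Q (Suc r)" if "r < m" for r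
      using someI_ex[OF ex[OF that]] by (simp add: f_def)
    have f0: "f 0 = 0" by (simp add: f_def)
    have fQ: "f i < ?N \<and> ?S i (f i) = Q i" if "i \<le> m" for i
      using f[of "i - 1"] that K Q(1) f0 by (cases i) (auto simp: state_row_0)
    have "(\<Sum>r<m. state_cost d1 ?T K \<sigma> tms r (f (Suc r))) \<le> k"
      unfolding cost using Q(3) fQ by (simp add: Suc_le_eq)
    then show "\<exists>f. f m < ?N \<and> ?walk f"
      using fQ f0 Q(2) by (intro exI[of _ f]) (auto simp: walk_def compat_def Suc_le_eq)
  next
    assume "\<exists>f. f m < ?N \<and> ?walk f"
    then obtain f where f: "\<forall>i<m. compat d2 ?T K \<sigma> i (f i) (f (Suc i))"
        "(\<Sum>i<m. state_cost d1 ?T K \<sigma> tms i (f (Suc i))) \<le> k" by (auto simp: walk_def)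
    show "\<exists>Q. plan d1 d2 \<sigma> k Q" unfolding plan_def
      using f by (intro exI[of _ "\<lambda>i. ?S i (f i)"])
        (auto simp: state_row_0 slots_ok_state[OF T] card_state compat_def cost)
  qed
qed

end

section \<open>The program\<close>

declare split_of_bool [split del]

abbreviation (input) "vans \<equiv> 0 :: nat"
abbreviation (input) "vn \<equiv> 49 :: nat"
abbreviation (input) "vk \<equiv> 2 :: nat"
abbreviation (input) "vd1 \<equiv> 3 :: nat"
abbreviation (input) "vd2 \<equiv> 4 :: nat"
abbreviation (input) "vm \<equiv> 5 :: nat"
abbreviation (input) "vsig \<equiv> 6 :: nat"
abbreviation (input) "vT \<equiv> 7 :: nat"
abbreviation (input) "vbase \<equiv> 8 :: nat"
abbreviation (input) "vK \<equiv> 9 :: nat"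
abbreviation (input) "vN \<equiv> 10 :: nat"
abbreviation (input) "vx \<equiv> 11 :: nat"
abbreviation (input) "vy \<equiv> 12 :: nat"
abbreviation (input) "vprev \<equiv> 13 :: nat"
abbreviation (input) "vrec \<equiv> 14 :: nat"
abbreviation (input) "vptr \<equiv> 15 :: nat"
abbreviation (input) "vi \<equiv> 16 :: nat"
abbreviation (input) "vv \<equiv> 17 :: nat"
abbreviation (input) "vdeg \<equiv> 18 :: nat"
abbreviation (input) "vr \<equiv> 19 :: nat"
abbreviation (input) "vq \<equiv> 20 :: nat"
abbreviation (input) "vp \<equiv> 21 :: nat"
abbreviation (input) "vc \<equiv> 22 :: nat"
abbreviation (input) "vbest \<equiv> 23 :: nat"
abbreviation (input) "vu \<equiv> 24 :: nat"
abbreviation (input) "vr1 \<equiv> 25 :: nat"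
abbreviation (input) "vlen \<equiv> 26 :: nat"
abbreviation (input) "vt \<equiv> 27 :: nat"
abbreviation (input) "vin \<equiv> 28 :: nat"
abbreviation (input) "vqq \<equiv> 29 :: nat"
abbreviation (input) "vj \<equiv> 30 :: nat"
abbreviation (input) "vdig \<equiv> 31 :: nat"
abbreviation (input) "va \<equiv> 32 :: nat"
abbreviation (input) "vb \<equiv> 33 :: nat"
abbreviation (input) "vst \<equiv> 34 :: nat"
abbreviation (input) "vlast \<equiv> 35 :: nat"
abbreviation (input) "vtau \<equiv> 36 :: nat"
abbreviation (input) "vhi \<equiv> 37 :: nat"
abbreviation (input) "vstart \<equiv> 38 :: nat"
abbreviation (input) "vlat \<equiv> 39 :: nat"
abbreviation (input) "vhit \<equiv> 40 :: nat"
abbreviation (input) "vbad \<equiv> 41 :: nat"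
abbreviation (input) "vfound \<equiv> 42 :: nat"
abbreviation (input) "vpp \<equiv> 43 :: nat"
abbreviation (input) "vj2 \<equiv> 44 :: nat"
abbreviation (input) "va2 \<equiv> 45 :: nat"
abbreviation (input) "vb2 \<equiv> 46 :: nat"
abbreviation (input) "vs2 \<equiv> 47 :: nat"
abbreviation (input) "vq2 \<equiv> 48 :: nat"

abbreviation plus_expr (infixl ".+" 65) where "x .+ y \<equiv> Bin Plus x y"
abbreviation monus_expr (infixl ".-" 65) where "x .- y \<equiv> Bin Monus x y"
abbreviation times_expr (infixl ".*" 70) where "x .* y \<equiv> Bin Times x y"
abbreviation quot_expr (infixl ".div" 70) where "x .div y \<equiv> Bin Quot x y"
abbreviation rem_expr (infixl ".mod" 70) where "x .mod y \<equiv> Bin Rem x y"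
abbreviation lt_expr (infix ".<" 50) where "x .< y \<equiv> Bin Lt x y"
abbreviation le_expr (infix ".<=" 50) where "x .<= y \<equiv> Bin Lt x (Bin Plus y (Con 1))"
abbreviation eq_expr (infix ".=" 50) where "x .= y \<equiv> Bin Eq x y"
text \<open>Any nonzero number counts as true, so products and sums act as conjunction and
  disjunction.\<close>

abbreviation and_expr (infixr ".&" 35) where "x .& y \<equiv> Bin Times x y"
abbreviation or_expr (infixr ".|" 30) where "x .| y \<equiv> Bin Plus x y"
abbreviation not_expr where "not_expr x \<equiv> Bin Eq x (Con 0)"
abbreviation set_var (infix ":=:" 62) where "x :=: e \<equiv> Asg x e"
abbreviation on_expr where "on_expr e c \<equiv> Cond e c Skip"

definition decode_com :: "nat \<Rightarrow> nat \<Rightarrow> nat \<Rightarrow> nat \<Rightarrow> com" where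
  "decode_com q a b s = vdig :=: Var q .mod Var vK ;; q :=: Var q .div Var vK ;;
     a :=: Var vdig .mod Var vT .+ Con 1 ;; b :=: Var vdig .div Var vT .mod Var vT .+ Con 1 ;;
     s :=: Var vdig .div (Var vT .* Var vT)"

text \<open>The two tests on \<open>vt\<close> imply \<open>va \<le> vb\<close>, so invalid digits
  are filtered out by them and by the test on \<open>vst\<close>.\<close>

definition covered_com :: com where
  "covered_com = vin :=: Con 0 ;; vqq :=: Var vq ;;
     For vj vsig (decode_com vqq va vb vst ;;
       on_expr ((Var vst .<= Var vu) .& (Var va .<= Var vt) .& (Var vt .<= Var vb)) (vin :=: Con 1))"

text \<open>\<open>vtau\<close> holds the predecessor of the window start under consideration.\<close>

definition window_com :: com where
  "window_com = vstart :=: Con 0 ;; vlat :=: Con 0 ;; vqq :=: Var vq ;; vhi :=: Var vtau .+ Var vd1 ;;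
     For vj vsig (decode_com vqq va vb vst ;;
       on_expr ((Var vst .<= Var vu) .& (Var va .<= Var vb))
         (on_expr ((Var va .<= Var vtau .+ Con 1) .&
             ((Var vtau .< Var va) .| (Var vhi .<= Var vb))) (vstart :=: Con 1) ;;
          on_expr (Var va .<= Var vhi)
            (Cond (Var vb .< Var vhi) (vt :=: Var vb) (vt :=: Var vhi) ;;
             on_expr (Var vlat .< Var vt) (vlat :=: Var vt))))"

definition hit_com :: com where
  "hit_com = vhit :=: (Var vtau .< Var vlast) ;;
     For vi vlen (vt :=: Rd (Var vrec .+ Con 3 .+ Var vi) ;;
       on_expr ((Var vtau .< Var vt) .& (Var vt .<= Var vhi))
         (covered_com ;; on_expr (Var vin) (vhit :=: Con 1)))"

definition pair_com :: com where
  "pair_com =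
     For vi vlen (vt :=: Rd (Var vrec .+ Con 3 .+ Var vi) ;; covered_com ;;
       on_expr (not_expr (Var vin)) (vc :=: Var vc .+ Con 1)) ;;
     vlast :=: Con 0 ;;
     For vtau vT (window_com ;; hit_com ;;
       on_expr (Var vstart .& not_expr (Var vhit)) (vlast :=: Var vlat ;; vc :=: Var vc .+ Con 1))"

text \<open>A pair that is not a path edge has no original times, which is expressed by the length
  0.\<close>

definition cost_com :: com where
  "cost_com = vc :=: Con 0 ;; vr1 :=: Var vr .+ Con 1 ;;
     For vu vr1 (vlen :=: Con 0 ;;
       on_expr (Var vu .= Var vr) (vlen :=: Rd (Var vrec .+ Con 2)) ;; pair_com)"

definition gap_expr :: expr where
  "gap_expr = ((Var vb .+ Var vd2 .<= Var va2) .| (Var vb2 .+ Var vd2 .<= Var va))"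

definition same_expr :: expr where
  "same_expr = ((Var va .= Var va2) .& (Var vb .= Var vb2) .& (Var vst .= Var vs2))"

text \<open>One loop serves the digits of both states; nested in the loop of
  \<open>compat_com\<close> it yields the factor \<sigma>^2 for a pair of states. Repeated digits
  are harmless, since equal slots never set \<open>vbad\<close>.\<close>

definition compare_com :: com where
  "compare_com =
     For vj2 vsig (decode_com vpp va2 vb2 vs2 ;;
       on_expr ((Var va2 .<= Var vb2) .& (Var vs2 .< Var vr))
         (Cond same_expr (vfound :=: Con 1) (on_expr (not_expr gap_expr) (vbad :=: Con 1))) ;;
       decode_com vq2 va2 vb2 vs2 ;;
       on_expr ((Var va2 .<= Var vb2) .& (Var vs2 .<= Var vr) .& not_expr same_expr .& not_expr gap_expr)
         (vbad :=: Con 1))"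

definition compat_com :: com where
  "compat_com = vbad :=: Con 0 ;; vqq :=: Var vq ;;
     For vj vsig (decode_com vqq va vb vst ;;
       on_expr ((Var va .<= Var vb) .& (Var vst .<= Var vr))
         (vfound :=: (Var vst .= Var vr) ;; vpp :=: Var vp ;; vq2 :=: Var vq ;; compare_com ;;
          on_expr (not_expr (Var vfound)) (vbad :=: Con 1)))"

lemma writes_blocks [simp]:
  "writes (decode_com q a b s) = {vdig, q, a, b, s}"
  "writes covered_com = {vin, vqq, vj, vdig, va, vb, vst}"
  "writes window_com = {vstart, vlat, vqq, vhi, vj, vdig, va, vb, vst, vt}"
  "writes hit_com = {vhit, vi, vt, vin, vqq, vj, vdig, va, vb, vst}"
  "writes pair_com = {vi, vt, vin, vqq, vj, vdig, va, vb, vst, vc, vlast, vtau, vstart, vlat, vhi, vhit}"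
  "writes cost_com = {vc, vr1, vu, vlen, vi, vt, vin, vqq, vj, vdig, va, vb, vst, vlast, vtau, vstart,
     vlat, vhi, vhit}"
  "writes compare_com = {vj2, vdig, va2, vb2, vs2, vpp, vq2, vfound, vbad}"
  "writes compat_com = {vbad, vqq, vj, vdig, va, vb, vst, vfound, vpp, vq2, vj2, va2, vb2, vs2}"
  unfolding compat_com_def compare_com_def cost_com_def pair_com_def hit_com_def window_com_def covered_com_def
    decode_com_def by auto

lemma pure_blocks [simp]:
  "pure (decode_com q a b s)" "pure covered_com" "pure window_com" "pure hit_com" "pure pair_com"
  "pure cost_com" "pure compare_com" "pure compat_com"
  unfolding compat_com_def compare_com_def cost_com_def pair_com_def hit_com_def window_com_def covered_com_def
    decode_com_def by auto

section \<open>Correctness of the pricing of a state\<close>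

definition spans :: "slot set \<Rightarrow> (nat \<times> nat) set" where
  "spans S = (\<lambda>(a, b, s). (a, b)) ` S"

lemma spans_insert [simp]: "spans (insert (a, b, s) S) = insert (a, b) (spans S)"
  by (simp add: spans_def)

lemma cover_insert [simp]: "t \<in> cover (insert (a, b) A) \<longleftrightarrow> (a \<le> t \<and> t \<le> b) \<or> t \<in> cover A"
  by (auto simp: cover_def)

lemma is_start_insert [simp]:
  "is_start d (insert (a, b) A) \<tau> \<longleftrightarrow> (a \<le> \<tau> \<and> \<tau> \<le> max a (b + 1 - d)) \<or> is_start d A \<tau>"
  by (auto simp: is_start_def)

lemma latest_insert [simp]:
  assumes "finite A"
  shows "latest d (insert (a, b) A) \<tau> =
    (if a \<le> \<tau> + d - 1 then max (min b (\<tau> + d - 1)) (latest d A \<tau>) else latest d A \<tau>)"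
proof -
  let ?f = "\<lambda>(a, b). min b (\<tau> + d - 1)"
  have fin: "finite {(a, b) \<in> A. a \<le> \<tau> + d - 1}" using assms by (auto intro: finite_subset[of _ A])
  have "{(a', b') \<in> insert (a, b) A. a' \<le> \<tau> + d - 1} =
    (if a \<le> \<tau> + d - 1 then insert (a, b) {(a', b') \<in> A. a' \<le> \<tau> + d - 1} else {(a', b') \<in> A. a' \<le> \<tau> + d - 1})"
    by auto
  then show ?thesis using fin unfolding latest_def by (simp add: insert_commute[of 0])
qed

lemma spans_empty [simp]: "spans {} = {}" "cover {} = {}" "\<not> is_start d {} \<tau>" "latest d {} \<tau> = 0"
  by (auto simp: spans_def cover_def is_start_def latest_def)

locale instance_bounds =
  fixes Z :: nat and \<rho> :: "nat \<Rightarrow> nat" and n d1 d2 m \<sigma> T :: nat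
  assumes pos: "0 < T" "0 < d1" "0 < d2" "0 < n"
    and \<rho>: "\<sigma> \<le> \<rho> vsig" "\<sigma> \<le> \<rho> vlen" "T \<le> \<rho> vT" "n \<le> \<rho> vr1"
    and Z: "5 \<le> Z" "T + d1 \<le> Z" "T + d2 \<le> Z" "(n * T * T) ^ \<sigma> \<le> Z" "n * (T + \<sigma>) \<le> Z" "2 * n \<le> Z"
begin

abbreviation "K \<equiv> n * T * T"
abbreviation "N \<equiv> K ^ \<sigma>"

definition glob :: "(nat \<Rightarrow> nat) \<Rightarrow> bool" where
  "glob R \<longleftrightarrow> R vn = n \<and> R vd1 = d1 \<and> R vd2 = d2 \<and> R vm = m \<and> R vsig = \<sigma> \<and> R vT = T \<and> R vK = K \<and> R vN = N"

abbreviation tr :: "com \<Rightarrow> (store \<Rightarrow> bool) \<Rightarrow> store \<Rightarrow> bool" where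
  "tr \<equiv> wp Z \<rho>"

lemma T_le_Z: "T \<le> Z" using Z by simp

lemma wp_decode:
  assumes "R vK = K" "R vT = T" "R q \<le> Z" "distinct [q, a, b, s, vdig, vK, vT]"
    and "\<And>R'. (\<And>x. x \<notin> {vdig, q, a, b, s} \<Longrightarrow> R' x = R x) \<Longrightarrow> R' q = R q div K \<Longrightarrow>
      (R' a, R' b, R' s) = decode T (R q mod K) \<Longrightarrow> Q (R', h)"
  shows "tr (decode_com q a b s) Q (R, h)"
proof -
  have "x mod T + 1 \<le> Z" for x
    using mod_less_divisor[OF pos(1), of x] T_le_Z by linarith
  moreover have "R q mod K \<le> Z" "R q div K \<le> Z" "R q mod K div (T * T) \<le> Z"
    using assms(3) by (meson div_le_dividend mod_less_eq_dividend le_trans)+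
  ultimately show ?thesis using assms(1-4) unfolding decode_com_def
    by (simp, intro assms(5)) (auto simp: decode_def)
qed

abbreviation st :: "nat \<Rightarrow> nat \<Rightarrow> nat \<Rightarrow> (nat \<times> nat) set" where
  "st j u q \<equiv> spans (state T K j (Suc u) q)"

lemma finite_st: "finite (st j u q)"
  using card_state by (simp add: spans_def)

lemma intervals_ok_st: "intervals_ok T (st j u q)"
proof -
  have "st j u q = started_by (state T K j (Suc u) q) u"
    using started_by_state[of u u T K j q] by (simp add: spans_def)
  then show ?thesis using intervals_ok_started_by[OF slots_ok_state[OF pos(1)]] by simp
qed

lemma div_K: "q div K ^ i div K = q div K ^ Suc i"
  by (metis div_mult2_eq power_Suc2)

lemma st_Suc:
  assumes "(a, b, s) = decode T (q div K ^ i mod K)"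
  shows "st (Suc i) u q = (if a \<le> b \<and> s \<le> u then insert (a, b) (st i u q) else st i u q)"
  by (simp add: state_Suc Let_def assms[symmetric] less_Suc_eq_le)

text \<open>After \<open>i\<close> rounds the first \<open>i\<close> digits have been consumed and
  the rest is \<open>q div K ^ i\<close>; the result so far is the one for the state made of these
  digits. This is the pattern of all loops over slots, and the reason why \<open>state\<close> takes
  the number of digits as an argument.\<close>

lemma wp_covered:
  assumes "glob R" "R vq = q" "R vu = u" "R vt = t" "q \<le> Z"
  shows "tr covered_com (\<lambda>(R', h'). R' vin = of_bool (t \<in> cover (st \<sigma> u q))) (R, h)"
  unfolding covered_com_def
  apply (simp add: assms)
  apply (rule wp_For[where I = "\<lambda>i R' h'. R' vqq = q div K ^ i \<and> R' vin = of_bool (t \<in> cover (st i u q))"])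
  subgoal by simp
  subgoal using assms \<rho> by (simp add: glob_def)
  subgoal by simp
  subgoal premises prems for i R' h'
  proof -
    have g: "glob R'" "R' vu = u" "R' vt = t" using assms prems(3) by (auto simp: glob_def)
    have le: "R' vqq \<le> Z" using prems(5) assms(5) by (simp add: div_le_dividend le_trans[OF div_le_dividend])
    show ?thesis unfolding wp_simps
      apply (rule wp_decode)
      prefer 5
      subgoal premises p for R''
        using st_Suc[OF p(3)[unfolded prems(5)[THEN conjunct1]], of u] p(2) prems(5) Z(1) g
        by (auto simp: p(1) div_K less_Suc_eq_le)
      using g le by (auto simp: glob_def)
  qed
  subgoal using assms by (simp add: glob_def)
  done

text \<open>Removes the maximum and the truncated difference: either the window starts at
  \<open>a\<close> itself or the whole window fits into the interval.\<close>

lemma start_condition: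
  "0 < d \<Longrightarrow> (a \<le> Suc \<tau> \<and> Suc \<tau> \<le> max a (b + 1 - d)) \<longleftrightarrow> a \<le> Suc \<tau> \<and> (\<tau> < a \<or> \<tau> + d \<le> b)"
  by (auto simp: max_def)

lemma decode_le: "(a, b, s) = decode T x \<Longrightarrow> a \<le> T \<and> b \<le> T"
  using pos(1) by (simp add: decode_def Suc_le_eq)

lemma wp_window:
  assumes "glob R" "R vq = q" "R vu = u" "R vtau = \<tau>" "\<tau> < T" "q \<le> Z"
  shows "tr window_com (\<lambda>(R', h'). R' vstart = of_bool (is_start d1 (st \<sigma> u q) (Suc \<tau>)) \<and>
    R' vlat = latest d1 (st \<sigma> u q) (Suc \<tau>) \<and> R' vhi = \<tau> + d1) (R, h)"
proof -
  have hi: "\<tau> + d1 \<le> Z" using Z assms(5) by linarith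
  show ?thesis
  unfolding window_com_def
  apply (simp add: assms hi[unfolded assms(4)[symmetric]])
  apply (rule conjI)
  subgoal using hi assms by (simp add: glob_def)
  apply (rule wp_For[where I = "\<lambda>i R' h'. R' vqq = q div K ^ i \<and>
     R' vstart = of_bool (is_start d1 (st i u q) (Suc \<tau>)) \<and> R' vlat = latest d1 (st i u q) (Suc \<tau>)"])
  subgoal by simp
  subgoal using assms \<rho> by (simp add: glob_def)
  subgoal by simp
  subgoal premises prems for i R' h'
  proof -
    have g: "glob R'" "R' vu = u" "R' vtau = \<tau>" "R' vhi = \<tau> + d1"
      using assms prems(3) by (auto simp: glob_def)
    have le: "R' vqq \<le> Z" using prems(5) assms(6) by (simp add: div_le_dividend le_trans[OF div_le_dividend])
    show ?thesis unfolding wp_simps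
      apply (rule wp_decode)
      prefer 5
      subgoal premises p for R''
      proof -
        let ?a = "R'' va" and ?b = "R'' vb" and ?s = "R'' vst"
        have S: "st (Suc i) u q = (if ?a \<le> ?b \<and> ?s \<le> u then insert (?a, ?b) (st i u q) else st i u q)"
          using prems(5) by (intro st_Suc) (simp add: p(3))
        have 1: "is_start d1 (st (Suc i) u q) (Suc \<tau>) \<longleftrightarrow>
          (?a \<le> ?b \<and> ?s \<le> u \<and> ?a \<le> Suc \<tau> \<and> (\<tau> < ?a \<or> \<tau> + d1 \<le> ?b)) \<or> is_start d1 (st i u q) (Suc \<tau>)"
          using start_condition[OF pos(2), of ?a \<tau> ?b] unfolding S by auto
        have 2: "latest d1 (st (Suc i) u q) (Suc \<tau>) = (if ?a \<le> ?b \<and> ?s \<le> u \<and> ?a \<le> \<tau> + d1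
          then max (min ?b (\<tau> + d1)) (latest d1 (st i u q) (Suc \<tau>)) else latest d1 (st i u q) (Suc \<tau>))"
          unfolding S by (simp add: finite_st)
        have b: "?b \<le> Z" using decode_le[OF p(3)] T_le_Z by simp
        have R: "R'' vu = u" "R'' vtau = \<tau>" "R'' vhi = \<tau> + d1" "R'' vqq = q div K ^ Suc i"
          "R'' vstart = of_bool (is_start d1 (st i u q) (Suc \<tau>))" "R'' vlat = latest d1 (st i u q) (Suc \<tau>)"
          using p(1)[of vu] p(1)[of vtau] p(1)[of vhi] p(1)[of vstart] p(1)[of vlat] p(2) prems(5) g
          by (simp_all only: div_K) simp_all
        show ?thesis unfolding 1 2 using b hi Z(1)
          by (auto simp: R less_Suc_eq_le min_def max_def not_less simp del: power_Suc)
      qed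
      using g le by (auto simp: glob_def)
  qed
  subgoal using assms by (simp add: glob_def)
  done
qed

lemma wp_hit:
  assumes "glob R" "R vq = q" "R vu = u" "R vtau = \<tau>" "R vhi = \<tau> + d1" "R vlast = l"
    "R vlen = length ts" "R vrec = A" "\<And>i. i < length ts \<Longrightarrow> h (A + 3 + i) = ts ! i"
    "length ts \<le> \<sigma>" "set ts \<subseteq> {1..T}" "q \<le> Z"
  shows "tr hit_com (\<lambda>(R', h'). 0 < R' vhit \<longleftrightarrow>
    \<tau> < l \<or> (\<exists>t\<in>set ts \<inter> cover (st \<sigma> u q). \<tau> < t \<and> t \<le> \<tau> + d1)) (R, h)"
  unfolding hit_com_def
  apply (simp add: assms)
  apply (rule conjI)
  subgoal using Z by (simp add: of_bool_def)
  apply (rule wp_For[where I = "\<lambda>i R' h'. 0 < R' vhit \<longleftrightarrow>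
    \<tau> < l \<or> (\<exists>t\<in>set (take i ts) \<inter> cover (st \<sigma> u q). \<tau> < t \<and> t \<le> \<tau> + d1)"])
  subgoal by simp
  subgoal using assms \<rho> by simp
  subgoal by simp
  subgoal premises prems for i R' h'
  proof -
    have i: "i < length ts" using prems(1) assms by simp
    have g: "glob R'" "R' vu = u" "R' vtau = \<tau>" "R' vhi = \<tau> + d1" "R' vq = q" "R' vrec = A" "h' = h"
      using assms prems(3,4) by (auto simp: glob_def)
    have t: "h (A + 3 + i) = ts ! i" "ts ! i \<le> Z" using assms(9)[OF i] subsetD[OF assms(11) nth_mem[OF i]] T_le_Z by auto
    have tk: "set (take (Suc i) ts) = insert (ts ! i) (set (take i ts))"
      using i by (simp add: take_Suc_conv_app_nth)
    show ?thesis
      using t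
      apply (simp add: g prems(2))
      apply (intro conjI impI)
      subgoal
        apply (rule wp_conseq[OF wp_covered[of _ q u "ts ! i"]])
        using g prems(5) assms(12) tk Z(1) by (auto simp: glob_def)
      using prems(5) tk by auto
  qed
  subgoal using assms by simp
  done

lemma wp_pair:
  assumes "glob R" "R vq = q" "R vu = u" "R vc = c" "R vlen = length ts" "R vrec = A"
    "\<And>i. i < length ts \<Longrightarrow> h (A + 3 + i) = ts ! i"
    "length ts \<le> \<sigma>" "set ts \<subseteq> {1..T}" "distinct ts" "q \<le> Z" "c + T + \<sigma> \<le> Z"
  shows "tr pair_com (\<lambda>(R', h'). R' vc = c + edit_cost d1 T (st \<sigma> u q) (set ts)) (R, h)"
  unfolding pair_com_def wp_simps
  apply (rule wp_For[where I = "\<lambda>i R' h'. R' vc = c + card (set (take i ts) - cover (st \<sigma> u q))"])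
  subgoal by simp
  subgoal using assms \<rho> by simp
  subgoal using assms by simp
  subgoal premises prems for i R' h'
  proof -
    have i: "i < length ts" using prems(1) assms by simp
    have g: "glob R'" "R' vu = u" "R' vq = q" "R' vrec = A" "h' = h"
      using assms prems(3,4) by (auto simp: glob_def)
    have t: "h (A + 3 + i) = ts ! i" "ts ! i \<le> Z" using assms(7)[OF i] subsetD[OF assms(9) nth_mem[OF i]] T_le_Z by auto
    have tk: "set (take (Suc i) ts) = insert (ts ! i) (set (take i ts))" "ts ! i \<notin> set (take i ts)"
      using i assms(10) by (simp_all add: take_Suc_conv_app_nth) (auto simp: in_set_conv_nth nth_eq_iff_index_eq)
    have "card (set (take i ts) - cover (st \<sigma> u q)) \<le> card (set (take i ts))" by (intro card_mono) auto
    also have "\<dots> \<le> \<sigma>" using card_length[of "take i ts"] assms(8) by simp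
    finally have card: "card (set (take i ts) - cover (st \<sigma> u q)) \<le> \<sigma>" .
    have le: "Suc (c + card (set (take i ts) - cover (st \<sigma> u q))) \<le> Z"
      using card assms(12) pos(1) by linarith
    show ?thesis
      using t
      apply (simp add: g prems(2))
      apply (rule wp_conseq[OF wp_covered[of _ q u "ts ! i"]])
      using g prems(5) assms(11) tk le by (auto simp: glob_def insert_Diff_if)
  qed
  subgoal premises prems for R' h'
  proof -
    have g: "glob R'" "R' vu = u" "R' vq = q" "R' vrec = A" "R' vlen = length ts" "h' = h"
      using assms prems(2,3) by (auto simp: glob_def)
    let ?F = "set ts \<inter> cover (st \<sigma> u q)"
    let ?g = "greedy d1 (st \<sigma> u q) ?F"
    let ?c = "c + card (set ts - cover (st \<sigma> u q))"
    have c: "R' vc = ?c" using prems(1) assms by simp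
    have "card (set ts - cover (st \<sigma> u q)) \<le> card (set ts)" by (intro card_mono) auto
    also have "\<dots> \<le> \<sigma>" using card_length[of ts] assms(8) by simp
    finally have cle: "?c + T \<le> Z" using assms(12) by simp
    show ?thesis
      apply simp
      apply (rule wp_For[where I = "\<lambda>i R' h'. R' vlast = fst (?g i) \<and> R' vc = ?c + snd (?g i)"])
      subgoal by simp
      subgoal using g \<rho> by (simp add: glob_def)
      subgoal using c by simp
      subgoal premises pr for i R'' h''
      proof -
        have i: "i < T" using pr(1) g by (simp add: glob_def)
        have g'': "glob R''" "R'' vu = u" "R'' vq = q" "R'' vrec = A" "R'' vlen = length ts" "h'' = h"
          using g pr(3,4) by (auto simp: glob_def)
        have sz: "?c + Suc (snd (?g i)) \<le> Z" using cle greedy_le[of d1 "st \<sigma> u q" ?F i] i by linarith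
        have lat: "latest d1 (st \<sigma> u q) (Suc i) \<le> Z" if "is_start d1 (st \<sigma> u q) (Suc i)"
          using latest_props(1)[OF intervals_ok_st that pos(2)] cover_subset[OF intervals_ok_st] T_le_Z
          by fastforce
        show ?thesis
          apply (simp del: greedy.simps)
          apply (rule wp_conseq[OF wp_window[of _ q u i]])
          using g'' pr(2) i assms(11) apply (simp_all)[6]
          subgoal premises p for R1 h1
            unfolding wp_simps(3)
            apply (rule wp_conseq[OF wp_hit[of _ q u i "fst (?g i)" ts A]])
            using g'' p pr(2,5) assms(7-11)
            apply (auto simp: glob_def)[12]
            subgoal premises p2 for R2 h2
            proof -
              have R2: "R2 vlast = fst (?g i)" "R2 vc = ?c + snd (?g i)"
                "R2 vstart = of_bool (is_start d1 (st \<sigma> u q) (Suc i))"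
                "R2 vlat = latest d1 (st \<sigma> u q) (Suc i)"
                using p2(2) p pr(5) by auto
              have "?g (Suc i) = (if is_start d1 (st \<sigma> u q) (Suc i) \<and> \<not> 0 < R2 vhit
                  then (latest d1 (st \<sigma> u q) (Suc i), Suc (snd (?g i))) else ?g i)"
                using p2(1) by (auto simp: case_prod_beta Let_def less_Suc_eq_le Suc_le_eq not_less)
              then show ?thesis using R2 sz lat by (auto simp del: greedy.simps)
            qed
            done
          done
      qed
      subgoal using g by (simp add: glob_def edit_cost_def ac_simps)
      done
  qed
  done

lemma edit_cost_bound: "finite X \<Longrightarrow> edit_cost d T A X \<le> T + card X"
  unfolding edit_cost_def by (intro add_mono greedy_le card_mono) auto

text \<open>Each of the at most \<open>n\<close> pairs contributes at most \<open>T\<close>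
  additions and \<open>\<sigma>\<close> deletions, so the running total stays below
  \<open>n * (T + \<sigma>)\<close>, one of the quantities bounded by \<open>Z\<close>.\<close>

lemma wp_cost:
  assumes "glob R" "R vq = q" "R vr = r" "r < n" "R vrec = A" "h (A + 2) = length ts"
    "\<And>i. i < length ts \<Longrightarrow> h (A + 3 + i) = ts ! i"
    "length ts \<le> \<sigma>" "set ts \<subseteq> {1..T}" "distinct ts" "q \<le> Z" "tm r = set ts"
  shows "tr cost_com (\<lambda>(R', h'). R' vc = state_cost d1 T K \<sigma> tm r q) (R, h)"
proof -
  let ?e = "\<lambda>u. edit_cost d1 T (st \<sigma> u q) (if u = r then set ts else {})"
  have bound: "(\<Sum>u<i. ?e u) + T + \<sigma> \<le> Z" if "i \<le> r" for i
  proof -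
    have card: "card (set ts) \<le> \<sigma>" using card_length[of ts] assms(8) by linarith
    have "?e u \<le> T + \<sigma>" for u
      using edit_cost_bound[of "if u = r then set ts else {}" d1 "st \<sigma> u q"] card
      by (auto split: if_splits)
    then have "(\<Sum>u<i. ?e u) \<le> of_nat (card {..<i}) * (T + \<sigma>)" by (intro sum_bounded_above)
    then have "(\<Sum>u<i. ?e u) + T + \<sigma> \<le> Suc i * (T + \<sigma>)" by simp
    also have "\<dots> \<le> n * (T + \<sigma>)" using that assms(4) by (intro mult_le_mono1) simp
    finally show ?thesis using Z by linarith
  qed
  have nZ: "Suc r \<le> Z" "\<sigma> \<le> Z" using assms(4) Z bound[of 0] by auto
  show ?thesis
  unfolding cost_com_def
  apply (simp add: assms nZ)
  apply (rule wp_For[where I = "\<lambda>i R' h'. R' vc = (\<Sum>u<i. ?e u)"])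
  subgoal by simp
  subgoal using assms \<rho> by simp
  subgoal by simp
  subgoal premises prems for i R' h'
  proof -
    have g: "glob R'" "R' vr = r" "R' vq = q" "R' vrec = A" "h' = h" "i \<le> r"
      using assms prems(1,3,4) by (auto simp: glob_def)
    define us where "us = (if i = r then ts else [])"
    have us: "(if i = r then set ts else {}) = set us" "length us \<le> \<sigma>" "set us \<subseteq> {1..T}" "distinct us"
      using assms by (auto simp: us_def)
    have pair: "tr pair_com (\<lambda>(R', h'). R' vc = (\<Sum>u<Suc i. ?e u)) (R'(vlen := length us), h)"
      apply (rule wp_conseq[OF wp_pair[of _ q i "\<Sum>u<i. ?e u" us A]])
      using g us prems(2,5) bound[of i] assms(7,11)
      by (auto simp: glob_def us_def split: if_splits)
    have "tr pair_com (\<lambda>(R'', h''). (R''(vu := Suc i)) vc = (\<Sum>u<Suc i. ?e u)) (R'(vlen := length us), h)"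
      by (rule wp_conseq[OF pair]) simp
    then show ?thesis using g nZ prems(2) assms(6,8) by (auto simp: us_def)
  qed
  subgoal using assms by (simp add: state_cost_def spans_def lessThan_Suc_atMost cong: if_cong)
  done
qed

end

section \<open>Transitions between states and the rows of the table\<close>

definition best_com :: com where
  "best_com = vbest :=: Con 0 ;;
     For vp vN (compat_com ;;
       on_expr (not_expr (Var vbad))
         (vt :=: Rd (Var vbase .+ Var vr .* Var vN .+ Var vp) .- Var vc ;;
          on_expr (Var vbest .< Var vt) (vbest :=: Var vt)))"

definition row_com :: com where
  "row_com = For vq vN (cost_com ;; best_com ;;
     Sto (Var vbase .+ (Var vr .+ Con 1) .* Var vN .+ Var vq) (Var vbest))"

lemma writes_best [simp]:
  "writes best_com = {vbest, vp, vt, vbad, vqq, vj, vdig, va, vb, vst, vfound, vpp, vq2, vj2, va2, vb2, vs2}"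
  by (auto simp: best_com_def)

lemma writes_row [simp]:
  "writes row_com = {vq, vbest, vp, vbad, vfound, vpp, vq2, vj2, va2, vb2, vs2,
     vc, vr1, vu, vlen, vi, vt, vin, vqq, vj, vdig, va, vb, vst, vlast, vtau, vstart, vlat, vhi, vhit}"
  by (auto simp: row_com_def)

lemma pure_best [simp]: "pure best_com"
  by (simp add: best_com_def)

text \<open>Blames a failure on a single slot of the new state, which is how
  \<open>compat_com\<close> searches for it.\<close>

lemma not_linked_iff:
  "\<not> linked d r S S' \<longleftrightarrow>
   (\<exists>y\<in>S'. (snd (snd y) \<noteq> r \<and> y \<notin> S) \<or> (\<exists>x\<in>S \<union> S'. x \<noteq> y \<and> \<not> apart d x y))"
  unfolding linked_def case_prod_beta prod.collapse by blast

context instance_bounds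
begin

lemma state_Suc':
  assumes "(a, b, s) = decode T (q div K ^ i mod K)"
  shows "state T K (Suc i) r q = (if a \<le> b \<and> s < r then insert (a, b, s) (state T K i r q) else state T K i r q)"
  by (simp add: state_Suc Let_def assms[symmetric])

lemma wp_compare:
  assumes g: "glob R" and R: "R vr = r" "R va = a" "R vb = b" "R vst = s" "R vpp = p" "R vq2 = q"
    "0 < R vfound \<longleftrightarrow> s = r" and pq: "p \<le> Z" "q \<le> Z"
  shows "tr compare_com (\<lambda>(R', h').
    (0 < R' vfound \<longleftrightarrow> s = r \<or> (a, b, s) \<in> state T K \<sigma> r p) \<and>
    (0 < R' vbad \<longleftrightarrow> 0 < R vbad \<or>
      (\<exists>x\<in>state T K \<sigma> r p \<union> state T K \<sigma> (Suc r) q. x \<noteq> (a, b, s) \<and> \<not> apart d2 x (a, b, s)))) (R, h)"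
proof -
  let ?y = "(a, b, s)"
  define bad where "bad S \<longleftrightarrow> 0 < R vbad \<or> (\<exists>x\<in>S. x \<noteq> ?y \<and> \<not> apart d2 x ?y)" for S
  have bad_insert: "bad (insert x S) \<longleftrightarrow> bad S \<or> (x \<noteq> ?y \<and> \<not> apart d2 x ?y)" for x S
    by (auto simp: bad_def)
  have div_le: "x div K ^ i \<le> Z" if "x \<le> Z" for x i
    using that le_trans[OF div_le_dividend] by blast
  show ?thesis
    unfolding compare_com_def bad_def[symmetric]
    apply (rule wp_For[where I = "\<lambda>i R' h'. R' vpp = p div K ^ i \<and> R' vq2 = q div K ^ i \<and>
      (0 < R' vfound \<longleftrightarrow> s = r \<or> ?y \<in> state T K i r p) \<and>
      (0 < R' vbad \<longleftrightarrow> bad (state T K i r p \<union> state T K i (Suc r) q))"])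
    subgoal by simp
    subgoal using g \<rho> by (simp add: glob_def)
    subgoal using R by (simp add: bad_def)
    subgoal premises prems for j R' h'
    proof -
      have g': "R' vK = K" "R' vT = T" "R' vr = r" "R' vd2 = d2" "R' va = a" "R' vb = b" "R' vst = s"
        using g R prems(3) by (simp_all add: glob_def)
      have I: "R' vpp = p div K ^ j" "R' vq2 = q div K ^ j"
        "0 < R' vfound \<longleftrightarrow> s = r \<or> ?y \<in> state T K j r p"
        "0 < R' vbad \<longleftrightarrow> bad (state T K j r p \<union> state T K j (Suc r) q)"
        using prems(5) by auto
      have le: "p div K ^ j \<le> Z" "q div K ^ j \<le> Z" using div_le pq by auto
      show ?thesis unfolding wp_simps(3)
        apply (rule wp_decode)
        prefer 5
        subgoal premises p1 for R1
        proof -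
          obtain a2 b2 s2 where x: "R1 va2 = a2" "R1 vb2 = b2" "R1 vs2 = s2" by blast
          let ?x = "(a2, b2, s2)"
          have P: "state T K (Suc j) r p =
            (if a2 \<le> b2 \<and> s2 < r then insert ?x (state T K j r p) else state T K j r p)"
            using state_Suc'[of a2 b2 s2 p j r] p1(3) x I by simp
          have R1: "R1 vK = K" "R1 vT = T" "R1 vr = r" "R1 vd2 = d2" "R1 va = a" "R1 vb = b" "R1 vst = s"
            "R1 vpp = p div K ^ Suc j" "R1 vq2 = q div K ^ j" "R1 vfound = R' vfound" "R1 vbad = R' vbad"
            using p1(1,2) g' I by (simp_all add: div_K del: power_Suc)
          have mid: "tr (on_expr ((Var va2 .<= Var vb2) .& (Var vs2 .< Var vr))
            (Cond same_expr (vfound :=: Con 1) (on_expr (not_expr gap_expr) (vbad :=: Con 1))))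
            (\<lambda>(R', h'). (0 < R' vfound \<longleftrightarrow> s = r \<or> ?y \<in> state T K (Suc j) r p) \<and>
              (0 < R' vbad \<longleftrightarrow> bad (state T K (Suc j) r p \<union> state T K j (Suc r) q))) (R1, h')"
            using I(3,4) Z(1) unfolding P
            by (auto simp: same_expr_def gap_expr_def x R1 less_Suc_eq_le apart_def bad_insert)
          show ?thesis
            apply (rule wp_conseq[OF mid])
            subgoal premises p2 for R2 h2
              unfolding wp_simps(3)
              apply (rule wp_decode)
              prefer 5
              subgoal premises p3 for R3
              proof -
                have R2: "R2 vpp = p div K ^ Suc j" "R2 vq2 = q div K ^ j" "R2 vr = r" "R2 vd2 = d2"
                  "R2 va = a" "R2 vb = b" "R2 vst = s"
                  using p2(2) R1 by (simp_all add: same_expr_def gap_expr_def)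
                have R3: "R3 vpp = p div K ^ Suc j" "R3 vq2 = q div K ^ Suc j" "R3 vr = r" "R3 vd2 = d2"
                  "R3 va = a" "R3 vb = b" "R3 vst = s" "R3 vfound = R2 vfound" "R3 vbad = R2 vbad"
                  using p3(1,2) R2 by (simp_all add: div_K del: power_Suc)
                obtain a3 b3 s3 where z: "R3 va2 = a3" "R3 vb2 = b3" "R3 vs2 = s3" by blast
                let ?z = "(a3, b3, s3)"
                have Q: "state T K (Suc j) (Suc r) q =
                  (if a3 \<le> b3 \<and> s3 \<le> r then insert ?z (state T K j (Suc r) q) else state T K j (Suc r) q)"
                  using state_Suc'[of a3 b3 s3 q j "Suc r"] p3(3) z R2 by (simp add: less_Suc_eq_le)
                show ?thesis using p2(1) Z(1) unfolding Q
                  by (auto simp: same_expr_def gap_expr_def z R3 less_Suc_eq_le apart_def bad_insert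
                      simp del: power_Suc)
              qed
              using p2(2) R1 le by (auto simp: same_expr_def gap_expr_def)
            done
        qed
        using g' I le by auto
    qed
    subgoal using g by (auto simp: glob_def)
    done
qed

lemma wp_compat:
  assumes "glob R" "R vp = p" "R vq = q" "R vr = r" "p \<le> Z" "q \<le> Z"
  shows "tr compat_com (\<lambda>(R', h'). 0 < R' vbad \<longleftrightarrow> \<not> compat d2 T K \<sigma> r p q) (R, h)"
proof -
  let ?S = "state T K \<sigma> r p" and ?S' = "state T K \<sigma> (Suc r) q"
  define bad where "bad y \<longleftrightarrow> (snd (snd y) \<noteq> r \<and> y \<notin> ?S) \<or> (\<exists>x\<in>?S \<union> ?S'. x \<noteq> y \<and> \<not> apart d2 x y)" for y
  have of_bool_le: "of_bool P \<le> Z" for P using Z(1) by (simp add: of_bool_def)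
  show ?thesis
    unfolding compat_com_def
    apply (simp add: assms)
    apply (rule wp_For[where I = "\<lambda>i R' h'. R' vqq = q div K ^ i \<and>
      (0 < R' vbad \<longleftrightarrow> (\<exists>y\<in>state T K i (Suc r) q. bad y))"])
    subgoal by auto
    subgoal using assms \<rho> by (simp add: glob_def)
    subgoal by simp
    subgoal premises prems for i R' h'
    proof -
      have g: "glob R'" "R' vp = p" "R' vq = q" "R' vr = r"
        using assms prems(3) by (auto simp: glob_def)
      have vqq: "R' vqq = q div K ^ i" "R' vqq \<le> Z"
        using prems(5) le_trans[OF div_le_dividend assms(6)] by auto
      show ?thesis unfolding wp_simps(3)
        apply (rule wp_decode)
        prefer 5
        subgoal premises p1 for R1
        proof -
          have R1: "glob R1" "R1 vp = p" "R1 vq = q" "R1 vr = r" "R1 vqq = q div K ^ Suc i"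
            using g p1(1,2) by (simp_all add: glob_def vqq(1) div_K del: power_Suc)
          obtain a b s where y: "R1 va = a" "R1 vb = b" "R1 vst = s" by blast
          let ?y = "(a, b, s)"
          have S: "state T K (Suc i) (Suc r) q =
            (if a \<le> b \<and> s \<le> r then insert ?y (state T K i (Suc r) q) else state T K i (Suc r) q)"
            using state_Suc'[of a b s q i "Suc r"] p1(3) vqq(1) y by (simp add: less_Suc_eq_le)
          have old: "0 < R1 vbad \<longleftrightarrow> (\<exists>y\<in>state T K i (Suc r) q. bad y)"
            using prems(5) p1(1) by simp
          show ?thesis
          proof (cases "a \<le> b \<and> s \<le> r")
            case False
            then have "\<not> (a < Suc b \<and> s < Suc r)" by auto
            then show ?thesis using old False by (auto simp: y R1(4,5) S simp del: power_Suc)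
          next
            case True
            let ?R = "R1(vfound := of_bool (s = r), vpp := p, vq2 := q)"
            have "tr (compare_com ;; on_expr (not_expr (Var vfound)) (vbad :=: Con 1))
              (\<lambda>(R'', h''). (R''(vj := Suc i)) vqq = q div K ^ Suc i \<and>
                (0 < (R''(vj := Suc i)) vbad \<longleftrightarrow> (\<exists>y\<in>state T K (Suc i) (Suc r) q. bad y))) (?R, h')"
              unfolding wp_simps(3)
              apply (rule wp_conseq[OF wp_compare[of ?R r a b s p q]])
              using R1 y assms(5,6) apply (simp_all add: glob_def)[10]
              subgoal premises p2 for R2 h2
              proof -
                let ?X = "\<exists>x\<in>?S \<union> ?S'. x \<noteq> ?y \<and> \<not> apart d2 x ?y"
                have R2: "R2 vqq = q div K ^ Suc i" "0 < R2 vfound \<longleftrightarrow> s = r \<or> ?y \<in> ?S"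
                  "0 < R2 vbad \<longleftrightarrow> 0 < R1 vbad \<or> ?X"
                  using p2(1) p2(2)[of vqq] R1(5) by (simp_all del: power_Suc)
                have ex: "(\<exists>y\<in>state T K (Suc i) (Suc r) q. bad y) \<longleftrightarrow>
                  \<not> (s = r \<or> ?y \<in> ?S) \<or> 0 < R1 vbad \<or> ?X"
                  unfolding S old using True by (simp add: bad_def[of ?y]) blast
                show ?thesis unfolding ex using Z(1)
                  by (cases "R2 vfound = 0") (use R2 in \<open>simp_all del: power_Suc\<close>)
              qed
              done
            then show ?thesis using True assms(5,6)
              by (simp add: y R1(2,3,4) of_bool_le less_Suc_eq_le del: power_Suc)
          qed
        qed
        using g vqq by (auto simp: glob_def)
    qed
    subgoal using assms by (auto simp: glob_def compat_def not_linked_iff bad_def)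
    done
qed

lemma wp_best:
  assumes g: "glob R" and R: "R vq = q" "R vr = r" "R vc = c" "R vbase = base"
    and q: "q \<le> Z" and N: "N \<le> \<rho> vN" and row: "\<And>p. p < N \<Longrightarrow> h (base + r * N + p) = tb p \<and> tb p \<le> Z"
  shows "tr best_com (\<lambda>(R', h'). R' vbest =
    max_below (\<lambda>p. if compat d2 T K \<sigma> r p q then tb p - c else 0) N) (R, h)"
proof -
  let ?f = "\<lambda>p. if compat d2 T K \<sigma> r p q then tb p - c else 0"
  show ?thesis
    unfolding best_com_def
    apply simp
    apply (rule wp_For[where I = "\<lambda>i R' h'. R' vbest = max_below ?f i"])
    subgoal by simp
    subgoal using g N by (simp add: glob_def)
    subgoal by simp
    subgoal premises prems for p R' h'
    proof -
      have p: "p < N" using prems(1) g by (simp add: glob_def)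
      have g': "glob R'" "R' vq = q" "R' vr = r" "R' vc = c" "R' vbase = base" "R' vN = N" "h' = h"
        using g R prems(3,4) by (simp_all add: glob_def)
      have val: "h (base + r * N + p) = tb p" "tb p - c \<le> Z" using row[OF p] by auto
      show ?thesis unfolding wp_simps(3)
        apply (rule wp_conseq[OF wp_compat[of _ p q r]])
        using g' prems(2) p Z q apply (simp_all)[6]
        subgoal premises p2 for R1 h1
        proof -
          have R1: "R1 vr = r" "R1 vc = c" "R1 vbase = base" "R1 vN = N" "R1 vp = p"
            "R1 vbest = max_below ?f p" "h1 = h" "0 < R1 vbad \<longleftrightarrow> \<not> compat d2 T K \<sigma> r p q"
            using p2 g' prems(2,5) by (simp_all del: power_mult_distrib)
          show ?thesis
            by (cases "compat d2 T K \<sigma> r p q") (use R1 val in \<open>auto simp: max_def not_less\<close>)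
        qed
        done
    qed
    subgoal using g by (simp add: glob_def)
    done
qed

abbreviation budget :: "(nat \<Rightarrow> nat set) \<Rightarrow> nat \<Rightarrow> nat \<Rightarrow> nat \<Rightarrow> nat" where
  "budget tm k \<equiv> table (compat d2 T K \<sigma>) (state_cost d1 T K \<sigma> tm) N k"

text \<open>The rows lie one after another behind the input. Row \<open>r + 1\<close> is written
  above everything that is read, namely the input and row \<open>r\<close>, so it suffices that the
  cells below it are preserved.\<close>

lemma wp_row:
  assumes g: "glob R" and R: "R vr = r" "R vbase = base" "R vrec = A" and r: "r < n" and k: "k + 1 \<le> Z"
    and N: "N \<le> \<rho> vN"
    and input: "h (A + 2) = length ts" "\<And>i. i < length ts \<Longrightarrow> h (A + 3 + i) = ts ! i"
      "A + 3 + length ts \<le> base"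
    and ts: "length ts \<le> \<sigma>" "set ts \<subseteq> {1..T}" "distinct ts" "tm r = set ts"
    and row: "\<And>p. p < N \<Longrightarrow>
      h (base + r * N + p) = budget tm k r p"
  shows "tr row_com (\<lambda>(R', h'). (\<forall>i<base. h' i = h i) \<and> (\<forall>q<N. h' (base + (r + 1) * N + q) =
    budget tm k (Suc r) q)) (R, h)"
proof -
  let ?t = "budget tm k"
  let ?b = "base + (r + 1) * N"
  have tZ: "?t r q \<le> Z" for r q using table_le[of _ _ N k r q] k le_trans by blast
  show ?thesis unfolding row_com_def
    apply (rule wp_For[where I = "\<lambda>i R' h'. (\<forall>j. j < ?b \<longrightarrow> h' j = h j) \<and> (\<forall>j<i. h' (?b + j) = ?t (Suc r) j)"])
    subgoal by simp
    subgoal using g N by (simp add: glob_def)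
    subgoal by simp
    subgoal premises prems for q R' h'
    proof -
      have q: "q < N" using prems(1) g by (simp add: glob_def)
      have qZ: "q \<le> Z" using q Z by simp
      have g': "glob R'" "R' vq = q" "R' vr = r" "R' vrec = A" "R' vbase = base"
        using g R prems(2,3) by (simp_all add: glob_def)
      have h': "h' j = h j" if "j < ?b" for j using prems(5) that by simp
      have lt: "A + 2 < ?b" "\<And>i. i < length ts \<Longrightarrow> A + 3 + i < ?b" using input(3) by auto
      have row': "h' (base + r * N + p) = ?t r p \<and> ?t r p \<le> Z" if "p < N" for p
        using h'[of "base + r * N + p"] row[OF that] tZ that by simp
      show ?thesis unfolding wp_simps(3)
        apply (rule wp_conseq[OF wp_cost[of _ q r A _ ts tm]])
        using g' r h'[OF lt(1)] h'[OF lt(2)] input(1,2) ts qZ apply (simp_all)[12]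
        subgoal premises p1 for R1 h1
        proof -
          have R1: "glob R1" "R1 vq = q" "R1 vr = r" "R1 vbase = base" "R1 vc = state_cost d1 T K \<sigma> tm r q" "h1 = h'"
            using p1 g' by (simp_all add: glob_def)
          show ?thesis
            apply (rule wp_conseq[OF wp_best[OF R1(1,2,3,5,4) qZ N, of _ "?t r"]])
            subgoal using row' R1(6) by simp
            subgoal premises p2 for R2 h2
            proof -
              have R2: "R2 vq = q" "R2 vr = r" "R2 vbase = base" "R2 vN = N" "h2 = h'"
                "R2 vbest = ?t (Suc r) q"
                using p2 R1 by (simp_all add: glob_def)
              have addr: "ev (Var vbase .+ (Var vr .+ Con 1) .* Var vN .+ Var vq) (R2, h2) = ?b + q"
                by (simp add: R2)
              have val: "ev (Var vbest) (R2, h2) = ?t (Suc r) q" by (simp add: R2 del: table.simps)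
              show ?thesis unfolding wp_simps addr val
                using tZ[of "Suc r" q] prems(5) by (simp add: R2 less_Suc_eq del: table.simps)
            qed
            done
        qed
        done
    qed
    subgoal using g by (simp add: glob_def del: table.simps)
    done
qed

end

section \<open>The input\<close>

locale etc_input =
  fixes G :: "nat temporal_graph" and es :: "(nat \<times> nat \<times> nat list) list" and n k d1 d2 :: nat
  assumes temporal: "is_temporal_graph G" and starts: "starts_at_one G"
    and path: "is_path_graph (tg_verts G) (tg_edges G)"
    and verts: "tg_verts G = {0..<n}"
    and distinct_edges: "distinct (map (\<lambda>(u, v, ts). {u, v}) es)"
    and edges: "tg_edges G = set (map (\<lambda>(u, v, ts). {u, v}) es)"
    and times: "\<forall>(u, v, ts)\<in>set es. ts = sorted_list_of_set (tg_times G {u, v})"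
    and d: "0 < d1" "0 < d2"
begin

abbreviation "ne \<equiv> length es"

definition fst_end :: "nat \<Rightarrow> nat" where "fst_end i = fst (es ! i)"
definition snd_end :: "nat \<Rightarrow> nat" where "snd_end i = fst (snd (es ! i))"
definition tlist :: "nat \<Rightarrow> nat list" where "tlist i = snd (snd (es ! i))"
definition edge :: "nat \<Rightarrow> nat set" where "edge i = {fst_end i, snd_end i}"

definition rec :: "nat \<times> nat \<times> nat list \<Rightarrow> nat list" where
  "rec = (\<lambda>(u, v, ts). u # v # length ts # ts)"

definition input :: "nat list" where
  "input = [n, k, d1, d2, ne] @ concat (map rec es)"

text \<open>The address of the \<open>i\<close>-th record, behind a header of 5 words;
  \<open>off ne\<close> is the first cell behind the input, where the table begins.\<close>

definition off :: "nat \<Rightarrow> nat" where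
  "off i = 5 + length (concat (map rec (take i es)))"

lemma off_0 [simp]: "off 0 = 5"
  by (simp add: off_def)

lemma off_Suc: "i < ne \<Longrightarrow> off (Suc i) = off i + 3 + length (tlist i)"
  by (simp add: off_def take_Suc_conv_app_nth rec_def tlist_def case_prod_beta)

lemma off_ne: "off ne = length input"
  by (simp add: off_def input_def)

lemma off_mono: "i \<le> j \<Longrightarrow> j \<le> ne \<Longrightarrow> off i \<le> off j"
  by (induction j rule: nat_induct_at_least) (auto simp: off_Suc)

lemma input_record:
  assumes "i < ne"
  shows "input ! off i = fst_end i" "input ! (off i + 1) = snd_end i"
    "input ! (off i + 2) = length (tlist i)"
    "\<And>j. j < length (tlist i) \<Longrightarrow> input ! (off i + 3 + j) = tlist i ! j"
proof -
  let ?pre = "[n, k, d1, d2, ne] @ concat (map rec (take i es))"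
  have "es = take i es @ es ! i # drop (Suc i) es" using assms by (rule id_take_nth_drop)
  then have "concat (map rec es) = concat (map rec (take i es)) @ rec (es ! i) @ concat (map rec (drop (Suc i) es))"
    by (metis concat.simps(2) concat_append list.simps(9) map_append)
  then have "input = ?pre @ (fst_end i # snd_end i # length (tlist i) # tlist i) @ concat (map rec (drop (Suc i) es))"
    by (simp add: input_def rec_def case_prod_beta fst_end_def snd_end_def tlist_def)
  moreover have "length ?pre = off i" by (simp add: off_def)
  ultimately have nth: "input ! (off i + j) =
      ((fst_end i # snd_end i # length (tlist i) # tlist i) @ concat (map rec (drop (Suc i) es))) ! j" for j
    by (metis nth_append_length_plus)
  show "input ! off i = fst_end i" using nth[of 0] by simp
  show "input ! (off i + 1) = snd_end i" using nth[of 1] by simp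
  show "input ! (off i + 2) = length (tlist i)" using nth[of 2] by simp
  show "input ! (off i + 3 + j) = tlist i ! j" if "j < length (tlist i)" for j
    using nth[of "3 + j"] that by (simp add: nth_append numeral_3_eq_3 add.assoc)
qed

lemma off_bound: "i < ne \<Longrightarrow> off i + 3 + length (tlist i) \<le> length input"
  using off_mono[of "Suc i" ne] off_Suc[of i] off_ne by simp

lemma input_header: "input ! 0 = n" "input ! 1 = k" "input ! 2 = d1" "input ! 3 = d2" "input ! 4 = ne"
  "5 \<le> length input"
  by (simp_all add: input_def numeral_eq_Suc)

lemma edge_in: "i < ne \<Longrightarrow> edge i \<in> tg_edges G"
  unfolding edges edge_def fst_end_def snd_end_def set_map
  by (rule image_eqI[of _ _ "es ! i"]) (auto simp: case_prod_beta)

lemma edge_map: "map (\<lambda>(u, v, ts). {u, v}) es = map edge [0..<ne]"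
  by (intro nth_equalityI) (auto simp: edge_def fst_end_def snd_end_def case_prod_beta)

lemma edges_eq: "tg_edges G = edge ` {..<ne}"
  unfolding edges edge_map by auto

lemma edge_inj: "i < ne \<Longrightarrow> j < ne \<Longrightarrow> edge i = edge j \<Longrightarrow> i = j"
  using distinct_edges unfolding edge_map distinct_map by (auto dest: inj_onD)

lemma tlist_props:
  assumes "i < ne"
  shows "set (tlist i) = tg_times G (edge i)" "distinct (tlist i)" "sorted (tlist i)" "tlist i \<noteq> []"
proof -
  have "tlist i = sorted_list_of_set (tg_times G (edge i))"
    using bspec[OF times nth_mem[OF assms]] by (simp add: tlist_def edge_def fst_end_def snd_end_def case_prod_beta)
  moreover have "finite (tg_times G (edge i))" "tg_times G (edge i) \<noteq> {}"
    using temporal edge_in[OF assms] by (auto simp: is_temporal_graph_def)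
  ultimately show "set (tlist i) = tg_times G (edge i)" "distinct (tlist i)" "sorted (tlist i)" "tlist i \<noteq> []"
    by auto
qed

lemma path_graph_locale:
  assumes "distinct vs" "set vs = tg_verts G" "tg_edges G = {{vs ! i, vs ! Suc i} | i. Suc i < length vs}"
  shows "path_graph G vs"
  using assms temporal by unfold_locales

text \<open>An edge exists because some time-edge has time 1; this excludes paths with fewer than
  two vertices.\<close>

lemma obtain_path:
  obtains vs where "path_graph G vs" "length vs = n" "ne = n - 1" "1 < n"
proof -
  obtain vs where vs: "distinct vs" "set vs = tg_verts G"
    "tg_edges G = {{vs ! i, vs ! Suc i} | i. Suc i < length vs}"
    using path unfolding is_path_graph_def by blast
  have len: "length vs = n" using distinct_card[OF vs(1)] vs(2) verts by simp
  interpret path_graph G vs using path_graph_locale[OF vs] .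
  have E: "tg_edges G = (\<lambda>i. vpair i i) ` {..<length vs - 1}" by (auto simp: vs(3) vpair_def)
  have "card (tg_edges G) = length vs - 1" unfolding E by (subst card_image) (auto intro!: inj_onI simp: vpair_eq_iff)
  moreover have "card (tg_edges G) = ne" unfolding edges_eq by (subst card_image) (auto intro!: inj_onI dest: edge_inj)
  ultimately have "ne = n - 1" using len by simp
  moreover have "tg_edges G \<noteq> {}" using starts by (auto simp: starts_at_one_def time_edges_def)
  then have "1 < n" unfolding E using len by auto
  ultimately show ?thesis using that path_graph_axioms len by blast
qed

lemma ne_eq: "ne = n - 1" and n_gt: "1 < n"
  using obtain_path by metis+

section \<open>Locating an end of the path by vertex degrees\<close>

definition degree :: "nat \<Rightarrow> nat" where
  "degree v = card {i. i < ne \<and> v \<in> edge i}"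

lemma path_degree:
  assumes "path_graph G vs" "length vs = n"
  shows "degree (vs ! 0) = 1" "j < n \<Longrightarrow> degree (vs ! j) = 1 \<Longrightarrow> j = 0 \<or> j = n - 1"
proof -
  interpret path_graph G vs by (rule assms)
  have deg: "degree v = card {e \<in> tg_edges G. v \<in> e}" for v
    unfolding degree_def by (rule bij_betw_same_card[of edge])
      (auto simp: bij_betw_def inj_on_def edges_eq dest: edge_inj)
  have E: "tg_edges G = {{vs ! i, vs ! Suc i} | i. Suc i < n}" using edges assms(2) by simp
  have inj: "i < n \<Longrightarrow> j < n \<Longrightarrow> vs ! i = vs ! j \<longleftrightarrow> i = j" for i j
    using distinct assms(2) by (simp add: nth_eq_iff_index_eq)
  have "{e \<in> tg_edges G. vs ! 0 \<in> e} = {{vs ! 0, vs ! 1}}"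
    unfolding E using n_gt inj by auto
  then show "degree (vs ! 0) = 1" by (simp add: deg)
  show "j = 0 \<or> j = n - 1" if j: "j < n" "degree (vs ! j) = 1"
  proof (rule ccontr)
    assume "\<not> (j = 0 \<or> j = n - 1)"
    then obtain i where i: "j = Suc i" "Suc j < n" using j by (cases j) auto
    have "{{vs ! i, vs ! j}, {vs ! j, vs ! Suc j}} \<subseteq> {e \<in> tg_edges G. vs ! j \<in> e}"
      unfolding E using i by auto
    moreover have "finite {e \<in> tg_edges G. vs ! j \<in> e}" by (simp add: edges_eq)
    moreover have "{vs ! i, vs ! j} \<noteq> {vs ! j, vs ! Suc j}" using i inj by (auto simp: doubleton_eq_iff)
    ultimately have "2 \<le> degree (vs ! j)" unfolding deg
      by (metis card_2_iff card_mono)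
    then show False using j by simp
  qed
qed

text \<open>Allows either end of the path, whichever the program finds, to be taken as the first
  vertex.\<close>

lemma path_rev:
  assumes "path_graph G vs"
  shows "path_graph G (rev vs)"
proof (rule path_graph_locale)
  interpret path_graph G vs by (rule assms)
  show "distinct (rev vs)" "set (rev vs) = tg_verts G" using distinct verts by auto
  let ?n = "length vs"
  have r: "{rev vs ! i, rev vs ! Suc i} = {vs ! (?n - 2 - i), vs ! Suc (?n - 2 - i)}" if "Suc i < ?n" for i
  proof -
    have eq: "?n - Suc i = Suc (?n - 2 - i)" "?n - Suc (Suc i) = ?n - 2 - i" using that by auto
    have "rev vs ! i = vs ! Suc (?n - 2 - i)" "rev vs ! Suc i = vs ! (?n - 2 - i)"
      using rev_nth[of i vs] rev_nth[of "Suc i" vs] that unfolding eq by auto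
    then show ?thesis by (simp only: insert_commute)
  qed
  show "tg_edges G = {{rev vs ! i, rev vs ! Suc i} | i. Suc i < length (rev vs)}"
    unfolding edges
  proof (intro equalityI subsetI)
    fix e assume "e \<in> {{vs ! i, vs ! Suc i} | i. Suc i < ?n}"
    then obtain i where i: "e = {vs ! i, vs ! Suc i}" "Suc i < ?n" by blast
    have "Suc (?n - 2 - i) < ?n" "?n - 2 - (?n - 2 - i) = i" using i by auto
    then have "e = {rev vs ! (?n - 2 - i), rev vs ! Suc (?n - 2 - i)}" "Suc (?n - 2 - i) < length (rev vs)"
      using r[of "?n - 2 - i"] i(1) by simp_all
    then show "e \<in> {{rev vs ! i, rev vs ! Suc i} | i. Suc i < length (rev vs)}" by blast
  next
    fix e assume "e \<in> {{rev vs ! i, rev vs ! Suc i} | i. Suc i < length (rev vs)}"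
    then obtain i where i: "e = {rev vs ! i, rev vs ! Suc i}" "Suc i < ?n" by auto
    have "Suc (?n - 2 - i) < ?n" using i by simp
    then show "e \<in> {{vs ! i, vs ! Suc i} | i. Suc i < ?n}" using r[OF i(2)] i by blast
  qed
qed

lemma obtain_path_from:
  assumes "degree x = 1" "x < n"
  obtains vs where "path_graph G vs" "length vs = n" "vs ! 0 = x"
proof -
  obtain vs where vs: "path_graph G vs" "length vs = n" using obtain_path by blast
  then have "set vs = {0..<n}" using verts path_graph.verts by metis
  then obtain j where j: "j < n" "vs ! j = x" using assms vs(2) by (metis atLeastLessThan_iff in_set_conv_nth zero_le)
  then consider "j = 0" | "j = n - 1" using path_degree(2)[OF vs j(1)] assms by auto
  then show ?thesis
  proof cases
    case 1
    then show ?thesis using that vs j by blast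
  next
    case 2
    then have "rev vs ! 0 = x" using j vs(2) n_gt by (simp add: rev_nth)
    then show ?thesis using that[of "rev vs"] path_rev vs by simp
  qed
qed

lemma ex_degree_one: "\<exists>v<n. degree v = 1"
proof -
  obtain vs where vs: "path_graph G vs" "length vs = n" using obtain_path by blast
  then have "set vs = {0..<n}" using verts path_graph.verts by metis
  then have "vs ! 0 < n" using n_gt vs(2) nth_mem[of 0 vs] by auto
  then show ?thesis using path_degree(1)[OF vs] by blast
qed

section \<open>Parameters computed from the input\<close>

lemma sorted_le_last: "sorted xs \<Longrightarrow> t \<in> set xs \<Longrightarrow> t \<le> last (xs :: nat list)"
  by (induction xs) (auto split: if_splits)

definition sig :: nat where "sig = max_below (\<lambda>i. length (tlist i)) ne"

lemma max_below_ge: "i < j \<Longrightarrow> f i \<le> max_below f j"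
  by (induction j) (auto simp: less_Suc_eq)

lemma length_tlist_le: "i < ne \<Longrightarrow> length (tlist i) \<le> sig"
  unfolding sig_def by (rule max_below_ge)

lemma sig_le:
  assumes "\<And>e. e \<in> tg_edges G \<Longrightarrow> card (tg_times G e) \<le> \<sigma>"
  shows "sig \<le> \<sigma>"
proof -
  have "length (tlist i) \<le> \<sigma>" if "i < ne" for i
    using assms[OF edge_in[OF that]] tlist_props(1,2)[OF that] distinct_card by metis
  then show ?thesis unfolding sig_def not_less[symmetric] less_max_below_iff by auto
qed

text \<open>The times of an edge are listed in increasing order, so only the last entries have to be
  compared.\<close>

lemma lifetime_eq: "max_below (\<lambda>i. last (tlist i)) ne = lifetime G"
proof -
  have te: "time_edges G \<noteq> {}" using starts by (auto simp: starts_at_one_def)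
  have "finite (time_edges G)"
  proof -
    have "time_edges G = (SIGMA e:tg_edges G. tg_times G e)" by (auto simp: time_edges_def)
    then show ?thesis using temporal by (auto simp: is_temporal_graph_def edges_eq)
  qed
  then have fin: "finite (snd ` time_edges G)" by simp
  have in_te: "t \<in> snd ` time_edges G \<longleftrightarrow> (\<exists>i<ne. t \<in> set (tlist i))" for t
  proof -
    have "t \<in> snd ` time_edges G \<longleftrightarrow> (\<exists>e\<in>tg_edges G. t \<in> tg_times G e)"
      by (auto simp: time_edges_def image_iff)
    also have "\<dots> \<longleftrightarrow> (\<exists>i<ne. t \<in> set (tlist i))" unfolding edges_eq using tlist_props(1) by auto
    finally show ?thesis .
  qed
  have L: "lifetime G = Max (snd ` time_edges G)" using te by (simp add: lifetime_def)
  show ?thesis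
  proof (rule antisym)
    have "last (tlist i) \<le> lifetime G" if "i < ne" for i
      unfolding L using fin in_te that tlist_props(4)[OF that] by (intro Max_ge) auto
    then show "max_below (\<lambda>i. last (tlist i)) ne \<le> lifetime G"
      unfolding not_less[symmetric] less_max_below_iff by auto
    have "lifetime G \<in> snd ` time_edges G" unfolding L using fin te by (intro Max_in) auto
    then obtain i where i: "i < ne" "lifetime G \<in> set (tlist i)" using in_te by blast
    then have "lifetime G \<le> last (tlist i)" using sorted_le_last tlist_props(3)[OF i(1)] by blast
    also have "\<dots> \<le> max_below (\<lambda>i. last (tlist i)) ne" using i(1) by (rule max_below_ge[where f = "\<lambda>i. last (tlist i)"])
    finally show "lifetime G \<le> max_below (\<lambda>i. last (tlist i)) ne" .
  qed
qed

lemma tlist_bounds: "i < ne \<Longrightarrow> set (tlist i) \<subseteq> {1..lifetime G}"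
proof -
  assume i: "i < ne"
  have "1 \<le> t" if "t \<in> set (tlist i)" for t
    using temporal edge_in[OF i] tlist_props(1)[OF i] that by (auto simp: is_temporal_graph_def)
  moreover have "t \<le> lifetime G" if "t \<in> set (tlist i)" for t
  proof -
    have "t \<le> last (tlist i)" using that sorted_le_last tlist_props(3)[OF i] by blast
    also have "\<dots> \<le> lifetime G" unfolding lifetime_eq[symmetric]
      using i by (rule max_below_ge[where f = "\<lambda>i. last (tlist i)"])
    finally show ?thesis .
  qed
  ultimately show ?thesis by auto
qed

lemma ne_pos: "0 < ne" using ne_eq n_gt by simp

lemma sig_pos: "0 < sig"
  using length_tlist_le[OF ne_pos] tlist_props(4)[OF ne_pos] by (cases "tlist 0") auto

lemma sig_le_lifetime: "sig \<le> lifetime G"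
proof -
  have "length (tlist i) \<le> lifetime G" if "i < ne" for i
    using card_mono[OF _ tlist_bounds[OF that]] distinct_card[OF tlist_props(2)[OF that]] by simp
  then show ?thesis unfolding sig_def not_less[symmetric] less_max_below_iff by auto
qed

end

section \<open>Reading the input, following the path, and the whole program\<close>

definition header_com :: com where
  "header_com = vn :=: Rd (Con 0) ;; vk :=: Rd (Con 1) ;; vd1 :=: Rd (Con 2) ;; vd2 :=: Rd (Con 3) ;;
     vm :=: Rd (Con 4) ;; vptr :=: Con 5 ;; vsig :=: Con 0 ;; vT :=: Con 0 ;;
     For vi vm (vlen :=: Rd (Var vptr .+ Con 2) ;; on_expr (Var vsig .< Var vlen) (vsig :=: Var vlen) ;;
       vt :=: Rd (Var vptr .+ Con 2 .+ Var vlen) ;; on_expr (Var vT .< Var vt) (vT :=: Var vt) ;;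
       vptr :=: Var vptr .+ Con 3 .+ Var vlen) ;;
     vbase :=: Var vptr"

text \<open>The vertices are the numbers below \<open>vn\<close>, so \<open>vn\<close> itself can
  play the predecessor of the first vertex.\<close>

definition endpoint_com :: com where
  "endpoint_com = For vv vn (vptr :=: Con 5 ;; vdeg :=: Con 0 ;;
     For vi vm
       (on_expr ((Rd (Var vptr) .= Var vv) .| (Rd (Var vptr .+ Con 1) .= Var vv)) (vdeg :=: Var vdeg .+ Con 1) ;;
        vptr :=: Var vptr .+ Con 3 .+ Rd (Var vptr .+ Con 2)) ;;
     on_expr (Var vdeg .= Con 1) (vx :=: Var vv)) ;;
     vprev :=: Var vn"

text \<open>A single store creates row 0 of the table: its other cells still have their initial
  value 0.\<close>

definition setup_com :: com where
  "setup_com = vK :=: Var vn .* Var vT .* Var vT ;; vN :=: Con 1 ;; For vi vsig (vN :=: Var vN .* Var vK) ;;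
     Sto (Var vbase) (Var vk .+ Con 1)"

text \<open>Records come in any order and orientation, hence a full scan for every path edge. The
  n^2 rounds in total are dominated by the work on the table.\<close>

definition find_com :: com where
  "find_com = vptr :=: Con 5 ;; For vi vm (
     on_expr ((Rd (Var vptr) .= Var vx) .& not_expr (Rd (Var vptr .+ Con 1) .= Var vprev))
       (vrec :=: Var vptr ;; vy :=: Rd (Var vptr .+ Con 1)) ;;
     on_expr ((Rd (Var vptr .+ Con 1) .= Var vx) .& not_expr (Rd (Var vptr) .= Var vprev))
       (vrec :=: Var vptr ;; vy :=: Rd (Var vptr)) ;;
     vptr :=: Var vptr .+ Con 3 .+ Rd (Var vptr .+ Con 2))"

definition rows_com :: com where
  "rows_com = For vr vm (find_com ;; row_com ;; vprev :=: Var vx ;; vx :=: Var vy)"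

definition answer_com :: com where
  "answer_com = vans :=: Con 0 ;;
     For vq vN (on_expr (Rd (Var vbase .+ Var vm .* Var vN .+ Var vq)) (vans :=: Con 1))"

definition etc_com :: com where
  "etc_com = header_com ;; endpoint_com ;; setup_com ;; rows_com ;; answer_com"

lemma writes_find [simp]: "writes find_com = {vptr, vi, vrec, vy}"
  by (auto simp: find_com_def)

lemma pure_find [simp]: "pure find_com"
  by (simp add: find_com_def)

locale etc_run =
  etc_input G es n k d1 d2 +
  instance_bounds Z \<rho> n d1 d2 "length es" "etc_input.sig es" "lifetime G"
  for G es n k d1 d2 Z \<rho> +
  assumes \<rho>': "ne \<le> \<rho> vm" "n \<le> \<rho> vn" "N \<le> \<rho> vN"
    and Z': "length input \<le> Z" "k + 1 \<le> Z" "\<forall>x\<in>set input. x \<le> Z"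
begin

abbreviation "T \<equiv> lifetime G"

definition input_at :: "(nat \<Rightarrow> nat) \<Rightarrow> bool" where
  "input_at h \<longleftrightarrow> (\<forall>i<length input. h i = input ! i)"

lemma input_at_le: "input_at h \<Longrightarrow> i < length input \<Longrightarrow> h i \<le> Z"
  using Z'(3) by (simp add: input_at_def)

lemma input_at_record:
  assumes "input_at h" "i < ne"
  shows "h (off i) = fst_end i" "h (Suc (off i)) = snd_end i" "h (off i + 2) = length (tlist i)"
    "h (off i + 2 + length (tlist i)) = last (tlist i)"
    "fst_end i \<le> Z" "snd_end i \<le> Z" "length (tlist i) \<le> Z" "last (tlist i) \<le> Z"
    "off i + 3 + length (tlist i) \<le> Z" "off i \<le> Z"
proof -
  note b = off_bound[OF assms(2)]
  note r = input_record[OF assms(2)]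
  have ne: "0 < length (tlist i)" using tlist_props(4)[OF assms(2)] by simp
  then have eq: "off i + 2 + length (tlist i) = off i + 3 + (length (tlist i) - 1)" by simp
  show 1: "h (off i) = fst_end i" using assms(1) b r(1) by (simp add: input_at_def)
  show 2: "h (Suc (off i)) = snd_end i" using assms(1) b r(2) by (simp add: input_at_def)
  show 3: "h (off i + 2) = length (tlist i)" using assms(1) b r(3) by (simp add: input_at_def)
  show 4: "h (off i + 2 + length (tlist i)) = last (tlist i)"
  proof -
    have "off i + 3 + (length (tlist i) - 1) < length input" using b ne by linarith
    then have "h (off i + 3 + (length (tlist i) - 1)) = input ! (off i + 3 + (length (tlist i) - 1))"
      using assms(1) unfolding input_at_def by blast
    also have "\<dots> = tlist i ! (length (tlist i) - 1)" using ne by (intro r(4)) simp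
    also have "\<dots> = last (tlist i)" using ne by (simp add: last_conv_nth)
    finally show ?thesis unfolding eq .
  qed
  show "fst_end i \<le> Z" using input_at_le[OF assms(1), of "off i"] 1 b by simp
  show "snd_end i \<le> Z" using input_at_le[OF assms(1), of "Suc (off i)"] 2 b by simp
  show "length (tlist i) \<le> Z" using input_at_le[OF assms(1), of "off i + 2"] 3 b by simp
  show "last (tlist i) \<le> Z" using input_at_le[OF assms(1), of "off i + 2 + length (tlist i)"] 4 b ne by simp
  show "off i + 3 + length (tlist i) \<le> Z" "off i \<le> Z" using b Z'(1) by auto
qed

lemma wp_header:
  assumes h: "input_at h"
  shows "tr header_com (\<lambda>(R', h'). R' vn = n \<and> R' vk = k \<and> R' vd1 = d1 \<and> R' vd2 = d2 \<and> R' vm = ne \<and>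
    R' vsig = sig \<and> R' vT = T \<and> R' vbase = length input \<and> h' = h) (R, h)"
proof -
  have ne: "input \<noteq> []" using input_header(6) by auto
  have hd: "h 0 = n" "h (Suc 0) = k" "h 2 = d1" "h 3 = d2" "h 4 = ne"
    using h input_header ne by (simp_all add: input_at_def)
  have le: "n \<le> Z" "k \<le> Z" "d1 \<le> Z" "d2 \<le> Z" "ne \<le> Z"
    using hd input_at_le[OF h, of 0] input_at_le[OF h, of "Suc 0"] input_at_le[OF h, of 2]
      input_at_le[OF h, of 3] input_at_le[OF h, of 4] input_header(6) ne by simp_all
  show ?thesis unfolding header_com_def
    apply (simp add: hd le Z(1))
    apply (rule wp_For[where I = "\<lambda>i R' h'. R' vptr = off i \<and>
      R' vsig = max_below (\<lambda>i. length (tlist i)) i \<and> R' vT = max_below (\<lambda>i. last (tlist i)) i"])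
    subgoal by simp
    subgoal using \<rho>' by simp
    subgoal by simp
    subgoal premises prems for i R' h'
    proof -
      have i: "i < ne" using prems(1) by simp
      have h': "h' = h" using prems(4) by simp
      note r = input_at_record[OF h i]
      show ?thesis using prems(5) r by (auto simp: h' off_Suc[OF i] max_def not_less)
    qed
    subgoal using Z'(1) by (simp add: off_ne sig_def lifetime_eq)
    done
qed

lemma wp_endpoint:
  assumes h: "input_at h" and R: "R vn = n" "R vm = ne"
  shows "tr endpoint_com (\<lambda>(R', h'). R' vx < n \<and> degree (R' vx) = 1 \<and> R' vprev = n) (R, h)"
proof -
  have le: "n \<le> Z" "ne \<le> Z" "5 \<le> Z" using Z ne_eq by auto
  define cnt where "cnt i v = card {j. j < i \<and> v \<in> edge j}" for i v
  have cnt_le: "cnt i v \<le> i" for i v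
    unfolding cnt_def using card_mono[of "{..<i}" "{j. j < i \<and> v \<in> edge j}"] by auto
  have cnt_0: "cnt 0 v = 0" for v by (simp add: cnt_def)
  have cnt_Suc: "cnt (Suc i) v = (if fst_end i = v \<or> snd_end i = v then Suc (cnt i v) else cnt i v)" for i v
  proof (cases "v \<in> edge i")
    case True
    then have "{j. j < Suc i \<and> v \<in> edge j} = insert i {j. j < i \<and> v \<in> edge j}"
      by (auto simp: less_Suc_eq)
    then show ?thesis using True by (auto simp: cnt_def edge_def)
  next
    case False
    then have "{j. j < Suc i \<and> v \<in> edge j} = {j. j < i \<and> v \<in> edge j}" by (auto simp: less_Suc_eq)
    then show ?thesis using False by (auto simp: cnt_def edge_def)
  qed
  show ?thesis unfolding endpoint_com_def wp_simps(3)
    \<comment> \<open>A later end overwrites an earlier one; it only matters that an end is stored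
      as soon as one has been met.\<close>
    apply (rule wp_For[where I = "\<lambda>v R' h'. (\<exists>v'<v. degree v' = 1) \<longrightarrow> R' vx < v \<and> degree (R' vx) = 1"])
    subgoal by simp
    subgoal using R \<rho>' by simp
    subgoal by simp
    subgoal premises prems for v R' h'
    proof -
      have v: "v < n" "R' vv = v" "R' vm = ne" "h' = h" using prems(1-4) R by simp_all
      show ?thesis
        using le
        apply simp
        apply (rule wp_For[where I = "\<lambda>i R'' h''. R'' vptr = off i \<and> R'' vdeg = cnt i v"])
        subgoal by simp
        subgoal using v \<rho>' by simp
        subgoal by (simp add: cnt_0)
        subgoal premises pr for i R1 h1
        proof -
          have i: "i < ne" using pr v by simp
          have R1: "R1 vv = v" "h1 = h" "R1 vptr = off i" "R1 vdeg = cnt i v"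
            using pr v by simp_all
          note r = input_at_record[OF h i]
          have "Suc (cnt i v) \<le> Z" using cnt_le[of i v] i le by simp
          then show ?thesis using r by (auto simp: R1 off_Suc[OF i] cnt_Suc)
        qed
        subgoal premises pr for R1 h1
        proof -
          have R1: "R1 vv = v" "R1 vdeg = degree v" "R1 vx = R' vx" using pr v by (simp_all add: degree_def cnt_def)
          show ?thesis using prems(5) v le by (auto simp: R1 less_Suc_eq)
        qed
        done
    qed
    subgoal using R le ex_degree_one by auto
    done
qed

lemma wp_setup:
  assumes R: "R vn = n" "R vT = T" "R vsig = sig" "R vk = k" "R vbase = base"
  shows "tr setup_com (\<lambda>(R', h'). R' vK = K \<and> R' vN = N \<and> h' = h(base := k + 1)) (R, h)"
proof -
  have K: "0 < K" using pos by simp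
  have Ki: "K ^ i \<le> Z" if "i \<le> sig" for i
    using power_increasing[OF that, of K] K Z(4) by linarith
  have KZ: "K \<le> Z" using Ki[of 1] sig_pos by simp
  show ?thesis unfolding setup_com_def
    using KZ Z(1)
    apply (simp add: R)
    apply (rule wp_For[where I = "\<lambda>i R' h'. R' vN = K ^ i"])
    subgoal by simp
    subgoal using R \<rho> by simp
    subgoal by simp
    subgoal premises prems for i R' h'
      using prems R Ki[of "Suc i"] by (simp add: mult.commute)
    subgoal using R Z' by simp
    done
qed

lemma wp_find:
  assumes h: "input_at h" and vs: "path_graph G vs" "length vs = n" and r: "r < ne"
    and R: "R vm = ne" "R vx = vs ! r" "R vprev = (if r = 0 then n else vs ! (r - 1))"
    and l: "l < ne" "edge l = {vs ! r, vs ! Suc r}"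
  shows "tr find_com (\<lambda>(R', h'). R' vrec = off l \<and> R' vy = vs ! Suc r) (R, h)"
proof -
  note V = verts
  interpret path_graph G vs by (rule vs)
  have inj: "i < n \<Longrightarrow> j < n \<Longrightarrow> vs ! i = vs ! j \<longleftrightarrow> i = j" for i j
    using distinct vs(2) by (simp add: nth_eq_iff_index_eq)
  have lt: "vs ! i < n" if "i < n" for i
    using that vs(2) nth_mem[of i vs] verts V by auto
  have n: "ne < n" using ne_eq n_gt by simp
  have prev: "vs ! Suc r \<noteq> (if r = 0 then n else vs ! (r - 1))" "vs ! r \<noteq> (if r = 0 then n else vs ! (r - 1))"
    using r n inj[of "Suc r" "r - 1"] inj[of r "r - 1"] lt[of "Suc r"] lt[of r] by auto
  \<comment> \<open>The only other path edge at the \<open>r\<close>-th vertex leads back to its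
    predecessor; for \<open>r = 0\<close> there is none.\<close>
  have other: "y = (if r = 0 then n else vs ! (r - 1))" if "i < ne" "i \<noteq> l" "edge i = {vs ! r, y}" for i y
  proof -
    have "edge i \<in> tg_edges G" using edge_in that by blast
    then obtain j where j: "edge i = {vs ! j, vs ! Suc j}" "Suc j < n" using edges vs(2) by auto
    have "edge i \<noteq> edge l" using edge_inj that l by blast
    then have "j \<noteq> r" using j l by auto
    moreover have "vs ! r = vs ! j \<or> vs ! r = vs ! Suc j" using j that by (auto simp: doubleton_eq_iff)
    then have "r = j \<or> r = Suc j" using inj j r n by auto
    ultimately have "r = Suc j" by simp
    then show ?thesis using j that inj[of j "Suc j"] by (auto simp: doubleton_eq_iff)
  qed
  show ?thesis unfolding find_com_def
    using Z(1)
    apply simp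
    apply (rule wp_For[where I = "\<lambda>i R' h'. R' vptr = off i \<and> (l < i \<longrightarrow> R' vrec = off l \<and> R' vy = vs ! Suc r)"])
    subgoal by simp
    subgoal using R \<rho>' by simp
    subgoal by simp
    subgoal premises prems for i R' h'
    proof -
      have i: "i < ne" using prems R by simp
      have R': "R' vx = vs ! r" "R' vprev = (if r = 0 then n else vs ! (r - 1))" "h' = h" "R' vptr = off i"
        "l < i \<Longrightarrow> R' vrec = off l" "l < i \<Longrightarrow> R' vy = vs ! Suc r"
        using prems R by simp_all
      note rec = input_at_record[OF h i]
      show ?thesis
      proof (cases "i = l")
        case True
        then consider "fst_end i = vs ! r" "snd_end i = vs ! Suc r" | "fst_end i = vs ! Suc r" "snd_end i = vs ! r"
          using l(2) by (auto simp: edge_def doubleton_eq_iff)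
        then show ?thesis
        proof cases
          case 1
          have "vs ! Suc r \<noteq> vs ! r" using inj[of r "Suc r"] r n by simp
          then show ?thesis using 1 rec True prev(1) by (simp add: R' off_Suc[OF l(1)])
        next
          case 2
          have "vs ! Suc r \<noteq> vs ! r" using inj[of r "Suc r"] r n by simp
          then show ?thesis using 2 rec True prev(1) by (simp add: R' off_Suc[OF l(1)])
        qed
      next
        case False
        have 1: "snd_end i = (if r = 0 then n else vs ! (r - 1))" if "fst_end i = vs ! r"
          using other[OF i False, of "snd_end i"] that by (simp add: edge_def)
        have 2: "fst_end i = (if r = 0 then n else vs ! (r - 1))" if "snd_end i = vs ! r"
          using other[OF i False, of "fst_end i"] that by (auto simp: edge_def insert_commute)
        have skip: "\<not> (fst_end i = vs ! r \<and> snd_end i \<noteq> R' vprev)" "\<not> (snd_end i = vs ! r \<and> fst_end i \<noteq> R' vprev)"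
          using 1 2 R'(2) by auto
        have "l < Suc i \<longleftrightarrow> l < i" using False by auto
        then show ?thesis using skip rec R'(5,6) by (auto simp: R'(1,3,4) off_Suc[OF i])
      qed
    qed
    subgoal using R l by simp
    done
qed

definition times_of :: "nat list \<Rightarrow> nat \<Rightarrow> nat set" where
  "times_of vs r = tg_times G {vs ! r, vs ! Suc r}"

lemma wp_rows:
  assumes g: "glob R" and R: "R vbase = length input" "R vx = vs ! 0" "R vprev = n"
    and vs: "path_graph G vs" "length vs = n"
    and h: "input_at h" and row0: "\<And>p. p < N \<Longrightarrow> h (length input + p) = (if p = 0 then k + 1 else 0)"
  shows "tr rows_com (\<lambda>(R', h'). \<forall>p<N. h' (length input + ne * N + p) =
    budget (times_of vs) k ne p) (R, h)"
proof -
  interpret path_graph G vs by (rule vs)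
  let ?t = "budget (times_of vs) k"
  have ne_n: "ne < n" using ne_eq n_gt by simp
  have in_vs: "vs ! i \<le> Z" if "i < n" for i
  proof -
    have "vs ! i < n" using that vs(2) nth_mem[of i vs] verts etc_input.verts[OF etc_input_axioms] by auto
    then show ?thesis using Z(6) by simp
  qed
  show ?thesis unfolding rows_com_def
    apply (rule wp_For[where I = "\<lambda>r R' h'. R' vx = vs ! r \<and> R' vprev = (if r = 0 then n else vs ! (r - 1)) \<and>
      input_at h' \<and> (\<forall>p<N. h' (length input + r * N + p) = ?t r p)"])
    subgoal by simp
    subgoal using g \<rho>' by (simp add: glob_def)
    subgoal using R h row0 by simp
    subgoal premises prems for r R' h'
    proof -
      have r: "r < ne" using prems(1) g by (simp add: glob_def)
      have g': "glob R'" "R' vr = r" "R' vbase = length input" using g R prems(2,3) by (simp_all add: glob_def)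
      have R': "R' vx = vs ! r" "R' vprev = (if r = 0 then n else vs ! (r - 1))" "input_at h'"
        "\<And>p. p < N \<Longrightarrow> h' (length input + r * N + p) = ?t r p"
        using prems(5) by auto
      have "{vs ! r, vs ! Suc r} \<in> tg_edges G" using edges r ne_n vs(2) by auto
      then obtain l where l: "l < ne" "edge l = {vs ! r, vs ! Suc r}" using edges_eq by force
      show ?thesis unfolding wp_simps(3)
        apply (rule wp_conseq[OF wp_find[OF R'(3) vs r _ R'(1,2) l]])
        subgoal using g' by (simp add: glob_def)
        subgoal premises p1 for R1 h1
        proof -
          have R1: "glob R1" "R1 vr = r" "R1 vbase = length input" "R1 vrec = off l" "R1 vy = vs ! Suc r"
            "R1 vx = vs ! r" "h1 = h'"
            using p1 g' R'(1) by (simp_all add: glob_def)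
          have ts: "times_of vs r = set (tlist l)" using tlist_props(1)[OF l(1)] l(2) by (simp add: times_of_def)
          show ?thesis
            apply (rule wp_conseq[OF wp_row[OF R1(1,2,3,4) _ Z'(2) \<rho>'(3), of _ "tlist l" "times_of vs"]])
            subgoal using r ne_n by simp
            subgoal using input_at_record(3)[OF R'(3) l(1)] R1(7) by simp
            subgoal for i
              using R'(3) R1(7) off_bound[OF l(1)] input_record(4)[OF l(1), of i] by (simp add: input_at_def)
            subgoal using off_bound[OF l(1)] .
            subgoal using length_tlist_le[OF l(1)] .
            subgoal using tlist_bounds[OF l(1)] .
            subgoal using tlist_props(2)[OF l(1)] .
            subgoal using ts .
            subgoal using R'(4) R1(7) by simp
            subgoal premises p2 for R2 h2
            proof -
              have R2: "R2 vx = vs ! r" "R2 vy = vs ! Suc r" using p2(2) R1 by simp_all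
              have "input_at h2" using p2(1) R'(3) R1(7) by (simp add: input_at_def)
              moreover have "\<forall>p<N. h2 (length input + Suc r * N + p) = ?t (Suc r) p"
                using p2(1) by (simp del: table.simps)
              ultimately show ?thesis using in_vs r ne_n by (simp add: R2 del: table.simps)
            qed
            done
        qed
        done
    qed
    subgoal using g by (simp add: glob_def)
    done
qed

lemma wp_answer:
  assumes g: "glob R" and R: "R vbase = length input"
  shows "tr answer_com (\<lambda>(R', h'). R' vans = of_bool (\<exists>p<N. 0 < h (length input + ne * N + p))) (R, h)"
  unfolding answer_com_def
  using Z(1)
  apply simp
  apply (rule wp_For[where I = "\<lambda>i R' h'. R' vans = of_bool (\<exists>p<i. 0 < h (length input + ne * N + p))"])
  subgoal by simp
  subgoal using g \<rho>' by (simp add: glob_def)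
  subgoal by simp
  subgoal premises prems for i R' h'
  proof -
    have R': "R' vbase = length input" "R' vN = N" "R' vm = ne" "R' vq = i" "h' = h"
      "R' vans = of_bool (\<exists>p<i. 0 < h (length input + ne * N + p))"
      using g R prems by (simp_all add: glob_def)
    have ex: "(\<exists>p<Suc i. 0 < h (length input + ne * N + p)) \<longleftrightarrow>
      0 < h (length input + ne * N + i) \<or> (\<exists>p<i. 0 < h (length input + ne * N + p))"
      by (auto simp: less_Suc_eq)
    show ?thesis unfolding ex using Z(1) by (cases "0 < h (length input + ne * N + i)") (simp_all add: R')
  qed
  subgoal using g by (simp add: glob_def)
  done

theorem wp_etc:
  assumes h: "\<And>i. h i = (if i < length input then input ! i else 0)"
  shows "tr etc_com (\<lambda>(R', h'). R' vans = of_bool (ETC G d1 d2 k)) (R, h)"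
proof -
  have hi: "input_at h" using h by (simp add: input_at_def)
  show ?thesis unfolding etc_com_def wp_simps(3)
    apply (rule wp_conseq[OF wp_header[OF hi]])
    subgoal premises p1 for R1 h1
    proof -
      have R1: "R1 vn = n" "R1 vm = ne" "h1 = h" using p1(1) by simp_all
      show ?thesis
        apply (rule wp_conseq[OF wp_endpoint[of _ R1]])
        using hi R1 apply (simp_all)[3]
        subgoal premises p2 for R2 h2
        proof -
          have R2: "R2 vn = n" "R2 vk = k" "R2 vd1 = d1" "R2 vd2 = d2" "R2 vm = ne" "R2 vsig = sig" "R2 vT = T"
            "R2 vbase = length input" "R2 vprev = n" "h2 = h"
            using p1(1) p2 by (simp_all add: endpoint_com_def)
          have x: "R2 vx < n" "degree (R2 vx) = 1" using p2(1) by simp_all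
          obtain vs where vs: "path_graph G vs" "length vs = n" "vs ! 0 = R2 vx"
            using obtain_path_from[OF x(2,1)] by blast
          show ?thesis
            apply (rule wp_conseq[OF wp_setup[of R2 "length input"]])
            using R2 apply (simp_all)[5]
            subgoal premises p3 for R3 h3
            proof -
              have R3: "glob R3" "R3 vbase = length input" "R3 vx = vs ! 0" "R3 vprev = n"
                "h3 = h(length input := k + 1)"
                using p3(1,2) R2 vs(3) by (simp_all add: glob_def setup_com_def)
              have "input_at h3" using hi R3(5) by (simp add: input_at_def)
              moreover have "h3 (length input + p) = (if p = 0 then k + 1 else 0)" for p
                using h R3(5) by simp
              ultimately show ?thesis
                apply (intro wp_conseq[OF wp_rows[OF R3(1,2,3,4) vs(1,2)]])
                subgoal by simp
                subgoal by simp
                subgoal premises p4 for R4 h4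
                proof -
                  have R4: "glob R4" "R4 vbase = length input"
                    using p4(4) R3 by (simp_all add: glob_def rows_com_def)
                  interpret P: path_graph G vs by (rule vs)
                  have "card (P.tms r) \<le> sig" if "r < length vs - 1" for r
                  proof -
                    have "P.vpair r r \<in> tg_edges G" using P.edge_iff[of r r] that by simp
                    then obtain l where l: "l < ne" "edge l = P.vpair r r" using edges_eq by force
                    have "card (P.tms r) = length (tlist l)"
                      using tlist_props(1,2)[OF l(1)] l(2) distinct_card unfolding P.tms_def by metis
                    then show ?thesis using length_tlist_le[OF l(1)] by simp
                  qed
                  from P.ETC_iff_table[OF d this pos(1), of k]
                  have "ETC G d1 d2 k \<longleftrightarrow> (\<exists>q<N. 0 < table (compat d2 T K sig)
                      (state_cost d1 T K sig P.tms) N k ne q)"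
                    using vs(2) n_gt ne_eq by simp
                  moreover have "P.tms = times_of vs" by (rule ext) (simp add: P.tms_def P.vpair_def times_of_def)
                  ultimately have eq: "ETC G d1 d2 k \<longleftrightarrow> (\<exists>p<N. 0 < h4 (length input + ne * N + p))"
                    using p4(3) by (simp cong: conj_cong)
                  show ?thesis unfolding eq by (rule wp_answer[OF R4])
                qed
                done
            qed
            done
        qed
        done
    qed
    done
qed

end

section \<open>Running time and word size\<close>

text \<open>As \<open>weight\<close> depends only on the program, it provides the constant of the O-notation.\<close>

primrec weight :: "com \<Rightarrow> nat" where
  "weight (Asg x e) = Suc (length (comp_expr 64 e))"
| "weight (Sto a e) = Suc (length (comp_expr 64 a) + length (comp_expr 65 e))"
| "weight (c ;; d) = weight c + weight d"
| "weight (Cond e c d) = length (comp_expr 64 e) + 2 + weight c + weight d"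
| "weight Skip = 0"
| "weight (For r x c) = weight c + 8"

text \<open>The largest product of loop bounds along a chain of nested loops.\<close>

primrec iters :: "(nat \<Rightarrow> nat) \<Rightarrow> com \<Rightarrow> nat" where
  "iters \<rho> (Asg x e) = 1"
| "iters \<rho> (Sto a e) = 1"
| "iters \<rho> (c ;; d) = max (iters \<rho> c) (iters \<rho> d)"
| "iters \<rho> (Cond e c d) = max (iters \<rho> c) (iters \<rho> d)"
| "iters \<rho> Skip = 1"
| "iters \<rho> (For r x c) = \<rho> x * iters \<rho> c"

text \<open>As all loop bounds are at least 1, constant overheads and commands in sequence can be
  charged to the deepest chain of loops, at the price of a factor that the program alone
  determines.\<close>

lemma cost_bound_le:
  assumes "\<And>x. 1 \<le> \<rho> x"
  shows "cost_bound \<rho> c \<le> weight c * iters \<rho> c \<and> 1 \<le> iters \<rho> c"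
proof (induction c)
  case (Seq c d)
  let ?m = "max (iters \<rho> c) (iters \<rho> d)"
  have "weight c * iters \<rho> c \<le> weight c * ?m" "weight d * iters \<rho> d \<le> weight d * ?m"
    by (intro mult_le_mono2 max.cobounded1 max.cobounded2)+
  moreover have "1 \<le> ?m" using Seq by auto
  ultimately show ?case
    using Seq unfolding cost_bound.simps weight.simps iters.simps add_mult_distrib by linarith
next
  case (Cond e c d)
  let ?m = "max (iters \<rho> c) (iters \<rho> d)"
  have "weight c * iters \<rho> c \<le> weight c * ?m" "weight d * iters \<rho> d \<le> weight d * ?m"
    by (intro mult_le_mono2 max.cobounded1 max.cobounded2)+
  moreover have "1 \<le> ?m" using Cond by auto
  then have "length (comp_expr 64 e) + 2 \<le> (length (comp_expr 64 e) + 2) * ?m"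
    by (metis mult.right_neutral mult_le_mono2)
  ultimately show ?case using Cond \<open>1 \<le> ?m\<close>
    unfolding cost_bound.simps weight.simps iters.simps add_mult_distrib by linarith
next
  case (For r x c)
  have 1: "1 \<le> \<rho> x" "1 \<le> iters \<rho> c" using assms For by auto
  \<comment> \<open>The entry cost 4 is charged again in every round; with the 4 of the round itself
    this gives the 8 in \<open>weight\<close>.\<close>
  have "cost_bound \<rho> (For r x c) \<le> \<rho> x * 4 + \<rho> x * (weight c * iters \<rho> c + 4)"
    using 1 For unfolding cost_bound.simps by (intro add_mono mult_le_mono2) auto
  also have "\<dots> = \<rho> x * (weight c * iters \<rho> c + 8)" by (simp add: algebra_simps)
  also have "\<dots> \<le> \<rho> x * (weight c * iters \<rho> c + 8 * iters \<rho> c)" using 1 by (intro mult_le_mono2) simp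
  also have "\<dots> = weight (For r x c) * iters \<rho> (For r x c)" by (simp add: algebra_simps)
  finally show ?case using 1 by (simp add: Suc_le_eq)
qed auto

lemmas com_defs = etc_com_def header_com_def endpoint_com_def setup_com_def rows_com_def find_com_def
  row_com_def best_com_def compat_com_def compare_com_def cost_com_def pair_com_def hit_com_def window_com_def
  covered_com_def decode_com_def answer_com_def same_expr_def gap_expr_def

text \<open>The degree 6 is enough for table addresses and for products used as conjunctions. It
  enters the word size, since \<open>Z ^ 6\<close> has to fit into a word.\<close>

lemma wf_etc_com: "wf_com 6 etc_com"
  by (simp add: com_defs)

definition loop_bounds :: "nat \<Rightarrow> nat \<Rightarrow> nat \<Rightarrow> nat \<Rightarrow> nat \<Rightarrow> nat" where
  "loop_bounds n \<sigma> T N = (\<lambda>_. n)(vsig := \<sigma>, vlen := \<sigma>, vT := T, vN := N)"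

lemma iters_etc_com:
  assumes "0 < n" "0 < \<sigma>" "0 < T" "n * T \<le> N"
  shows "iters (loop_bounds n \<sigma> T N) etc_com \<le> n * N * N * (\<sigma> * \<sigma>)"
proof -
  have "n * 1 \<le> n * T" using assms by (intro mult_le_mono2) simp
  then have N: "1 \<le> N" "n \<le> N" "n * T \<le> N" using assms by linarith+
  \<comment> \<open>The factors on the right belong to the dominant chain: path edges, states,
    predecessors, and the slots of two states. Other chains are compared with it factor by factor,
    those for pricing a state using \<open>n * T \<le> N\<close>.\<close>
  have main: "a * b * c * (d * e) \<le> n * N * N * (\<sigma> * \<sigma>)"
    if "a \<le> n" "b \<le> N" "c \<le> N" "d \<le> \<sigma>" "e \<le> \<sigma>" for a b c d e
    using that by (intro mult_le_mono)
  show ?thesis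
    using assms N main[of n N "n * T" \<sigma> \<sigma>] main[of n N "n * T" \<sigma> 1] main[of n N n \<sigma> \<sigma>]
      main[of n N N \<sigma> \<sigma>] main[of n N N \<sigma> 1] main[of n 1 1 1 1] main[of n n 1 1 1] main[of 1 1 1 \<sigma> 1]
      main[of 1 N 1 1 1] main[of n N 1 1 1] main[of 1 1 1 1 1] main[of n N n \<sigma> 1] main[of n N n 1 1]
      main[of n N N 1 1] main[of n N "n * T" 1 1]
    by (simp add: com_defs loop_bounds_def nat_mult_max_right Suc_le_eq ac_simps)
qed

section \<open>From the size of an instance to word size and running time\<close>

context etc_input
begin

abbreviation "size_bound \<equiv> n * (n * lifetime G * lifetime G) ^ sig * (n * lifetime G * lifetime G) ^ sig * (sig * sig)"

text \<open>There are fewer than \<open>n\<close> records, and as \<open>sig\<close> is positive,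
  the three leading words of a record are at most \<open>3 * sig\<close>.\<close>

lemma length_input_le: "length input \<le> 5 + 4 * (n * sig)"
proof -
  have "i \<le> ne \<Longrightarrow> off i \<le> 5 + i * (3 + sig)" for i
  proof (induction i)
    case (Suc i)
    then show ?case using off_Suc[of i] length_tlist_le[of i] by simp
  qed simp
  from this[of ne] have "length input \<le> 5 + ne * (3 + sig)" by (simp add: off_ne)
  also have "ne * (3 + sig) \<le> n * (4 * sig)" using ne_eq sig_pos by (intro mult_le_mono) auto
  finally show ?thesis by simp
qed

lemma lifetime_pos: "0 < lifetime G"
  using sig_pos sig_le_lifetime by linarith

lemma decides:
  assumes M: "size_bound \<le> M" "\<And>x. x \<in> set input \<Longrightarrow> x \<le> M" and w: "M ^ 13 \<le> 2 ^ w"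
  shows "decides_within w (compile 0 etc_com) input (ETC G d1 d2 k) (weight etc_com * size_bound)"
proof -
  let ?T = "lifetime G"
  define N where "N = (n * ?T * ?T) ^ sig"
  have p: "1 \<le> n" "1 \<le> ?T" "1 \<le> sig" "sig \<le> ?T" "2 \<le> n"
    using n_gt lifetime_pos sig_pos sig_le_lifetime by auto
  have KN: "n * ?T * ?T \<le> N" unfolding N_def using p self_le_power[of "n * ?T * ?T" sig] by (simp add: Suc_le_eq)
  moreover have "n * ?T * 1 \<le> n * ?T * ?T" "n * 1 \<le> n * ?T" using p by (intro mult_le_mono2; simp)+
  ultimately have nTN: "n * ?T \<le> N" and nN: "n \<le> N" by linarith+
  have B: "size_bound = n * N * N * (sig * sig)" by (simp add: N_def)
  have ss: "1 * 1 \<le> sig * sig" using p by (intro mult_le_mono)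
  have "n * N * 1 * (1 * 1) \<le> n * N * N * (sig * sig)"
    using p nN ss by (intro mult_le_mono) auto
  then have nNM: "n * N \<le> M" using M(1) unfolding B by linarith
  have "2 * N \<le> n * N" using p by (intro mult_le_mono1)
  then have "2 * N \<le> M" using nNM by linarith
  moreover have "2 * 2 * 2 * (1 * 1) \<le> n * N * N * (sig * sig)"
    using p nN ss by (intro mult_le_mono) auto
  ultimately have M8: "8 \<le> M" "2 * N \<le> M" using M(1) unfolding B by linarith+
  \<comment> \<open>As \<open>M\<close> is at least 8, the square absorbs the constant factors in
    the bounds on stored values.\<close>
  define Z where "Z = M ^ 2"
  have MZ: "8 * M \<le> Z" using M8 mult_le_mono1[of 8 M M] by (simp add: Z_def power2_eq_square)
  have hd: "n \<le> M" "k \<le> M" "d1 \<le> M" "d2 \<le> M" using M(2) by (auto simp: input_def)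
  have "1 * ?T \<le> n * ?T" using p by (intro mult_le_mono1)
  then have nT: "n * ?T \<le> M" "?T \<le> M" using nTN M8 by linarith+
  have "n * sig \<le> n * ?T" using p by (intro mult_le_mono2)
  then have ns: "n * sig \<le> M" using nT by linarith
  define \<rho> where "\<rho> = loop_bounds n sig ?T N"
  have \<rho>1: "1 \<le> \<rho> x" for x using p nN by (auto simp: \<rho>_def loop_bounds_def)
  interpret etc_run G es n k d1 d2 Z \<rho>
  proof unfold_locales
    show "n * (?T + etc_input.sig es) \<le> Z" using nT ns MZ by (simp add: add_mult_distrib2)
    show "(n * ?T * ?T) ^ etc_input.sig es \<le> Z" using M8 MZ by (simp add: N_def)
    show "length input \<le> Z" using length_input_le ns MZ M8 by linarith
    show "\<forall>x\<in>set input. x \<le> Z" using M(2) MZ by fastforce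
  qed (use p d hd nT MZ M8 ne_eq in \<open>auto simp: \<rho>_def loop_bounds_def N_def\<close>)
  let ?h = "\<lambda>i. if i < length input then input ! i else 0"
  let ?s0 = "init_state w input"
  \<comment> \<open>The origin of the exponent 13: degree 6 over \<open>Z = M ^ 2\<close> gives
    \<open>M ^ 12\<close>, and one more factor makes the inequality strict.\<close>
  have Zw: "Z ^ 6 < 2 ^ w"
  proof -
    have "Z ^ 6 = M ^ 12" by (simp add: Z_def flip: power_mult)
    also have "\<dots> < M ^ 13" using M8 by (intro power_strict_increasing) auto
    finally show ?thesis using w by simp
  qed
  have in_w: "input ! i < 2 ^ w" if "i < length input" for i
    using M(2)[OF nth_mem[OF that]] w M8 power_strict_increasing[of 1 13 M] by simp
  have mem: "mem ?s0 = ?h" using in_w by (auto simp: init_state_def fun_eq_iff)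
  have sm: "small Z ((\<lambda>_. 0), ?h)" using Z' nth_mem by (auto simp: small_def)
  have wp: "wp Z \<rho> etc_com (\<lambda>(R', h'). R' vans = of_bool (ETC G d1 d2 k)) ((\<lambda>_. 0), ?h)"
    by (rule wp_etc) simp
  have "\<exists>s'. reach w (compile 0 etc_com) (cost_bound \<rho> etc_com) ?s0 s' \<and>
      agree (sem etc_com ((\<lambda>_. 0), ?h)) (0 + length (compile 0 etc_com)) s'"
    by (rule conjunct2[OF comp_correct[OF _ wf_etc_com _ sm]])
      (use wp Z(1) Zw mem in \<open>auto simp: wp_def code_at_def agree_def init_state_def\<close>)
  then obtain s' where s': "reach w (compile 0 etc_com) (cost_bound \<rho> etc_com) ?s0 s'"
    "agree (sem etc_com ((\<lambda>_. 0), ?h)) (length (compile 0 etc_com)) s'" by auto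
  have "regs s' 0 = of_bool (ETC G d1 d2 k)" "halted (compile 0 etc_com) s'"
    using s'(2) wp by (auto simp: wp_def agree_def halted_def case_prod_beta)
  moreover have "cost_bound \<rho> etc_com \<le> weight etc_com * size_bound"
  proof -
    have "iters \<rho> etc_com \<le> size_bound"
      unfolding B \<rho>_def using p nTN by (intro iters_etc_com) auto
    then show ?thesis using cost_bound_le[of \<rho> etc_com, OF \<rho>1] by (meson le_trans mult_le_mono2)
  qed
  then have "reach w (compile 0 etc_com) (weight etc_com * size_bound) ?s0 s'"
    by (rule reach_mono[OF s'(1)])
  ultimately show ?thesis unfolding decides_within_def reach_def Let_def by auto
qed

end

lemma decides_within_mono: "decides_within w P xs a t \<Longrightarrow> t \<le> t' \<Longrightarrow> decides_within w P xs a t'"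
  unfolding decides_within_def using le_trans by blast

theorem theorem2:
  shows "\<exists>(P :: program) (c :: nat) (C :: nat).
    \<forall>(\<P> :: nat temporal_graph) (\<Delta>\<^sub>1 :: nat) (\<Delta>\<^sub>2 :: nat) (k :: nat) (\<sigma> :: nat) (n :: nat) (T :: nat)
      (xs :: nat list) (w :: nat).
      is_temporal_graph \<P> \<and> starts_at_one \<P> \<and>
      is_path_graph (tg_verts \<P>) (tg_edges \<P>) \<and> n = card (tg_verts \<P>) \<and>
      T = lifetime \<P> \<and>
      0 < \<Delta>\<^sub>1 \<and> 0 < \<Delta>\<^sub>2 \<and> 0 < k \<and>
      (\<forall>e\<in>tg_edges \<P>. card (tg_times \<P> e) \<le> \<sigma>) \<and>
      encodes_ETC xs \<P> \<Delta>\<^sub>1 \<Delta>\<^sub>2 k \<and>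
      sufficient_word_size c xs (T ^ (4 * \<sigma>) * \<sigma> ^ 2 * n ^ (2 * \<sigma> + 1)) w
      \<longrightarrow> decides_within w P xs (ETC \<P> \<Delta>\<^sub>1 \<Delta>\<^sub>2 k)
            (C * (T ^ (4 * \<sigma>) * \<sigma> ^ 2 * n ^ (2 * \<sigma> + 1)))"
proof (rule exI[of _ "compile 0 etc_com"], rule exI[of _ 13], rule exI[of _ "weight etc_com"],
    intro allI impI, elim conjE)
  fix \<P> :: "nat temporal_graph" and \<Delta>\<^sub>1 \<Delta>\<^sub>2 k \<sigma> n T w :: nat and xs :: "nat list"
  let ?B = "T ^ (4 * \<sigma>) * \<sigma> ^ 2 * n ^ (2 * \<sigma> + 1)"
  assume G: "is_temporal_graph \<P>" "starts_at_one \<P>" "is_path_graph (tg_verts \<P>) (tg_edges \<P>)"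
    and n: "n = card (tg_verts \<P>)" and T: "T = lifetime \<P>" and \<Delta>: "0 < \<Delta>\<^sub>1" "0 < \<Delta>\<^sub>2"
    and \<sigma>: "\<forall>e\<in>tg_edges \<P>. card (tg_times \<P> e) \<le> \<sigma>"
    and enc: "encodes_ETC xs \<P> \<Delta>\<^sub>1 \<Delta>\<^sub>2 k" and w: "sufficient_word_size 13 xs ?B w"
  from enc obtain n' es where es: "tg_verts \<P> = {0..<n'}"
      "distinct (map (\<lambda>(u, v, ts). {u, v}) es)" "tg_edges \<P> = set (map (\<lambda>(u, v, ts). {u, v}) es)"
      "\<forall>(u, v, ts)\<in>set es. ts = sorted_list_of_set (tg_times \<P> {u, v})"
      "xs = [n', k, \<Delta>\<^sub>1, \<Delta>\<^sub>2, length es] @ concat (map (\<lambda>(u, v, ts). u # v # length ts # ts) es)"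
    unfolding encodes_ETC_def by blast
  have n': "n' = n" using n es(1) by simp
  interpret etc_input \<P> es n k \<Delta>\<^sub>1 \<Delta>\<^sub>2
    using G \<Delta> es n' by unfold_locales auto
  have xs: "xs = input" by (simp add: es(5) n' input_def rec_def)
  have sig: "sig \<le> \<sigma>" using sig_le \<sigma> by blast
  have "size_bound = T ^ (4 * sig) * sig ^ 2 * n ^ (2 * sig + 1)"
  proof -
    have "4 * sig = sig + sig + (sig + sig)" "2 * sig + 1 = Suc (sig + sig)" by simp_all
    then have e: "T ^ (4 * sig) = T ^ sig * T ^ sig * (T ^ sig * T ^ sig)" "n ^ (2 * sig + 1) = n * (n ^ sig * n ^ sig)"
      by (simp_all only: power_add power_Suc)
    show ?thesis unfolding e power2_eq_square power_mult_distrib T[symmetric] by (simp only: ac_simps)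
  qed
  also have "\<dots> \<le> ?B"
    using sig n_gt lifetime_pos by (intro mult_le_mono power_increasing power_mono) (auto simp: T)
  finally have B: "size_bound \<le> ?B" .
  let ?M = "Max (insert ?B (set xs))"
  have "size_bound \<le> ?M" using B by (intro le_trans[OF B] Max_ge) auto
  moreover have "x \<le> ?M" if "x \<in> set input" for x using that by (intro Max_ge) (auto simp: xs)
  moreover have "?M ^ 13 \<le> 2 ^ w" using w by (simp add: sufficient_word_size_def)
  ultimately have "decides_within w (compile 0 etc_com) xs (ETC \<P> \<Delta>\<^sub>1 \<Delta>\<^sub>2 k) (weight etc_com * size_bound)"
    unfolding xs by (rule decides)
  then show "decides_within w (compile 0 etc_com) xs (ETC \<P> \<Delta>\<^sub>1 \<Delta>\<^sub>2 k) (weight etc_com * ?B)"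
    by (rule decides_within_mono) (use B in simp)
qed

end
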